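(* Let $G^J_1(\mathbb{R})$ be the real Jacobi group with its S-coordinates $(x,y,\theta,p,q,\kappa)$, let $\alpha,\beta,\gamma,\delta>0$, and let the one-forms $\lambda_i$ and vector fields $L^i$ ($i=1,\dots,6$) be as defined in the context. (a) The composition law $gg'=g_1$ in S-coordinates is the following. If $g$ has S-coordinates $(x,y,\theta,p,q,\kappa)$, with $a=y^{1/2}\cos\theta-xy^{-1/2}\sin\theta$, $b=y^{1/2}\sin\theta+xy^{-1/2}\cos\theta$, $c=-y^{-1/2}\sin\theta$, $d=y^{-1/2}\cos\theta$ and $(\lambda,\mu)=(pa+qc,\,pb+qd)$, and $g'$ has S-coordinates $(x',y',\theta',p',q',\kappa')$, then, with $\Lambda=(cx'+d)^2+(cy')^2$, $$x_1+\mathrm{i}y_1=\frac{(ax'+b)(cx'+d)+ac\,y'^2+\mathrm{i}y'}{\Lambda},$$ $$\sin\theta_1=\frac{(cx'+d)\sin\theta'-cy'\cos\theta'}{\sqrt{\Lambda}},\qquad \cos\theta_1=\frac{cy'\sin\theta'+(cx'+d)\cos\theta'}{\sqrt{\Lambda}},$$ $$(p_1,q_1)=(p+dp'-cq',\ q-bp'+aq'),\qquad \kappa_1=\kappa+\kappa'+\lambda q'-\mu p'.$$ (b) The left-invariant metric on $G^J_1(\mathbb{R})$ in S-coordinates is $$\mathrm{d}s^2_{G^J_1(\mathbb{R})}=\sum_{i=1}^6\lambda_i^2=\alpha\frac{\mathrm{d}x^2+\mathrm{d}y^2}{y^2}+\beta\Big(\frac{\mathrm{d}x}{y}+2\,\mathrm{d}\theta\Big)^2+\frac{\gamma}{y}\big[\mathrm{d}q^2+(x^2+y^2)\mathrm{d}p^2+2x\,\mathrm{d}p\,\mathrm{d}q\big]+\delta(\mathrm{d}\kappa-p\,\mathrm{d}q+q\,\mathrm{d}p)^2.$$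 Its matrix in the variables $(x,y,\theta,p,q,\kappa)$ is symmetric and block-diagonal, its nonzero entries (up to symmetry) being $g_{xx}=\frac{\alpha+\beta}{y^2}$, $g_{yy}=\frac{\alpha}{y^2}$, $g_{x\theta}=\frac{2\beta}{y}$, $g_{\theta\theta}=4\beta$, $g'_{pp}=\gamma\frac{x^2+y^2}{y}+\delta q^2$, $g'_{pq}=\gamma\frac{x}{y}-\delta pq$, $g'_{qq}=\frac{\gamma}{y}+\delta p^2$, $g'_{p\kappa}=\delta q$, $g'_{q\kappa}=-\delta p$, $g'_{\kappa\kappa}=\delta$. (c) $\langle\lambda_i\,|\,L^j\rangle=\delta_{ij}$ for $i,j=1,\dots,6$. The vector fields $L^1,\dots,L^6$ are orthonormal with respect to this metric and verify the commutation relations $$[L^1,L^2]=-\tfrac{\sqrt\beta}{\alpha}L^3,\quad [L^2,L^3]=\tfrac{1}{2\sqrt\beta}L^1,\quad [L^3,L^1]=\tfrac1{\sqrt\beta}L^2,$$ $$[L^1,L^4]=-\tfrac1{2\sqrt\alpha}L^5,\quad [L^1,L^5]=-\tfrac1{2\sqrt\alpha}L^4,\quad [L^2,L^4]=-\tfrac1{2\sqrt\alpha}L^4,\quad [L^2,L^5]=\tfrac1{2\sqrt\alpha}L^5,$$ $$[L^3,L^4]=-\tfrac1{2\sqrt\alpha}L^5,\quad [L^3,L^5]=\tfrac1{2\sqrt\beta}L^4,\quad [L^4,L^5]=\tfrac{2\sqrt\delta}{\gamma}L^6,\quad [L^i,L^6]=0\ (1\le i\le5).$$ (d) Depending on the values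 of the parameters $\alpha,\beta,\gamma,\delta$ (some of them now being allowed to vanish in the displayed formula for the metric, the result being regarded as a tensor in the variables that still occur), one has an invariant metric on the following manifolds: 1) the Siegel upper half-plane $\mathcal{X}_1$ (variables $x,y$) if $\beta,\gamma,\delta=0$; 2) the group $\mathrm{SL}(2,\mathbb{R})$ (variables $x,y,\theta$) if $\gamma,\delta=0$, $\beta\neq0$; 3) the Siegel--Jacobi upper half-plane $\mathcal{X}^J_1$ (variables $x,y,p,q$) if $\beta,\delta=0$; 4) the extended Siegel--Jacobi upper half-plane $\tilde{\mathcal{X}}^J_1$ (variables $x,y,p,q,\kappa$) if $\beta=0$; 5) the Jacobi group $G^J_1(\mathbb{R})$ if $\alpha\beta\gamma\delta\neq0$.
   Context: The real Jacobi group $G^J_1(\mathbb{R})$ consists of triples $(M,X,\kappa)$, $M=\begin{pmatrix}a&b\\ c&d\end{pmatrix}\in\mathrm{SL}(2,\mathbb{R})$, $X=(\lambda,\mu)\in\mathbb{R}^2$ (row vector), $\kappa\in\mathbb{R}$, with product $(M,X,\kappa)(M',X',\kappa')=\big(MM',\,XM'+X',\,\kappa+\kappa'+\det\begin{pmatrix}XM'\\ X'\end{pmatrix}\big)$. Equivalently it is the group of matrices $$\begin{pmatrix}a&0&b&q\\ \lambda&1&\mu&\kappa\\ c&0&d&-p\\ 0&0&0&1\end{pmatrix},\qquad (p,q):=XM^{-1}.$$ The S-coordinates of $(M,X,\kappa)$ are $(x,y,\theta,p,q,\kappa)$, where $(p,q)=XM^{-1}$ and $(x,y,\theta)$, $y>0$,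 is given by the Iwasawa decomposition $M=\begin{pmatrix}1&x\\ 0&1\end{pmatrix}\begin{pmatrix}y^{1/2}&0\\ 0&y^{-1/2}\end{pmatrix}\begin{pmatrix}\cos\theta&\sin\theta\\ -\sin\theta&\cos\theta\end{pmatrix}$. One-forms: $\lambda_1=\frac{\sqrt\alpha}{y}(\cos2\theta\,\mathrm{d}x+\sin2\theta\,\mathrm{d}y)$, $\lambda_2=\frac{\sqrt\alpha}{y}(-\sin2\theta\,\mathrm{d}x+\cos2\theta\,\mathrm{d}y)$, $\lambda_3=\sqrt\beta\big(\frac{\mathrm{d}x}{y}+2\mathrm{d}\theta\big)$, $\lambda_4=\sqrt\gamma\,(a\,\mathrm{d}p+c\,\mathrm{d}q)$, $\lambda_5=\sqrt\gamma\,(b\,\mathrm{d}p+d\,\mathrm{d}q)$, $\lambda_6=\sqrt\delta\,(\mathrm{d}\kappa-p\,\mathrm{d}q+q\,\mathrm{d}p)$, where $a,b,c,d$ are the entries of $M$ as functions of $(x,y,\theta)$. Vector fields: $L^1=\frac1{\sqrt\alpha}\big(y\cos2\theta\,\partial_x+y\sin2\theta\,\partial_y-\frac12\cos2\theta\,\partial_\theta\big)$, $L^2=\frac1{\sqrt\alpha}\big(-y\sin2\theta\,\partial_x+y\cos2\theta\,\partial_y+\frac12\sin2\theta\,\partial_\theta\big)$, $L^3=\frac1{2\sqrt\beta}\partial_\theta$, $L^4=\frac1{\sqrt\gamma}\big(d\,\partial_p-b\,\partial_q-(pb+qd)\partial_\kappa\big)$, $L^5=\frac1{\sqrt\gamma}\big(-c\,\partial_p+a\,\partial_q+(pa+qc)\partial_\kappa\big)$,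 $L^6=\frac1{\sqrt\delta}\partial_\kappa$. Homogeneous spaces and actions, obtained from left multiplication by dropping coordinates: $\mathcal{X}_1=\{\tau=x+\mathrm{i}y:\ y>0\}$ with $\mathrm{SL}(2,\mathbb{R})$ acting by $\tau\mapsto\frac{a\tau+b}{c\tau+d}$; $\mathrm{SL}(2,\mathbb{R})$ acting on itself by left multiplication; $\tilde{\mathcal{X}}^J_1=G^J_1(\mathbb{R})/\mathrm{SO}(2)\cong\mathcal{X}_1\times\mathbb{R}^3$ with coordinates $(x,y,p,q,\kappa)$ and $G^J_1(\mathbb{R})$ acting by left multiplication (the formulas for $x_1,y_1,p_1,q_1,\kappa_1$ in (a)); $\mathcal{X}^J_1=G^J_1(\mathbb{R})/(\mathrm{SO}(2)\times\mathbb{R})\cong\mathcal{X}_1\times\mathbb{R}^2$ with coordinates $(x,y,p,q)$ ($\mathbb{R}$ being the subgroup of elements $(1,0,\kappa)$), with action through the quotient group of pairs $(M,X)$ (the formulas for $x_1,y_1,p_1,q_1$ in (a)).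
   Formalization: Two printed commutators are false for the given vector fields and are corrected: [L^2,L^3] = (1/√β) L^1 instead of (1/(2√β)) L^1, and [L^3,L^4] = −(1/(2√β)) L^5 instead of −(1/(2√α)) L^5. *)

theory Defs
  imports "HOL-Analysis.Analysis" "HOL-Algebra.Left_Coset"
begin

section \<open>The real Jacobi group\<close>

type_synonym jac = "(real^2^2) \<times> (real^2) \<times> real"

definition mat2 :: "real \<Rightarrow> real \<Rightarrow> real \<Rightarrow> real \<Rightarrow> real^2^2" where
  "mat2 a b c d = vector [vector [a, b], vector [c, d]]"

definition SL2 :: "(real^2^2) set" where
  "SL2 = {M. det M = 1}"

definition jac_mult :: "jac \<Rightarrow> jac \<Rightarrow> jac" where
  "jac_mult = (\<lambda>(M, X, k) (M', X', k').
     (M ** M', X v* M' + X', k + k' + det (vector [X v* M', X'] :: real^2^2)))"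

definition jacobi :: "jac monoid" where
  "jacobi = \<lparr>carrier = SL2 \<times> UNIV \<times> UNIV, mult = jac_mult, one = (mat 1, 0, 0)\<rparr>"

definition SO2 :: "jac set" where
  "SO2 = {(M, 0, 0) | M. orthogonal_matrix M \<and> det M = 1}"

definition SO2_R :: "jac set" where
  "SO2_R = {(M, 0, k) | M k. orthogonal_matrix M \<and> det M = 1}"


section \<open>S-coordinates\<close>

text \<open>Both points and tangent vectors are written in the order \<open>(x, y, \<theta>, p, q, \<kappa>)\<close>; a tangent
  vector is the tuple of its coefficients with respect to \<open>\<partial>\<^sub>x, \<partial>\<^sub>y, \<partial>\<^sub>\<theta>, \<partial>\<^sub>p, \<partial>\<^sub>q, \<partial>\<^sub>\<kappa>\<close>, equivalently of
  the values of \<open>dx, dy, d\<theta>, dp, dq, d\<kappa>\<close> on it.\<close>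

type_synonym scoord = "real \<times> real \<times> real \<times> real \<times> real \<times> real"

definition S_domain :: "scoord set" where
  "S_domain = {(x, y, \<theta>, p, q, \<kappa>). y > 0}"

definition iwasawa :: "real \<Rightarrow> real \<Rightarrow> real \<Rightarrow> real^2^2" where
  "iwasawa x y \<theta> =
     mat2 1 x 0 1 ** mat2 (sqrt y) 0 0 (1 / sqrt y)
     ** mat2 (cos \<theta>) (sin \<theta>) (- sin \<theta>) (cos \<theta>)"

text \<open>The angle \<open>\<theta>\<close> ranges over all of \<open>\<real>\<close>, so it is determined by the group element only modulo
  \<open>2\<pi>\<close>. This is why coordinates are relations between points and tuples.\<close>

definition has_S_coords :: "jac \<Rightarrow> scoord \<Rightarrow> bool" where
  "has_S_coords = (\<lambda>(M, X, k) (x, y, \<theta>, p, q, \<kappa>).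
     y > 0 \<and> M = iwasawa x y \<theta> \<and> vector [p, q] = X v* matrix_inv M \<and> \<kappa> = k)"

definition entry_a :: "real \<Rightarrow> real \<Rightarrow> real \<Rightarrow> real" where
  "entry_a x y \<theta> = sqrt y * cos \<theta> - x / sqrt y * sin \<theta>"

definition entry_b :: "real \<Rightarrow> real \<Rightarrow> real \<Rightarrow> real" where
  "entry_b x y \<theta> = sqrt y * sin \<theta> + x / sqrt y * cos \<theta>"

definition entry_c :: "real \<Rightarrow> real \<Rightarrow> real \<Rightarrow> real" where
  "entry_c x y \<theta> = - (1 / sqrt y) * sin \<theta>"

definition entry_d :: "real \<Rightarrow> real \<Rightarrow> real \<Rightarrow> real" where
  "entry_d x y \<theta> = 1 / sqrt y * cos \<theta>"


section \<open>One-forms, vector fields and the metric\<close>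

definition one_form :: "real \<Rightarrow> real \<Rightarrow> real \<Rightarrow> real \<Rightarrow> nat \<Rightarrow> scoord \<Rightarrow> scoord \<Rightarrow> real" where
  "one_form \<alpha> \<beta> \<gamma> \<delta> i = (\<lambda>(x, y, \<theta>, p, q, \<kappa>) (dx, dy, d\<theta>, dp, dq, d\<kappa>).
     [sqrt \<alpha> / y * (cos (2 * \<theta>) * dx + sin (2 * \<theta>) * dy),
      sqrt \<alpha> / y * (- sin (2 * \<theta>) * dx + cos (2 * \<theta>) * dy),
      sqrt \<beta> * (dx / y + 2 * d\<theta>),
      sqrt \<gamma> * (entry_a x y \<theta> * dp + entry_c x y \<theta> * dq),
      sqrt \<gamma> * (entry_b x y \<theta> * dp + entry_d x y \<theta> * dq),
      sqrt \<delta> * (d\<kappa> - p * dq + q * dp)] ! (i - 1))"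

definition vfield :: "real \<Rightarrow> real \<Rightarrow> real \<Rightarrow> real \<Rightarrow> nat \<Rightarrow> scoord \<Rightarrow> scoord" where
  "vfield \<alpha> \<beta> \<gamma> \<delta> i = (\<lambda>(x, y, \<theta>, p, q, \<kappa>).
     let a = entry_a x y \<theta>; b = entry_b x y \<theta>; c = entry_c x y \<theta>; d = entry_d x y \<theta> in
     [(1 / sqrt \<alpha>) *\<^sub>R (y * cos (2 * \<theta>), y * sin (2 * \<theta>), - (1 / 2) * cos (2 * \<theta>), 0, 0, 0),
      (1 / sqrt \<alpha>) *\<^sub>R (- y * sin (2 * \<theta>), y * cos (2 * \<theta>), 1 / 2 * sin (2 * \<theta>), 0, 0, 0),
      (1 / (2 * sqrt \<beta>)) *\<^sub>R (0, 0, 1, 0, 0, 0),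
      (1 / sqrt \<gamma>) *\<^sub>R (0, 0, 0, d, - b, - (p * b + q * d)),
      (1 / sqrt \<gamma>) *\<^sub>R (0, 0, 0, - c, a, p * a + q * c),
      (1 / sqrt \<delta>) *\<^sub>R (0, 0, 0, 0, 0, 1)] ! (i - 1))"

text \<open>\<open>[V, W] f = V (W f) - W (V f)\<close>, in coordinates. With the fields above this gives
  \<open>[L\<^sup>2, L\<^sup>3] = (1 / sqrt \<beta>) L\<^sup>1\<close> and \<open>[L\<^sup>3, L\<^sup>4] = - (1 / (2 sqrt \<beta>)) L\<^sup>5\<close>. The published table of
  commutators has the coefficients \<open>1 / (2 sqrt \<beta>)\<close> and \<open>- (1 / (2 sqrt \<alpha>))\<close> there, which are
  misprints.\<close>

definition lie_bracket ::
  "('a::real_normed_vector \<Rightarrow> 'a) \<Rightarrow> ('a \<Rightarrow> 'a) \<Rightarrow> 'a \<Rightarrow> 'a" where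
  "lie_bracket V W u =
     frechet_derivative W (at u) (V u) - frechet_derivative V (at u) (W u)"

definition ds2 :: "real \<Rightarrow> real \<Rightarrow> real \<Rightarrow> real \<Rightarrow> scoord \<Rightarrow> scoord \<Rightarrow> real" where
  "ds2 \<alpha> \<beta> \<gamma> \<delta> = (\<lambda>(x, y, \<theta>, p, q, \<kappa>) (dx, dy, d\<theta>, dp, dq, d\<kappa>).
     \<alpha> * ((dx\<^sup>2 + dy\<^sup>2) / y\<^sup>2) + \<beta> * (dx / y + 2 * d\<theta>)\<^sup>2
     + \<gamma> / y * (dq\<^sup>2 + (x\<^sup>2 + y\<^sup>2) * dp\<^sup>2 + 2 * x * dp * dq)
     + \<delta> * (d\<kappa> - p * dq + q * dp)\<^sup>2)"

text \<open>The symmetric 2-tensor whose quadratic form is \<open>ds2\<close>.\<close>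

definition metric_tensor ::
  "real \<Rightarrow> real \<Rightarrow> real \<Rightarrow> real \<Rightarrow> scoord \<Rightarrow> scoord \<Rightarrow> scoord \<Rightarrow> real" where
  "metric_tensor \<alpha> \<beta> \<gamma> \<delta> u v w =
     (ds2 \<alpha> \<beta> \<gamma> \<delta> u (v + w) - ds2 \<alpha> \<beta> \<gamma> \<delta> u v - ds2 \<alpha> \<beta> \<gamma> \<delta> u w) / 2"

definition coord_vec :: "nat \<Rightarrow> scoord" where
  "coord_vec i =
     [(1, 0, 0, 0, 0, 0), (0, 1, 0, 0, 0, 0), (0, 0, 1, 0, 0, 0),
      (0, 0, 0, 1, 0, 0), (0, 0, 0, 0, 1, 0), (0, 0, 0, 0, 0, 1)] ! (i - 1)"

definition metric_matrix ::
  "real \<Rightarrow> real \<Rightarrow> real \<Rightarrow> real \<Rightarrow> scoord \<Rightarrow> nat \<Rightarrow> nat \<Rightarrow> real" where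
  "metric_matrix \<alpha> \<beta> \<gamma> \<delta> u i j = metric_tensor \<alpha> \<beta> \<gamma> \<delta> u (coord_vec i) (coord_vec j)"


section \<open>Invariant metrics on a manifold given by coordinates\<close>

text \<open>\<open>R m u\<close> means that the point \<open>m\<close> has coordinates \<open>u\<close>. A point may have several coordinate
  tuples (angles), but locally the coordinates are unique.\<close>

definition coord_domain :: "('m \<Rightarrow> 'c \<Rightarrow> bool) \<Rightarrow> 'c set" where
  "coord_domain R = {u. \<exists>m. R m u}"

definition coordinates_on :: "'m set \<Rightarrow> ('m \<Rightarrow> 'c::euclidean_space \<Rightarrow> bool) \<Rightarrow> bool" where
  "coordinates_on M R \<longleftrightarrow>
     {m. \<exists>u. R m u} = M \<and>
     open (coord_domain R) \<and>
     (\<forall>m m' u. R m u \<longrightarrow> R m' u \<longrightarrow> m = m') \<and>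
     (\<forall>u\<in>coord_domain R. \<exists>U. open U \<and> u \<in> U \<and>
        (\<forall>m. \<forall>v\<in>U. \<forall>w\<in>U. R m v \<longrightarrow> R m w \<longrightarrow> v = w))"

primrec Ck_on :: "nat \<Rightarrow> 'c::euclidean_space set \<Rightarrow> ('c \<Rightarrow> real) \<Rightarrow> bool" where
  "Ck_on 0 S f \<longleftrightarrow> continuous_on S f"
| "Ck_on (Suc k) S f \<longleftrightarrow>
     f differentiable_on S \<and> (\<forall>b\<in>Basis. Ck_on k S (\<lambda>u. frechet_derivative f (at u) b))"

definition riemannian_metric_on ::
  "'c::euclidean_space set \<Rightarrow> ('c \<Rightarrow> 'c \<Rightarrow> 'c \<Rightarrow> real) \<Rightarrow> bool" where
  "riemannian_metric_on D h \<longleftrightarrow>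
     (\<forall>u\<in>D. bilinear (h u) \<and> (\<forall>v w. h u v w = h u w v) \<and> (\<forall>v. v \<noteq> 0 \<longrightarrow> h u v v > 0)) \<and>
     (\<forall>v w k. Ck_on k D (\<lambda>u. h u v w))"

text \<open>\<open>f\<close> is a coordinate expression of the map \<open>T\<close> on the open set \<open>U\<close> of coordinate tuples.\<close>

definition local_expression ::
  "('m \<Rightarrow> 'c::euclidean_space \<Rightarrow> bool) \<Rightarrow> ('m \<Rightarrow> 'm) \<Rightarrow> 'c set \<Rightarrow> ('c \<Rightarrow> 'c) \<Rightarrow> bool" where
  "local_expression R T U f \<longleftrightarrow>
     open U \<and> U \<subseteq> coord_domain R \<and> f differentiable_on U \<and>
     (\<forall>u\<in>U. \<forall>m. R m u \<longrightarrow> R (T m) (f u))"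

text \<open>The second condition says that \<open>T\<close> has differentiable coordinate expressions around every
  point, whatever coordinates of the point and of its image are chosen; the third one that all
  of them pull \<open>h\<close> back to \<open>h\<close>. For \<open>T = id\<close> this contains the statement that \<open>h\<close> does
  not depend on the choice of the coordinates of a point.\<close>

definition isometry_on ::
  "'m set \<Rightarrow> ('m \<Rightarrow> 'c::euclidean_space \<Rightarrow> bool) \<Rightarrow> ('c \<Rightarrow> 'c \<Rightarrow> 'c \<Rightarrow> real) \<Rightarrow> ('m \<Rightarrow> 'm) \<Rightarrow> bool"
  where
  "isometry_on M R h T \<longleftrightarrow>
     bij_betw T M M \<and>
     (\<forall>m u w. R m u \<longrightarrow> R (T m) w \<longrightarrow> (\<exists>U f. local_expression R T U f \<and> u \<in> U \<and> f u = w)) \<and>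
     (\<forall>U f. local_expression R T U f \<longrightarrow>
        (\<forall>u\<in>U. \<forall>v w.
           h (f u) (frechet_derivative f (at u) v) (frechet_derivative f (at u) w) = h u v w))"

definition invariant_metric ::
  "'g set \<Rightarrow> ('g \<Rightarrow> 'm \<Rightarrow> 'm) \<Rightarrow> 'm set \<Rightarrow> ('m \<Rightarrow> 'c::euclidean_space \<Rightarrow> bool) \<Rightarrow>
   ('c \<Rightarrow> 'c \<Rightarrow> 'c \<Rightarrow> real) \<Rightarrow> bool" where
  "invariant_metric \<Gamma> act M R h \<longleftrightarrow>
     coordinates_on M R \<and> riemannian_metric_on (coord_domain R) h \<and>
     (\<forall>g\<in>\<Gamma>. isometry_on M R h (act g))"

text \<open>The tensor \<open>g\<close> in the variables \<open>(x, y, \<theta>, p, q, \<kappa>)\<close> involves only the variables (and their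
  differentials) retained by \<open>proj\<close>, and \<open>h\<close> is \<open>g\<close> regarded as a tensor in these variables.\<close>

definition tensor_in_variables ::
  "(scoord \<Rightarrow> 'c) \<Rightarrow> (scoord \<Rightarrow> scoord \<Rightarrow> scoord \<Rightarrow> real) \<Rightarrow> ('c \<Rightarrow> 'c \<Rightarrow> 'c \<Rightarrow> real) \<Rightarrow> bool" where
  "tensor_in_variables proj g h \<longleftrightarrow>
     (\<forall>u\<in>S_domain. \<forall>v w. g u v w = h (proj u) (proj v) (proj w))"


section \<open>The homogeneous spaces\<close>

definition upper_half_plane :: "complex set" where
  "upper_half_plane = {\<tau>. Im \<tau> > 0}"

definition moebius_act :: "real^2^2 \<Rightarrow> complex \<Rightarrow> complex" where
  "moebius_act M \<tau> =
     (of_real (M $ 1 $ 1) * \<tau> + of_real (M $ 1 $ 2)) / (of_real (M $ 2 $ 1) * \<tau> + of_real (M $ 2 $ 2))"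

definition coords_uhp :: "complex \<Rightarrow> real \<times> real \<Rightarrow> bool" where
  "coords_uhp \<tau> = (\<lambda>(x, y). y > 0 \<and> \<tau> = Complex x y)"

definition coords_SL2 :: "real^2^2 \<Rightarrow> real \<times> real \<times> real \<Rightarrow> bool" where
  "coords_SL2 M = (\<lambda>(x, y, \<theta>). y > 0 \<and> M = iwasawa x y \<theta>)"

text \<open>Cosets inherit the S-coordinates of their elements, with the non-constant ones dropped. The
  elements \<open>(1, 0, \<kappa>)\<close> act trivially on the cosets of \<open>SO2_R\<close>, so left multiplication there is an
  action of the quotient group of pairs \<open>(M, X)\<close>.\<close>

definition ext_siegel_jacobi :: "jac set set" where
  "ext_siegel_jacobi = lcosets\<^bsub>jacobi\<^esub> SO2"

definition coords_ext_siegel_jacobi ::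
  "jac set \<Rightarrow> real \<times> real \<times> real \<times> real \<times> real \<Rightarrow> bool" where
  "coords_ext_siegel_jacobi C = (\<lambda>(x, y, p, q, \<kappa>).
     C \<in> ext_siegel_jacobi \<and> (\<exists>g\<in>C. \<exists>\<theta>. has_S_coords g (x, y, \<theta>, p, q, \<kappa>)))"

definition siegel_jacobi :: "jac set set" where
  "siegel_jacobi = lcosets\<^bsub>jacobi\<^esub> SO2_R"

definition coords_siegel_jacobi :: "jac set \<Rightarrow> real \<times> real \<times> real \<times> real \<Rightarrow> bool" where
  "coords_siegel_jacobi C = (\<lambda>(x, y, p, q).
     C \<in> siegel_jacobi \<and> (\<exists>g\<in>C. \<exists>\<theta> \<kappa>. has_S_coords g (x, y, \<theta>, p, q, \<kappa>)))"

end

theory Submission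
  imports Defs
begin

text \<open>The whole statement rests on one picture: the S-coordinates \<open>u\<close> parametrize the group by an
  explicit map \<open>s_point\<close>, and \<open>has_S_coords g u\<close> only says \<open>g = s_point u\<close> and \<open>y > 0\<close>.

  Composition law. The product formulas do define a coordinate tuple, and evaluating \<open>s_point\<close> on it
  gives the product (\<open>composition_law_SL2\<close>, \<open>composition_law\<close>); and tuples with the same image
  under \<open>s_point\<close> differ only by a multiple of \<open>2 \<pi>\<close> in the angle.

  Invariance. Write \<open>M\<close> for the matrix of a group element and \<open>\<omega> = M\<^sup>-\<^sup>1 dM\<close>. Then
  \<open>\<lambda>\<^sub>1 = sqrt \<alpha> (\<omega>\<^sub>1\<^sub>2 + \<omega>\<^sub>2\<^sub>1)\<close>, \<open>\<lambda>\<^sub>2 = sqrt \<alpha> (\<omega>\<^sub>1\<^sub>1 - \<omega>\<^sub>2\<^sub>2)\<close>, \<open>\<lambda>\<^sub>3 = sqrt \<beta> (\<omega>\<^sub>1\<^sub>2 - \<omega>\<^sub>2\<^sub>1)\<close>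
  (\<open>one_form_cartan\<close>), while \<open>(\<lambda>\<^sub>4, \<lambda>\<^sub>5) = sqrt \<gamma> (dp, dq) M\<close>. Replacing \<open>M\<close> by \<open>N M\<close> and
  \<open>(dp, dq)\<close> by \<open>(dp, dq) N\<^sup>-\<^sup>1\<close> changes none of them, and the twist in the last component of the
  product is exactly what keeps \<open>\<lambda>\<^sub>6\<close> fixed (\<open>one_form_left_invariant\<close>). The metric is the sum of
  the squares of the \<open>\<lambda>\<^sub>i\<close>, hence every differentiable coordinate expression of a left translation
  pulls it back to itself (\<open>left_translation_metric\<close>), also if some parameters vanish. Such
  expressions exist through any coordinates of a point and of its image because the angle changes by minus an argument of
  \<open>c \<tau> + d\<close>, which has a smooth branch on the upper half-plane (\<open>angle_shift\<close>,
  \<open>left_translation_lift\<close>).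

  Quotients. The five manifolds are treated at once by the locale \<open>homogeneous_space\<close>: an equivariant
  surjection from the group that in coordinates is the linear map \<open>\<pi>\<close> forgetting some variables. If
  the possibly degenerate metric of the group involves only the remaining variables, then it descends;
  a coordinate expression downstairs is locally covered by one upstairs, so isometry is inherited
  (\<open>act_preserves_metric\<close>, \<open>invariant_metric_descends\<close>). What is left for each manifold is to check
  the locale assumptions and that the vanishing parameters leave a definite form in the
  remaining variables.

  Frame. Duality is a computation with \<open>det M = 1\<close> and gives orthonormality. The fields \<open>L\<^sup>1\<close>,
  \<open>L\<^sup>2\<close>, \<open>L\<^sup>3\<close> differentiate the matrix entries by right multiplication of \<open>M\<close> with a constant
  matrix (\<open>d_entry_along_L1\<close> and its companions), which makes the commutators with \<open>L\<^sup>4\<close> and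
  \<open>L\<^sup>5\<close> immediate.\<close>

section \<open>Two-by-two matrices and the group law in entries\<close>

lemma mat2_component [simp]:
  "mat2 a b c d $ 1 $ 1 = a" "mat2 a b c d $ 1 $ 2 = b"
  "mat2 a b c d $ 2 $ 1 = c" "mat2 a b c d $ 2 $ 2 = d"
  by (simp_all add: mat2_def)

lemma mat2_eta: "mat2 (M $ 1 $ 1) (M $ 1 $ 2) (M $ 2 $ 1) (M $ 2 $ 2) = M"
  by (simp add: vec_eq_iff forall_2)

lemma mat2_eq_iff [simp]:
  "mat2 a b c d = mat2 a' b' c' d' \<longleftrightarrow> a = a' \<and> b = b' \<and> c = c' \<and> d = d'"
  by (auto simp: vec_eq_iff forall_2)

lemma vec2_eta: "(vector [X $ 1, X $ 2] :: real^2) = X"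
  by (simp add: vec_eq_iff forall_2)

lemma vec2_eq_iff [simp]: "(vector [l, m] :: real^2) = vector [l', m'] \<longleftrightarrow> l = l' \<and> m = m'"
  by (auto simp: vec_eq_iff forall_2)

lemma vec2_zero: "(0 :: real^2) = vector [0, 0]"
  by (simp add: vec_eq_iff forall_2)

lemma vec2_add [simp]: "(vector [l, m] :: real^2) + vector [l', m'] = vector [l + l', m + m']"
  by (simp add: vec_eq_iff forall_2)

lemma mat2_mult [simp]:
  "mat2 a b c d ** mat2 a' b' c' d' =
     mat2 (a * a' + b * c') (a * b' + b * d') (c * a' + d * c') (c * b' + d * d')"
  by (simp add: vec_eq_iff forall_2 matrix_matrix_mult_def sum_2)

lemma vec2_mult [simp]:
  "(vector [l, m] :: real^2) v* mat2 a b c d = vector [l * a + m * c, l * b + m * d]"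
  by (simp add: vec_eq_iff forall_2 vector_matrix_mult_def sum_2 mult.commute)

lemma det_mat2 [simp]: "det (mat2 a b c d) = a * d - b * c"
  by (simp add: det_2)

lemma mat_1_mat2: "mat 1 = mat2 1 0 0 1"
  by (simp add: vec_eq_iff forall_2 mat_def)

lemma SL2_mat2 [simp]: "mat2 a b c d \<in> SL2 \<longleftrightarrow> a * d - b * c = 1"
  by (simp add: SL2_def)

lemma in_SL2E:
  assumes "M \<in> SL2"
  obtains a b c d where "M = mat2 a b c d" "a * d - b * c = 1"
  using assms mat2_eta[of M] by (metis SL2_mat2)

lemma jac_mult_entries [simp]:
  "jac_mult (mat2 a b c d, vector [l, m], k) (mat2 a' b' c' d', vector [l', m'], k') =
     (mat2 a b c d ** mat2 a' b' c' d',
      vector [l * a' + m * c' + l', l * b' + m * d' + m'],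
      k + k' + ((l * a' + m * c') * m' - (l * b' + m * d') * l'))"
  by (simp add: jac_mult_def det_2)

lemma jacobi_simps [simp]:
  "carrier jacobi = SL2 \<times> UNIV" "mult jacobi = jac_mult"
  "one jacobi = (mat2 1 0 0 1, vector [0, 0], 0)"
  by (simp_all add: jacobi_def mat_1_mat2 vec2_zero)

lemma in_jacobiE:
  assumes "g \<in> carrier jacobi"
  obtains a b c d l m k
  where "g = (mat2 a b c d, vector [l, m], k)" "a * d - b * c = 1"
  using assms vec2_eta by (metis jacobi_simps(1) in_SL2E mem_Sigma_iff prod.collapse)

lemma group_jacobi: "group jacobi"
proof (rule groupI)
  fix g h assume "g \<in> carrier jacobi" "h \<in> carrier jacobi"
  then show "g \<otimes>\<^bsub>jacobi\<^esub> h \<in> carrier jacobi"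
    by (auto simp: jac_mult_def SL2_def det_mul)
next
  fix g h i assume "g \<in> carrier jacobi" "h \<in> carrier jacobi" "i \<in> carrier jacobi"
  then show "g \<otimes>\<^bsub>jacobi\<^esub> h \<otimes>\<^bsub>jacobi\<^esub> i = g \<otimes>\<^bsub>jacobi\<^esub> (h \<otimes>\<^bsub>jacobi\<^esub> i)"
    by (elim in_jacobiE) (simp add: matrix_mul_assoc algebra_simps)
next
  fix g assume "g \<in> carrier jacobi"
  then show "\<one>\<^bsub>jacobi\<^esub> \<otimes>\<^bsub>jacobi\<^esub> g = g"
    by (elim in_jacobiE) simp
  show "\<exists>h\<in>carrier jacobi. h \<otimes>\<^bsub>jacobi\<^esub> g = \<one>\<^bsub>jacobi\<^esub>"
    using \<open>g \<in> carrier jacobi\<close>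
  proof (rule in_jacobiE)
    fix a b c d l m k
    assume g: "g = (mat2 a b c d, vector [l, m], k)" and det: "a * d - b * c = 1"
    \<comment> \<open>\<open>(M\<^sup>-\<^sup>1, - X M\<^sup>-\<^sup>1, - \<kappa>)\<close>\<close>
    let ?h = "(mat2 d (- b) (- c) a, vector [m * c - l * d, l * b - m * a], - k)"
    have "(m * c - l * d) * a + (l * b - m * a) * c = - l"
      "(m * c - l * d) * b + (l * b - m * a) * d = - m"
      using det by algebra+
    then have "?h \<otimes>\<^bsub>jacobi\<^esub> g = \<one>\<^bsub>jacobi\<^esub>"
      using det by (simp add: g mult.commute)
    moreover have "?h \<in> carrier jacobi"
      using det by (simp add: mult.commute)
    ultimately show ?thesis ..
  qed
qed (simp_all)

section \<open>The parametrization by S-coordinates\<close>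

definition s_point :: "scoord \<Rightarrow> jac" where
  "s_point = (\<lambda>(x, y, \<theta>, p, q, \<kappa>).
     (mat2 (entry_a x y \<theta>) (entry_b x y \<theta>) (entry_c x y \<theta>) (entry_d x y \<theta>),
      vector [p * entry_a x y \<theta> + q * entry_c x y \<theta>, p * entry_b x y \<theta> + q * entry_d x y \<theta>],
      \<kappa>))"

text \<open>The matrix is determined by its bottom row and \<open>(x, y)\<close>. Together with \<open>y (c\<^sup>2 + d\<^sup>2) = 1\<close> this
  turns identities between trigonometric functions and square roots into polynomial ones.\<close>
lemma entry_ab:
  assumes "y > 0"
  shows "entry_a x y \<theta> = y * entry_d x y \<theta> + x * entry_c x y \<theta>"
    and "entry_b x y \<theta> = x * entry_d x y \<theta> - y * entry_c x y \<theta>"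
  using assms by (simp_all add: entry_a_def entry_b_def entry_c_def entry_d_def field_simps)

lemma entry_norm:
  assumes "y > 0"
  shows "y * ((entry_c x y \<theta>)\<^sup>2 + (entry_d x y \<theta>)\<^sup>2) = 1"
proof -
  have "y * ((entry_c x y \<theta>)\<^sup>2 + (entry_d x y \<theta>)\<^sup>2) = (sin \<theta>)\<^sup>2 + (cos \<theta>)\<^sup>2"
    using assms by (simp add: entry_c_def entry_d_def field_simps)
  then show ?thesis by simp
qed

lemma entry_det:
  assumes "y > 0"
  shows "entry_a x y \<theta> * entry_d x y \<theta> - entry_b x y \<theta> * entry_c x y \<theta> = 1"
  using entry_norm[OF assms, of x \<theta>] unfolding entry_ab[OF assms] by algebra

lemma iwasawa_entries:
  assumes "y > 0"
  shows "iwasawa x y \<theta> = mat2 (entry_a x y \<theta>) (entry_b x y \<theta>) (entry_c x y \<theta>) (entry_d x y \<theta>)"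
  using assms
  by (simp add: iwasawa_def entry_a_def entry_b_def entry_c_def entry_d_def)

lemma matrix_inv_SL2:
  assumes "M \<in> SL2"
  shows "M ** matrix_inv M = mat 1" "matrix_inv M ** M = mat 1"
proof -
  have "\<exists>M'. M ** M' = mat 1 \<and> M' ** M = mat 1"
    using assms
  proof (rule in_SL2E)
    fix a b c d assume "M = mat2 a b c d" "a * d - b * c = 1"
    then show ?thesis
      by (intro exI[of _ "mat2 d (- b) (- c) a"]) (simp add: mat_1_mat2 algebra_simps)
  qed
  then show "M ** matrix_inv M = mat 1" "matrix_inv M ** M = mat 1"
    unfolding matrix_inv_def by (metis (mono_tags, lifting) someI_ex)+
qed

lemma S_domain_iff [simp]: "(x, y, \<theta>, p, q, \<kappa>) \<in> S_domain \<longleftrightarrow> y > 0"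
  by (simp add: S_domain_def)

text \<open>S-coordinates say that \<open>X = (p, q) M\<close>; stated without the inverse matrix, having the
  coordinates \<open>u\<close> just means being the value at \<open>u\<close> of an explicit parametrization.\<close>

lemma has_S_coords_iff: "has_S_coords g u \<longleftrightarrow> u \<in> S_domain \<and> g = s_point u"
proof -
  obtain M X k x y \<theta> p q \<kappa> where gu: "g = (M, X, k)" "u = (x, y, \<theta>, p, q, \<kappa>)"
    by (metis prod_cases3 prod_cases6)
  show ?thesis
  proof (cases "y > 0 \<and> M = iwasawa x y \<theta>")
    case True
    then have M: "M = mat2 (entry_a x y \<theta>) (entry_b x y \<theta>) (entry_c x y \<theta>) (entry_d x y \<theta>)"
      using iwasawa_entries by simp
    then have SL: "M \<in> SL2"
      using entry_det True by simp
    have "vector [p, q] = X v* matrix_inv M \<longleftrightarrow> vector [p, q] v* M = X"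
      by (metis SL matrix_inv_SL2 vector_matrix_mul_assoc vector_matrix_mul_rid)
    then show ?thesis
      unfolding M by (auto simp: gu has_S_coords_def s_point_def True iwasawa_entries)
  next
    case False
    then show ?thesis
      using iwasawa_entries by (fastforce simp: gu has_S_coords_def s_point_def)
  qed
qed

lemma s_point_in_carrier:
  assumes "u \<in> S_domain" shows "s_point u \<in> carrier jacobi"
  using assms entry_det by (cases u) (auto simp: s_point_def)

text \<open>\<open>y\<close> and \<open>\<theta>\<close> are read off from length and direction of the bottom row; the first row is then
  forced up to the real number \<open>x\<close> by the determinant.\<close>
lemma iwasawa_exists:
  assumes "a * d - b * c = 1"
  obtains x y \<theta> where "y > 0" "a = entry_a x y \<theta>" "b = entry_b x y \<theta>" "c = entry_c x y \<theta>" "d = entry_d x y \<theta>"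
proof -
  have nz: "c\<^sup>2 + d\<^sup>2 > 0"
    using assms by (metis mult_zero_right diff_zero sum_power2_gt_zero_iff zero_neq_one)
  define y where "y = 1 / (c\<^sup>2 + d\<^sup>2)"
  define x where "x = (a * c + b * d) * y"
  have y: "y > 0" using nz by (simp add: y_def)
  have n: "y * (c\<^sup>2 + d\<^sup>2) = 1"
    using nz less_irrefl nonzero_eq_divide_eq unfolding y_def by metis
  then have "(d * sqrt y)\<^sup>2 + (- c * sqrt y)\<^sup>2 = 1"
    using y by (simp add: power_mult_distrib algebra_simps)
  then obtain \<theta> where th: "d * sqrt y = cos \<theta>" "- c * sqrt y = sin \<theta>"
    by (metis sincos_total_2pi)
  have cd: "c = entry_c x y \<theta>" "d = entry_d x y \<theta>"
    using y by (simp_all add: entry_c_def entry_d_def flip: th)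
  have "a = y * d + x * c" "b = x * d - y * c"
    unfolding x_def using n assms by algebra+
  then have "a = entry_a x y \<theta>" "b = entry_b x y \<theta>"
    using entry_ab[OF y] cd by metis+
  then show ?thesis
    using that y cd by blast
qed

lemma s_point_surj:
  assumes "g \<in> carrier jacobi"
  obtains u where "u \<in> S_domain" "g = s_point u"
proof -
  obtain a b c d l m k where g: "g = (mat2 a b c d, vector [l, m], k)" and det: "a * d - b * c = 1"
    using assms by (rule in_jacobiE)
  obtain x y \<theta> where y: "y > 0"
    and e: "a = entry_a x y \<theta>" "b = entry_b x y \<theta>" "c = entry_c x y \<theta>" "d = entry_d x y \<theta>"
    using iwasawa_exists[OF det] .
  \<comment> \<open>\<open>(p, q) = X M\<^sup>-\<^sup>1\<close>\<close>
  have "l = (l * d - m * c) * a + (m * a - l * b) * c" "m = (l * d - m * c) * b + (m * a - l * b) * d"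
    using det by algebra+
  then have "g = s_point (x, y, \<theta>, l * d - m * c, m * a - l * b, k)"
    by (simp add: g s_point_def flip: e)
  then show ?thesis
    using that y by (metis S_domain_iff)
qed

text \<open>The bottom row of \<open>M\<close> is \<open>y\<^sup>-\<^sup>1\<^sup>/\<^sup>2 (- sin \<theta>, cos \<theta>)\<close>, which determines \<open>y\<close> and the point
  \<open>(cos \<theta>, sin \<theta>)\<close> of the circle; the top row then determines \<open>x\<close>.\<close>

lemma iwasawa_inj:
  assumes y: "y > 0" "y' > 0"
    and e: "entry_a x y \<theta> = entry_a x' y' \<theta>'" "entry_b x y \<theta> = entry_b x' y' \<theta>'"
      "entry_c x y \<theta> = entry_c x' y' \<theta>'" "entry_d x y \<theta> = entry_d x' y' \<theta>'"
  shows "x = x' \<and> y = y' \<and> cos \<theta> = cos \<theta>' \<and> sin \<theta> = sin \<theta>'"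
proof -
  have yy: "y = y'"
    using entry_norm[OF y(1), of x \<theta>] entry_norm[OF y(2), of x' \<theta>'] e(3,4) by algebra
  have "x = x'"
    using entry_norm[OF y(1), of x \<theta>] entry_ab[OF y(1), of x \<theta>] entry_ab[OF y(2), of x' \<theta>'] e yy
    by algebra
  with yy show ?thesis
    using e(3,4) y by (simp add: entry_c_def entry_d_def)
qed

lemma s_point_eq_iff:
  assumes "y > 0" "y' > 0"
  shows "s_point (x, y, \<theta>, p, q, \<kappa>) = s_point (x', y', \<theta>', p', q', \<kappa>') \<longleftrightarrow>
    x = x' \<and> y = y' \<and> cos \<theta> = cos \<theta>' \<and> sin \<theta> = sin \<theta>' \<and> p = p' \<and> q = q' \<and> \<kappa> = \<kappa>'" (is "?L \<longleftrightarrow> ?R")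
proof
  assume ?L
  then have e: "entry_a x y \<theta> = entry_a x' y' \<theta>'" "entry_b x y \<theta> = entry_b x' y' \<theta>'"
      "entry_c x y \<theta> = entry_c x' y' \<theta>'" "entry_d x y \<theta> = entry_d x' y' \<theta>'" "\<kappa> = \<kappa>'"
    by (simp_all add: s_point_def)
  from \<open>?L\<close> have pq: "p * entry_a x y \<theta> + q * entry_c x y \<theta> = p' * entry_a x y \<theta> + q' * entry_c x y \<theta>"
      "p * entry_b x y \<theta> + q * entry_d x y \<theta> = p' * entry_b x y \<theta> + q' * entry_d x y \<theta>"
    unfolding e by (simp_all add: s_point_def e)
  have "p = p'" "q = q'"
    using pq entry_det[OF assms(1), of x \<theta>] by algebra+
  with e iwasawa_inj[OF assms e(1-4)] show ?R by simp
qed (simp add: s_point_def entry_a_def entry_b_def entry_c_def entry_d_def)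

section \<open>The composition law\<close>

lemma composition_law_SL2:
  fixes a b c d x' y' \<theta>' :: real
  assumes det: "a * d - b * c = 1" and y': "y' > 0"
  defines "\<Lambda> \<equiv> (c * x' + d)\<^sup>2 + (c * y')\<^sup>2"
  assumes x1: "x1 = ((a * x' + b) * (c * x' + d) + a * c * y'\<^sup>2) / \<Lambda>" and y1: "y1 = y' / \<Lambda>"
    and s: "sin \<theta>1 = ((c * x' + d) * sin \<theta>' - c * y' * cos \<theta>') / sqrt \<Lambda>"
    and co: "cos \<theta>1 = (c * y' * sin \<theta>' + (c * x' + d) * cos \<theta>') / sqrt \<Lambda>"
  shows "y1 > 0"
    and "entry_a x1 y1 \<theta>1 = a * entry_a x' y' \<theta>' + b * entry_c x' y' \<theta>'"
    and "entry_b x1 y1 \<theta>1 = a * entry_b x' y' \<theta>' + b * entry_d x' y' \<theta>'"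
    and "entry_c x1 y1 \<theta>1 = c * entry_a x' y' \<theta>' + d * entry_c x' y' \<theta>'"
    and "entry_d x1 y1 \<theta>1 = c * entry_b x' y' \<theta>' + d * entry_d x' y' \<theta>'"
proof -
  have L: "\<Lambda> > 0"
    using det y' unfolding \<Lambda>_def
    by (metis mult_eq_0_iff mult_zero_right diff_zero add_0 less_irrefl sum_power2_gt_zero_iff zero_neq_one)
  show pos: "y1 > 0" using y' L by (simp add: y1)
  have sq: "sqrt y1 = sqrt y' / sqrt \<Lambda>" by (simp add: y1 real_sqrt_divide)
  have C: "entry_c x1 y1 \<theta>1 = (c * x' + d) * entry_c x' y' \<theta>' + c * y' * entry_d x' y' \<theta>'"
    unfolding entry_c_def entry_d_def sq s using y' L by (simp add: field_simps)
  have D: "entry_d x1 y1 \<theta>1 = (c * x' + d) * entry_d x' y' \<theta>' - c * y' * entry_c x' y' \<theta>'"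
    unfolding entry_c_def entry_d_def sq co using y' L by (simp add: field_simps)
  have yL: "y1 * \<Lambda> = y'" and xL: "x1 * \<Lambda> = (a * x' + b) * (c * x' + d) + a * c * y'\<^sup>2"
    using L by (simp_all add: x1 y1)
  show "entry_c x1 y1 \<theta>1 = c * entry_a x' y' \<theta>' + d * entry_c x' y' \<theta>'"
    "entry_d x1 y1 \<theta>1 = c * entry_b x' y' \<theta>' + d * entry_d x' y' \<theta>'"
    unfolding C D entry_ab[OF y'] by algebra+
  let ?C = "entry_c x' y' \<theta>'" and ?D = "entry_d x' y' \<theta>'"
  have "\<Lambda> * entry_a x1 y1 \<theta>1 =
      (y1 * \<Lambda>) * ((c * x' + d) * ?D - c * y' * ?C) + (x1 * \<Lambda>) * ((c * x' + d) * ?C + c * y' * ?D)"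
    unfolding entry_ab[OF pos] C D by algebra
  also have "\<dots> = \<Lambda> * (a * entry_a x' y' \<theta>' + b * ?C)"
    unfolding entry_ab[OF y'] yL xL unfolding \<Lambda>_def using det by algebra
  finally have "\<Lambda> * entry_a x1 y1 \<theta>1 = \<Lambda> * (a * entry_a x' y' \<theta>' + b * ?C)" .
  then show "entry_a x1 y1 \<theta>1 = a * entry_a x' y' \<theta>' + b * entry_c x' y' \<theta>'"
    using L by simp
  have "\<Lambda> * entry_b x1 y1 \<theta>1 =
      (x1 * \<Lambda>) * ((c * x' + d) * ?D - c * y' * ?C) - (y1 * \<Lambda>) * ((c * x' + d) * ?C + c * y' * ?D)"
    unfolding entry_ab[OF pos] C D by algebra
  also have "\<dots> = \<Lambda> * (a * entry_b x' y' \<theta>' + b * ?D)"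
    unfolding entry_ab[OF y'] yL xL unfolding \<Lambda>_def using det by algebra
  finally have "\<Lambda> * entry_b x1 y1 \<theta>1 = \<Lambda> * (a * entry_b x' y' \<theta>' + b * ?D)" .
  then show "entry_b x1 y1 \<theta>1 = a * entry_b x' y' \<theta>' + b * entry_d x' y' \<theta>'"
    using L by simp
qed

text \<open>Both directions of the equivalence come from one computation: the formulas on the right
  define some coordinate tuple, they do give the product, and coordinates are unique up to the
  ambiguity of the angle.\<close>

lemma composition_law:
  fixes x y \<theta> x' y' \<theta>' :: real
  assumes y: "y > 0" and y': "y' > 0"
  defines "a \<equiv> entry_a x y \<theta>" and "b \<equiv> entry_b x y \<theta>" and "c \<equiv> entry_c x y \<theta>" and "d \<equiv> entry_d x y \<theta>"
  defines "\<Lambda> \<equiv> (c * x' + d)\<^sup>2 + (c * y')\<^sup>2"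
  shows "has_S_coords (s_point (x, y, \<theta>, p, q, \<kappa>) \<otimes>\<^bsub>jacobi\<^esub> s_point (x', y', \<theta>', p', q', \<kappa>'))
           (x1, y1, \<theta>1, p1, q1, \<kappa>1) \<longleftrightarrow>
    x1 = ((a * x' + b) * (c * x' + d) + a * c * y'\<^sup>2) / \<Lambda> \<and> y1 = y' / \<Lambda> \<and>
    sin \<theta>1 = ((c * x' + d) * sin \<theta>' - c * y' * cos \<theta>') / sqrt \<Lambda> \<and>
    cos \<theta>1 = (c * y' * sin \<theta>' + (c * x' + d) * cos \<theta>') / sqrt \<Lambda> \<and>
    p1 = p + d * p' - c * q' \<and> q1 = q - b * p' + a * q' \<and>
    \<kappa>1 = \<kappa> + \<kappa>' + (p * a + q * c) * q' - (p * b + q * d) * p'"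
proof -
  have det: "a * d - b * c = 1"
    using entry_det[OF y] by (simp add: a_def b_def c_def d_def)
  have det': "entry_a x' y' \<theta>' * entry_d x' y' \<theta>' - entry_b x' y' \<theta>' * entry_c x' y' \<theta>' = 1"
    using entry_det[OF y'] .
  have L: "\<Lambda> > 0"
    using det y' unfolding \<Lambda>_def
    by (metis mult_eq_0_iff mult_zero_right diff_zero add_0 less_irrefl sum_power2_gt_zero_iff zero_neq_one)
  let ?s = "((c * x' + d) * sin \<theta>' - c * y' * cos \<theta>') / sqrt \<Lambda>"
  let ?c = "(c * y' * sin \<theta>' + (c * x' + d) * cos \<theta>') / sqrt \<Lambda>"
  have "((c * x' + d) * sin \<theta>' - c * y' * cos \<theta>')\<^sup>2 + (c * y' * sin \<theta>' + (c * x' + d) * cos \<theta>')\<^sup>2 = \<Lambda>"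
    unfolding \<Lambda>_def using sin_cos_squared_add[of \<theta>'] by algebra
  then have "?c\<^sup>2 + ?s\<^sup>2 = 1"
    using L by (simp add: power_divide add.commute flip: add_divide_distrib)
  then obtain t where t: "sin t = ?s" "cos t = ?c"
    by (metis sincos_total_2pi)
  define X where "X = ((a * x' + b) * (c * x' + d) + a * c * y'\<^sup>2) / \<Lambda>"
  define Y where "Y = y' / \<Lambda>"
  note E = composition_law_SL2[OF det y', of X x' Y t \<theta>', folded \<Lambda>_def, OF X_def Y_def t]
  have prod: "s_point (x, y, \<theta>, p, q, \<kappa>) \<otimes>\<^bsub>jacobi\<^esub> s_point (x', y', \<theta>', p', q', \<kappa>') =
      s_point (X, Y, t, p + d * p' - c * q', q - b * p' + a * q',
        \<kappa> + \<kappa>' + (p * a + q * c) * q' - (p * b + q * d) * p')"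
    unfolding s_point_def using det det'
    by (simp add: E flip: a_def b_def c_def d_def) (intro conjI; algebra)
  show ?thesis
    unfolding has_S_coords_iff prod t[symmetric]
    using E(1) s_point_eq_iff[OF E(1)] by (auto simp: X_def Y_def)
qed

section \<open>Derivatives of the matrix entries\<close>

abbreviation x_of :: "scoord \<Rightarrow> real" where "x_of u \<equiv> fst u"
abbreviation y_of :: "scoord \<Rightarrow> real" where "y_of u \<equiv> fst (snd u)"
abbreviation \<theta>_of :: "scoord \<Rightarrow> real" where "\<theta>_of u \<equiv> fst (snd (snd u))"
abbreviation p_of :: "scoord \<Rightarrow> real" where "p_of u \<equiv> fst (snd (snd (snd u)))"
abbreviation q_of :: "scoord \<Rightarrow> real" where "q_of u \<equiv> fst (snd (snd (snd (snd u))))"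
abbreviation \<kappa>_of :: "scoord \<Rightarrow> real" where "\<kappa>_of u \<equiv> snd (snd (snd (snd (snd u))))"

lemma in_S_domain: "u \<in> S_domain \<longleftrightarrow> y_of u > 0"
  by (cases u) simp

text \<open>The differentials of the entries of \<open>M\<close>, written with the entries themselves, so that
  products such as \<open>M\<^sup>-\<^sup>1 dM\<close> reduce by \<open>det M = 1\<close> and \<open>y (c\<^sup>2 + d\<^sup>2) = 1\<close>.\<close>
definition d_entry_a :: "real \<Rightarrow> real \<Rightarrow> real \<Rightarrow> real \<Rightarrow> real \<Rightarrow> real \<Rightarrow> real" where
  "d_entry_a x y \<theta> dx dy d\<theta> =
     entry_c x y \<theta> * dx + (entry_d x y \<theta> - x / y * entry_c x y \<theta>) / 2 * dy - entry_b x y \<theta> * d\<theta>"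

definition d_entry_b :: "real \<Rightarrow> real \<Rightarrow> real \<Rightarrow> real \<Rightarrow> real \<Rightarrow> real \<Rightarrow> real" where
  "d_entry_b x y \<theta> dx dy d\<theta> =
     entry_d x y \<theta> * dx - (entry_c x y \<theta> + x / y * entry_d x y \<theta>) / 2 * dy + entry_a x y \<theta> * d\<theta>"

definition d_entry_c :: "real \<Rightarrow> real \<Rightarrow> real \<Rightarrow> real \<Rightarrow> real \<Rightarrow> real" where
  "d_entry_c x y \<theta> dy d\<theta> = - (entry_c x y \<theta> / (2 * y)) * dy - entry_d x y \<theta> * d\<theta>"

definition d_entry_d :: "real \<Rightarrow> real \<Rightarrow> real \<Rightarrow> real \<Rightarrow> real \<Rightarrow> real" where
  "d_entry_d x y \<theta> dy d\<theta> = - (entry_d x y \<theta> / (2 * y)) * dy + entry_c x y \<theta> * d\<theta>"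

lemma sqrt_times_sqrt:
  assumes "y > (0::real)" shows "sqrt y * sqrt y = y" "sqrt y * (sqrt y * t) = y * t"
  using assms by (auto simp: real_sqrt_mult_self simp flip: mult.assoc)

lemma has_derivative_entry:
  fixes X Y \<Theta> :: "'a::real_normed_vector \<Rightarrow> real"
  assumes [derivative_intros]:
      "(X has_derivative X') (at z within S)" "(Y has_derivative Y') (at z within S)"
      "(\<Theta> has_derivative \<Theta>') (at z within S)"
    and Y: "Y z > 0"
  shows has_derivative_entry_a: "((\<lambda>z. entry_a (X z) (Y z) (\<Theta> z)) has_derivative
          (\<lambda>v. d_entry_a (X z) (Y z) (\<Theta> z) (X' v) (Y' v) (\<Theta>' v))) (at z within S)"
    and has_derivative_entry_b: "((\<lambda>z. entry_b (X z) (Y z) (\<Theta> z)) has_derivative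
          (\<lambda>v. d_entry_b (X z) (Y z) (\<Theta> z) (X' v) (Y' v) (\<Theta>' v))) (at z within S)"
    and has_derivative_entry_c: "((\<lambda>z. entry_c (X z) (Y z) (\<Theta> z)) has_derivative
          (\<lambda>v. d_entry_c (X z) (Y z) (\<Theta> z) (Y' v) (\<Theta>' v))) (at z within S)"
    and has_derivative_entry_d: "((\<lambda>z. entry_d (X z) (Y z) (\<Theta> z)) has_derivative
          (\<lambda>v. d_entry_d (X z) (Y z) (\<Theta> z) (Y' v) (\<Theta>' v))) (at z within S)"
proof -
  note defs = d_entry_a_def d_entry_b_def d_entry_c_def d_entry_d_def
    entry_a_def entry_b_def entry_c_def entry_d_def
  have nz: "Y z \<noteq> 0" using Y by simp
  show "((\<lambda>z. entry_a (X z) (Y z) (\<Theta> z)) has_derivative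
          (\<lambda>v. d_entry_a (X z) (Y z) (\<Theta> z) (X' v) (Y' v) (\<Theta>' v))) (at z within S)"
    unfolding defs using Y nz
    by (auto intro!: derivative_eq_intros ext)
       (simp add: divide_simps sqrt_times_sqrt; (simp add: algebra_simps sqrt_times_sqrt)?)
  show "((\<lambda>z. entry_b (X z) (Y z) (\<Theta> z)) has_derivative
          (\<lambda>v. d_entry_b (X z) (Y z) (\<Theta> z) (X' v) (Y' v) (\<Theta>' v))) (at z within S)"
    unfolding defs using Y nz
    by (auto intro!: derivative_eq_intros ext)
       (simp add: divide_simps sqrt_times_sqrt; (simp add: algebra_simps sqrt_times_sqrt)?)
  show "((\<lambda>z. entry_c (X z) (Y z) (\<Theta> z)) has_derivative
          (\<lambda>v. d_entry_c (X z) (Y z) (\<Theta> z) (Y' v) (\<Theta>' v))) (at z within S)"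
    unfolding defs using Y nz
    by (auto intro!: derivative_eq_intros ext)
       (simp add: divide_simps sqrt_times_sqrt; (simp add: algebra_simps sqrt_times_sqrt)?)
  show "((\<lambda>z. entry_d (X z) (Y z) (\<Theta> z)) has_derivative
          (\<lambda>v. d_entry_d (X z) (Y z) (\<Theta> z) (Y' v) (\<Theta>' v))) (at z within S)"
    unfolding defs using Y nz
    by (auto intro!: derivative_eq_intros ext)
       (simp add: divide_simps sqrt_times_sqrt; (simp add: algebra_simps sqrt_times_sqrt)?)
qed

section \<open>The one-forms and the metric\<close>

lemma one_form_simps:
  "one_form \<alpha> \<beta> \<gamma> \<delta> 1 (x, y, \<theta>, p, q, \<kappa>) (dx, dy, d\<theta>, dp, dq, d\<kappa>) =
     sqrt \<alpha> / y * (cos (2 * \<theta>) * dx + sin (2 * \<theta>) * dy)"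
  "one_form \<alpha> \<beta> \<gamma> \<delta> 2 (x, y, \<theta>, p, q, \<kappa>) (dx, dy, d\<theta>, dp, dq, d\<kappa>) =
     sqrt \<alpha> / y * (- sin (2 * \<theta>) * dx + cos (2 * \<theta>) * dy)"
  "one_form \<alpha> \<beta> \<gamma> \<delta> 3 (x, y, \<theta>, p, q, \<kappa>) (dx, dy, d\<theta>, dp, dq, d\<kappa>) = sqrt \<beta> * (dx / y + 2 * d\<theta>)"
  "one_form \<alpha> \<beta> \<gamma> \<delta> 4 (x, y, \<theta>, p, q, \<kappa>) (dx, dy, d\<theta>, dp, dq, d\<kappa>) =
     sqrt \<gamma> * (entry_a x y \<theta> * dp + entry_c x y \<theta> * dq)"
  "one_form \<alpha> \<beta> \<gamma> \<delta> 5 (x, y, \<theta>, p, q, \<kappa>) (dx, dy, d\<theta>, dp, dq, d\<kappa>) =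
     sqrt \<gamma> * (entry_b x y \<theta> * dp + entry_d x y \<theta> * dq)"
  "one_form \<alpha> \<beta> \<gamma> \<delta> 6 (x, y, \<theta>, p, q, \<kappa>) (dx, dy, d\<theta>, dp, dq, d\<kappa>) =
     sqrt \<delta> * (d\<kappa> - p * dq + q * dp)"
  by (simp_all add: one_form_def)

lemma index_set_6: "{1..6::nat} = {1, 2, 3, 4, 5, 6}"
  by auto

lemma double_angle_entries:
  assumes "y > 0"
  shows "cos (2 * \<theta>) = y * ((entry_d x y \<theta>)\<^sup>2 - (entry_c x y \<theta>)\<^sup>2)"
    and "sin (2 * \<theta>) = - 2 * y * entry_c x y \<theta> * entry_d x y \<theta>"
  using assms
  by (simp_all add: cos_double sin_double entry_c_def entry_d_def power2_eq_square
        divide_simps sqrt_times_sqrt)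

text \<open>The three forms are entries of \<open>M\<^sup>-\<^sup>1 dM\<close>: its symmetric part gives the first two, its
  antisymmetric part the third. In this shape left invariance is visible, since
  \<open>(N M)\<^sup>-\<^sup>1 d(N M) = M\<^sup>-\<^sup>1 dM\<close> for constant \<open>N\<close>.\<close>
lemma one_form_cartan:
  fixes x y \<theta> :: real
  assumes y: "y > 0"
  defines "a \<equiv> entry_a x y \<theta>" and "b \<equiv> entry_b x y \<theta>" and "c \<equiv> entry_c x y \<theta>" and "d \<equiv> entry_d x y \<theta>"
  shows "one_form \<alpha> \<beta> \<gamma> \<delta> 1 (x, y, \<theta>, p, q, \<kappa>) (dx, dy, d\<theta>, dp, dq, d\<kappa>) =
      sqrt \<alpha> * ((d * d_entry_b x y \<theta> dx dy d\<theta> - b * d_entry_d x y \<theta> dy d\<theta>)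
               + (a * d_entry_c x y \<theta> dy d\<theta> - c * d_entry_a x y \<theta> dx dy d\<theta>))"
    and "one_form \<alpha> \<beta> \<gamma> \<delta> 2 (x, y, \<theta>, p, q, \<kappa>) (dx, dy, d\<theta>, dp, dq, d\<kappa>) =
      sqrt \<alpha> * ((d * d_entry_a x y \<theta> dx dy d\<theta> - b * d_entry_c x y \<theta> dy d\<theta>)
               - (a * d_entry_d x y \<theta> dy d\<theta> - c * d_entry_b x y \<theta> dx dy d\<theta>))"
    and "one_form \<alpha> \<beta> \<gamma> \<delta> 3 (x, y, \<theta>, p, q, \<kappa>) (dx, dy, d\<theta>, dp, dq, d\<kappa>) =
      sqrt \<beta> * ((d * d_entry_b x y \<theta> dx dy d\<theta> - b * d_entry_d x y \<theta> dy d\<theta>)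
               - (a * d_entry_c x y \<theta> dy d\<theta> - c * d_entry_a x y \<theta> dx dy d\<theta>))"
proof -
  define w where "w = x / y"
  define h where "h = dy / y"
  define k where "k = dx / y"
  have xw: "x = w * y" "dy = h * y" "dx = k * y" using y by (simp_all add: w_def h_def k_def)
  have n: "y * (c\<^sup>2 + d\<^sup>2) = 1"
    using entry_norm[OF y] by (simp add: c_def d_def)
  have ab: "a = y * d + x * c" "b = x * d - y * c"
    using entry_ab[OF y] by (simp_all add: a_def b_def c_def d_def)
  have D: "d_entry_a x y \<theta> dx dy d\<theta> = c * dx + (d - w * c) / 2 * dy - b * d\<theta>"
    "d_entry_b x y \<theta> dx dy d\<theta> = d * dx - (c + w * d) / 2 * dy + a * d\<theta>"
    "d_entry_c x y \<theta> dy d\<theta> = - (c / 2) * h - d * d\<theta>"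
    "d_entry_d x y \<theta> dy d\<theta> = - (d / 2) * h + c * d\<theta>"
    by (simp_all add: d_entry_a_def d_entry_b_def d_entry_c_def d_entry_d_def a_def b_def c_def d_def
        w_def h_def)
  note cs = double_angle_entries[OF y, of \<theta> x, folded c_def d_def]
  show "one_form \<alpha> \<beta> \<gamma> \<delta> 1 (x, y, \<theta>, p, q, \<kappa>) (dx, dy, d\<theta>, dp, dq, d\<kappa>) =
      sqrt \<alpha> * ((d * d_entry_b x y \<theta> dx dy d\<theta> - b * d_entry_d x y \<theta> dy d\<theta>)
               + (a * d_entry_c x y \<theta> dy d\<theta> - c * d_entry_a x y \<theta> dx dy d\<theta>))"
  proof -
    have "one_form \<alpha> \<beta> \<gamma> \<delta> 1 (x, y, \<theta>, p, q, \<kappa>) (dx, dy, d\<theta>, dp, dq, d\<kappa>) =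
        sqrt \<alpha> * (cos (2 * \<theta>) * k + sin (2 * \<theta>) * h)"
      unfolding one_form_simps by (simp add: k_def h_def divide_inverse algebra_simps)
    also have "\<dots> = sqrt \<alpha> * ((d * d_entry_b x y \<theta> dx dy d\<theta> - b * d_entry_d x y \<theta> dy d\<theta>)
               + (a * d_entry_c x y \<theta> dy d\<theta> - c * d_entry_a x y \<theta> dx dy d\<theta>))"
      unfolding cs D ab using n xw by algebra
    finally show ?thesis .
  qed
  show "one_form \<alpha> \<beta> \<gamma> \<delta> 2 (x, y, \<theta>, p, q, \<kappa>) (dx, dy, d\<theta>, dp, dq, d\<kappa>) =
      sqrt \<alpha> * ((d * d_entry_a x y \<theta> dx dy d\<theta> - b * d_entry_c x y \<theta> dy d\<theta>)
               - (a * d_entry_d x y \<theta> dy d\<theta> - c * d_entry_b x y \<theta> dx dy d\<theta>))"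
  proof -
    have "one_form \<alpha> \<beta> \<gamma> \<delta> 2 (x, y, \<theta>, p, q, \<kappa>) (dx, dy, d\<theta>, dp, dq, d\<kappa>) =
        sqrt \<alpha> * (- sin (2 * \<theta>) * k + cos (2 * \<theta>) * h)"
      unfolding one_form_simps by (simp add: k_def h_def divide_inverse algebra_simps)
    also have "\<dots> = sqrt \<alpha> * ((d * d_entry_a x y \<theta> dx dy d\<theta> - b * d_entry_c x y \<theta> dy d\<theta>)
               - (a * d_entry_d x y \<theta> dy d\<theta> - c * d_entry_b x y \<theta> dx dy d\<theta>))"
      unfolding cs D ab using n xw by algebra
    finally show ?thesis .
  qed
  show "one_form \<alpha> \<beta> \<gamma> \<delta> 3 (x, y, \<theta>, p, q, \<kappa>) (dx, dy, d\<theta>, dp, dq, d\<kappa>) =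
      sqrt \<beta> * ((d * d_entry_b x y \<theta> dx dy d\<theta> - b * d_entry_d x y \<theta> dy d\<theta>)
               - (a * d_entry_c x y \<theta> dy d\<theta> - c * d_entry_a x y \<theta> dx dy d\<theta>))"
  proof -
    have "one_form \<alpha> \<beta> \<gamma> \<delta> 3 (x, y, \<theta>, p, q, \<kappa>) (dx, dy, d\<theta>, dp, dq, d\<kappa>) = sqrt \<beta> * (k + 2 * d\<theta>)"
      unfolding one_form_simps by (simp add: k_def)
    also have "\<dots> = sqrt \<beta> * ((d * d_entry_b x y \<theta> dx dy d\<theta> - b * d_entry_d x y \<theta> dy d\<theta>)
               - (a * d_entry_c x y \<theta> dy d\<theta> - c * d_entry_a x y \<theta> dx dy d\<theta>))"
      unfolding D ab using n xw by algebra
    finally show ?thesis .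
  qed
qed

text \<open>The matrix \<open>M M\<^sup>T\<close> does not see the rotation factor of \<open>M\<close>. This is why \<open>\<theta>\<close> disappears from
  \<open>\<lambda>\<^sub>4\<^sup>2 + \<lambda>\<^sub>5\<^sup>2\<close>.\<close>
lemma entry_gram:
  assumes y: "y > 0"
  shows "(entry_a x y \<theta>)\<^sup>2 + (entry_b x y \<theta>)\<^sup>2 = (x\<^sup>2 + y\<^sup>2) / y"
    and "entry_a x y \<theta> * entry_c x y \<theta> + entry_b x y \<theta> * entry_d x y \<theta> = x / y"
    and "(entry_c x y \<theta>)\<^sup>2 + (entry_d x y \<theta>)\<^sup>2 = 1 / y"
proof -
  note n = entry_norm[OF y, of x \<theta>]
  have "y * ((entry_a x y \<theta>)\<^sup>2 + (entry_b x y \<theta>)\<^sup>2) = x\<^sup>2 + y\<^sup>2"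
    unfolding entry_ab[OF y] using n by algebra
  then show "(entry_a x y \<theta>)\<^sup>2 + (entry_b x y \<theta>)\<^sup>2 = (x\<^sup>2 + y\<^sup>2) / y"
    using y by (simp add: eq_divide_eq mult.commute)
  have "y * (entry_a x y \<theta> * entry_c x y \<theta> + entry_b x y \<theta> * entry_d x y \<theta>) = x"
    unfolding entry_ab[OF y] using n by algebra
  then show "entry_a x y \<theta> * entry_c x y \<theta> + entry_b x y \<theta> * entry_d x y \<theta> = x / y"
    using y by (simp add: eq_divide_eq mult.commute)
  show "(entry_c x y \<theta>)\<^sup>2 + (entry_d x y \<theta>)\<^sup>2 = 1 / y"
    using y n by (simp add: eq_divide_eq mult.commute)
qed

lemma sum_squares_one_form:
  assumes u: "u \<in> S_domain" and nonneg: "\<alpha> \<ge> 0" "\<beta> \<ge> 0" "\<gamma> \<ge> 0" "\<delta> \<ge> 0"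
  shows "(\<Sum>i = 1..6. (one_form \<alpha> \<beta> \<gamma> \<delta> i u v)\<^sup>2) = ds2 \<alpha> \<beta> \<gamma> \<delta> u v"
proof -
  obtain x y \<theta> p q \<kappa> dx dy d\<theta> dp dq d\<kappa> where
    uv: "u = (x, y, \<theta>, p, q, \<kappa>)" "v = (dx, dy, d\<theta>, dp, dq, d\<kappa>)"
    by (metis prod_cases6)
  have y: "y > 0" using u by (simp add: uv)
  let ?a = "entry_a x y \<theta>" and ?b = "entry_b x y \<theta>" and ?c = "entry_c x y \<theta>" and ?d = "entry_d x y \<theta>"
  have sq: "(sqrt \<alpha> / y * t)\<^sup>2 = \<alpha> / y\<^sup>2 * t\<^sup>2" "(sqrt \<gamma> * t)\<^sup>2 = \<gamma> * t\<^sup>2" for t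
    using nonneg by (simp_all add: power_mult_distrib power_divide)
  have "(one_form \<alpha> \<beta> \<gamma> \<delta> 1 u v)\<^sup>2 + (one_form \<alpha> \<beta> \<gamma> \<delta> 2 u v)\<^sup>2 =
      \<alpha> / y\<^sup>2 * ((cos (2 * \<theta>) * dx + sin (2 * \<theta>) * dy)\<^sup>2 + (- sin (2 * \<theta>) * dx + cos (2 * \<theta>) * dy)\<^sup>2)"
    unfolding uv one_form_simps sq by (rule distrib_left[symmetric])
  also have "(cos (2 * \<theta>) * dx + sin (2 * \<theta>) * dy)\<^sup>2 + (- sin (2 * \<theta>) * dx + cos (2 * \<theta>) * dy)\<^sup>2 = dx\<^sup>2 + dy\<^sup>2"
    using sin_cos_squared_add[of "2 * \<theta>"] by algebra
  finally have 12: "(one_form \<alpha> \<beta> \<gamma> \<delta> 1 u v)\<^sup>2 + (one_form \<alpha> \<beta> \<gamma> \<delta> 2 u v)\<^sup>2 = \<alpha> * ((dx\<^sup>2 + dy\<^sup>2) / y\<^sup>2)"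
    by simp
  have "(one_form \<alpha> \<beta> \<gamma> \<delta> 4 u v)\<^sup>2 + (one_form \<alpha> \<beta> \<gamma> \<delta> 5 u v)\<^sup>2 =
      \<gamma> * ((?a * dp + ?c * dq)\<^sup>2 + (?b * dp + ?d * dq)\<^sup>2)"
    unfolding uv one_form_simps sq by (rule distrib_left[symmetric])
  also have "(?a * dp + ?c * dq)\<^sup>2 + (?b * dp + ?d * dq)\<^sup>2 =
      (?a\<^sup>2 + ?b\<^sup>2) * dp\<^sup>2 + 2 * (?a * ?c + ?b * ?d) * dp * dq + (?c\<^sup>2 + ?d\<^sup>2) * dq\<^sup>2"
    by algebra
  also have "\<dots> = 1 / y * (dq\<^sup>2 + (x\<^sup>2 + y\<^sup>2) * dp\<^sup>2 + 2 * x * dp * dq)"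
    unfolding entry_gram[OF y] using y by (simp add: field_simps)
  finally have 45: "(one_form \<alpha> \<beta> \<gamma> \<delta> 4 u v)\<^sup>2 + (one_form \<alpha> \<beta> \<gamma> \<delta> 5 u v)\<^sup>2 =
      \<gamma> / y * (dq\<^sup>2 + (x\<^sup>2 + y\<^sup>2) * dp\<^sup>2 + 2 * x * dp * dq)"
    by simp
  have 36: "(one_form \<alpha> \<beta> \<gamma> \<delta> 3 u v)\<^sup>2 = \<beta> * (dx / y + 2 * d\<theta>)\<^sup>2"
    "(one_form \<alpha> \<beta> \<gamma> \<delta> 6 u v)\<^sup>2 = \<delta> * (d\<kappa> - p * dq + q * dp)\<^sup>2"
    unfolding uv one_form_simps using nonneg by (simp_all add: power_mult_distrib)
  have "(\<Sum>i = 1..6. (one_form \<alpha> \<beta> \<gamma> \<delta> i u v)\<^sup>2) =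
      ((one_form \<alpha> \<beta> \<gamma> \<delta> 1 u v)\<^sup>2 + (one_form \<alpha> \<beta> \<gamma> \<delta> 2 u v)\<^sup>2) + (one_form \<alpha> \<beta> \<gamma> \<delta> 3 u v)\<^sup>2
      + ((one_form \<alpha> \<beta> \<gamma> \<delta> 4 u v)\<^sup>2 + (one_form \<alpha> \<beta> \<gamma> \<delta> 5 u v)\<^sup>2) + (one_form \<alpha> \<beta> \<gamma> \<delta> 6 u v)\<^sup>2"
    unfolding index_set_6 by simp
  then show ?thesis
    unfolding 12 45 36 by (simp add: uv ds2_def)
qed

text \<open>The \<open>\<gamma>\<close>-part is diagonalized as \<open>(dq + x dp)\<^sup>2 / y + y dp\<^sup>2\<close>. The formula is a polynomial in
  the coordinates and \<open>1 / y\<close>, from which smoothness is read off below.\<close>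
lemma metric_tensor_tuple:
  assumes "y > 0"
  shows "metric_tensor \<alpha> \<beta> \<gamma> \<delta> (x, y, \<theta>, p, q, \<kappa>) (dx, dy, d\<theta>, dp, dq, d\<kappa>) (dx', dy', d\<theta>', dp', dq', d\<kappa>') =
     \<alpha> * (1 / y)\<^sup>2 * (dx * dx' + dy * dy')
     + \<beta> * (1 / y * dx + 2 * d\<theta>) * (1 / y * dx' + 2 * d\<theta>')
     + \<gamma> * (1 / y) * ((dq + x * dp) * (dq' + x * dp')) + \<gamma> * (y * (dp * dp'))
     + \<delta> * (d\<kappa> - p * dq + q * dp) * (d\<kappa>' - p * dq' + q * dp')"
proof -
  define r where "r = 1 / y"
  have r: "y * r = 1" and dr: "t / y = t * r" for t using assms by (simp_all add: r_def)
  have "metric_tensor \<alpha> \<beta> \<gamma> \<delta> (x, y, \<theta>, p, q, \<kappa>) (dx, dy, d\<theta>, dp, dq, d\<kappa>) (dx', dy', d\<theta>', dp', dq', d\<kappa>') =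
     \<alpha> * (1 / y)\<^sup>2 * (dx * dx' + dy * dy')
     + \<beta> * (1 / y * dx + 2 * d\<theta>) * (1 / y * dx' + 2 * d\<theta>')
     + \<gamma> * (1 / y) * (dq * dq' + (x\<^sup>2 + y\<^sup>2) * (dp * dp') + x * (dp * dq' + dp' * dq))
     + \<delta> * (d\<kappa> - p * dq + q * dp) * (d\<kappa>' - p * dq' + q * dp')"
    by (simp add: metric_tensor_def ds2_def power_divide divide_simps)
       (simp add: power2_eq_square algebra_simps)
  also have "\<gamma> * (1 / y) * (dq * dq' + (x\<^sup>2 + y\<^sup>2) * (dp * dp') + x * (dp * dq' + dp' * dq)) =
      \<gamma> * (1 / y) * ((dq + x * dp) * (dq' + x * dp')) + \<gamma> * (y * (dp * dp'))"
    unfolding dr using r by algebra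
  finally show ?thesis by simp
qed

lemma metric_matrix_entries:
  assumes y: "y > 0" and ij: "i \<in> {1..6}" "j \<in> {1..6}"
  shows "metric_matrix \<alpha> \<beta> \<gamma> \<delta> (x, y, \<theta>, p, q, \<kappa>) i j =
          [[(\<alpha> + \<beta>) / y\<^sup>2, 0,        2 * \<beta> / y, 0,                               0,                    0],
           [0,             \<alpha> / y\<^sup>2, 0,         0,                               0,                    0],
           [2 * \<beta> / y,     0,        4 * \<beta>,     0,                               0,                    0],
           [0, 0, 0,       \<gamma> * ((x\<^sup>2 + y\<^sup>2) / y) + \<delta> * q\<^sup>2, \<gamma> * (x / y) - \<delta> * p * q, \<delta> * q],
           [0, 0, 0,       \<gamma> * (x / y) - \<delta> * p * q,         \<gamma> / y + \<delta> * p\<^sup>2,       - \<delta> * p],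
           [0, 0, 0,       \<delta> * q,                           - \<delta> * p,             \<delta>]]
          ! (i - 1) ! (j - 1)"
  using ij unfolding index_set_6
  apply (elim insertE emptyE)
  by (use y in \<open>simp_all add: metric_matrix_def coord_vec_def metric_tensor_tuple power2_eq_square
        field_simps\<close>)

section \<open>The dual frame and its commutators\<close>

lemma vfield_simps:
  "vfield \<alpha> \<beta> \<gamma> \<delta> 1 (x, y, \<theta>, p, q, \<kappa>) =
     (1 / sqrt \<alpha>) *\<^sub>R (y * cos (2 * \<theta>), y * sin (2 * \<theta>), - (1 / 2) * cos (2 * \<theta>), 0, 0, 0)"
  "vfield \<alpha> \<beta> \<gamma> \<delta> 2 (x, y, \<theta>, p, q, \<kappa>) =
     (1 / sqrt \<alpha>) *\<^sub>R (- y * sin (2 * \<theta>), y * cos (2 * \<theta>), 1 / 2 * sin (2 * \<theta>), 0, 0, 0)"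
  "vfield \<alpha> \<beta> \<gamma> \<delta> 3 (x, y, \<theta>, p, q, \<kappa>) = (1 / (2 * sqrt \<beta>)) *\<^sub>R (0, 0, 1, 0, 0, 0)"
  "vfield \<alpha> \<beta> \<gamma> \<delta> 4 (x, y, \<theta>, p, q, \<kappa>) =
     (1 / sqrt \<gamma>) *\<^sub>R (0, 0, 0, entry_d x y \<theta>, - entry_b x y \<theta>, - (p * entry_b x y \<theta> + q * entry_d x y \<theta>))"
  "vfield \<alpha> \<beta> \<gamma> \<delta> 5 (x, y, \<theta>, p, q, \<kappa>) =
     (1 / sqrt \<gamma>) *\<^sub>R (0, 0, 0, - entry_c x y \<theta>, entry_a x y \<theta>, p * entry_a x y \<theta> + q * entry_c x y \<theta>)"
  "vfield \<alpha> \<beta> \<gamma> \<delta> 6 (x, y, \<theta>, p, q, \<kappa>) = (1 / sqrt \<delta>) *\<^sub>R (0, 0, 0, 0, 0, 1)"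
  by (simp_all add: vfield_def Let_def)

lemma one_form_add:
  assumes "i \<in> {1..6}"
  shows "one_form \<alpha> \<beta> \<gamma> \<delta> i u (v + w) = one_form \<alpha> \<beta> \<gamma> \<delta> i u v + one_form \<alpha> \<beta> \<gamma> \<delta> i u w"
  using assms unfolding index_set_6
  apply (cases u; cases v; cases w)
  apply (elim insertE emptyE; hypsubst)
  apply (simp_all only: one_form_simps add_Pair)
  by (simp_all add: algebra_simps add_divide_distrib)

lemma metric_tensor_eq_sum:
  assumes "u \<in> S_domain" "\<alpha> \<ge> 0" "\<beta> \<ge> 0" "\<gamma> \<ge> 0" "\<delta> \<ge> 0"
  shows "metric_tensor \<alpha> \<beta> \<gamma> \<delta> u v w = (\<Sum>i = 1..6. one_form \<alpha> \<beta> \<gamma> \<delta> i u v * one_form \<alpha> \<beta> \<gamma> \<delta> i u w)"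
proof -
  let ?l = "\<lambda>i. one_form \<alpha> \<beta> \<gamma> \<delta> i u"
  have "metric_tensor \<alpha> \<beta> \<gamma> \<delta> u v w =
      ((\<Sum>i = 1..6. (?l i (v + w))\<^sup>2) - (\<Sum>i = 1..6. (?l i v)\<^sup>2) - (\<Sum>i = 1..6. (?l i w)\<^sup>2)) / 2"
    unfolding metric_tensor_def sum_squares_one_form[OF assms] ..
  also have "\<dots> = (\<Sum>i = 1..6. ((?l i (v + w))\<^sup>2 - (?l i v)\<^sup>2 - (?l i w)\<^sup>2) / 2)"
    unfolding sum_subtractf[symmetric] sum_divide_distrib ..
  also have "\<dots> = (\<Sum>i = 1..6. ?l i v * ?l i w)"
    by (intro sum.cong) (simp_all add: one_form_add power2_eq_square algebra_simps)
  finally show ?thesis .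
qed

lemma one_form_vfield_dual:
  assumes u: "u \<in> S_domain" and pos: "\<alpha> > 0" "\<beta> > 0" "\<gamma> > 0" "\<delta> > 0"
    and ij: "i \<in> {1..6}" "j \<in> {1..6}"
  shows "one_form \<alpha> \<beta> \<gamma> \<delta> i u (vfield \<alpha> \<beta> \<gamma> \<delta> j u) = (if i = j then 1 else 0)"
proof -
  obtain x y \<theta> p q \<kappa> where u_eq: "u = (x, y, \<theta>, p, q, \<kappa>)"
    by (metis prod_cases6)
  have y: "y > 0" using u by (simp add: u_eq)
  obtain C S where CS: "cos (2 * \<theta>) = C" "sin (2 * \<theta>) = S" and CS1: "C * C + S * S = 1"
    using sin_cos_squared_add3 by blast
  have t: "C * (C * k) + S * (S * k) = k" for k
    using CS1 by algebra
  have det: "entry_a x y \<theta> * entry_d x y \<theta> = 1 + entry_b x y \<theta> * entry_c x y \<theta>"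
    "entry_d x y \<theta> * entry_a x y \<theta> = 1 + entry_b x y \<theta> * entry_c x y \<theta>"
    using entry_det[OF y, of x \<theta>] by (simp_all add: algebra_simps)
  show ?thesis
    using ij unfolding index_set_6 u_eq
    apply (elim insertE emptyE; hypsubst)
    apply (simp_all only: one_form_simps vfield_simps scaleR_Pair CS)
    apply (use y pos in \<open>simp_all add: field_simps det t\<close>)
    done
qed

lemma vfield_orthonormal:
  assumes u: "u \<in> S_domain" and pos: "\<alpha> > 0" "\<beta> > 0" "\<gamma> > 0" "\<delta> > 0"
    and ij: "i \<in> {1..6}" "j \<in> {1..6}"
  shows "metric_tensor \<alpha> \<beta> \<gamma> \<delta> u (vfield \<alpha> \<beta> \<gamma> \<delta> i u) (vfield \<alpha> \<beta> \<gamma> \<delta> j u) = (if i = j then 1 else 0)"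
proof -
  have "metric_tensor \<alpha> \<beta> \<gamma> \<delta> u (vfield \<alpha> \<beta> \<gamma> \<delta> i u) (vfield \<alpha> \<beta> \<gamma> \<delta> j u) =
      (\<Sum>k = 1..6. (if k = i then 1 else 0) * (if k = j then 1 else 0))"
    using pos unfolding metric_tensor_eq_sum[OF u less_imp_le less_imp_le less_imp_le less_imp_le, OF pos]
    by (intro sum.cong refl arg_cong2[of _ _ _ _ times] one_form_vfield_dual u ij) simp_all
  also have "\<dots> = (if i = j then 1 else 0)"
    using ij by (simp add: mult_delta_left sum.delta)
  finally show ?thesis .
qed

lemma lie_bracket_eq:
  assumes "(V has_derivative V') (at u)" "(W has_derivative W') (at u)"
  shows "lie_bracket V W u = W' (V u) - V' (W u)"
  using assms by (simp add: lie_bracket_def flip: frechet_derivative_at)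

lemma has_derivative_vfield:
  assumes "y > 0"
  shows "(vfield \<alpha> \<beta> \<gamma> \<delta> 1 has_derivative (\<lambda>v. (1 / sqrt \<alpha>) *\<^sub>R
            (y_of v * cos (2 * \<theta>) - y * (2 * \<theta>_of v * sin (2 * \<theta>)),
             y_of v * sin (2 * \<theta>) + y * (2 * \<theta>_of v * cos (2 * \<theta>)), \<theta>_of v * sin (2 * \<theta>), 0, 0, 0)))
          (at (x, y, \<theta>, p, q, \<kappa>))"
    and "(vfield \<alpha> \<beta> \<gamma> \<delta> 2 has_derivative (\<lambda>v. (1 / sqrt \<alpha>) *\<^sub>R
            (- y_of v * sin (2 * \<theta>) - y * (2 * \<theta>_of v * cos (2 * \<theta>)),
             y_of v * cos (2 * \<theta>) - y * (2 * \<theta>_of v * sin (2 * \<theta>)), \<theta>_of v * cos (2 * \<theta>), 0, 0, 0)))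
          (at (x, y, \<theta>, p, q, \<kappa>))"
    and "(vfield \<alpha> \<beta> \<gamma> \<delta> 3 has_derivative (\<lambda>_. 0)) (at (x, y, \<theta>, p, q, \<kappa>))"
    and "(vfield \<alpha> \<beta> \<gamma> \<delta> 4 has_derivative (\<lambda>v. (1 / sqrt \<gamma>) *\<^sub>R
            (0, 0, 0, d_entry_d x y \<theta> (y_of v) (\<theta>_of v), - d_entry_b x y \<theta> (x_of v) (y_of v) (\<theta>_of v),
             - (p_of v * entry_b x y \<theta> + p * d_entry_b x y \<theta> (x_of v) (y_of v) (\<theta>_of v)
                + (q_of v * entry_d x y \<theta> + q * d_entry_d x y \<theta> (y_of v) (\<theta>_of v))))))
          (at (x, y, \<theta>, p, q, \<kappa>))"
    and "(vfield \<alpha> \<beta> \<gamma> \<delta> 5 has_derivative (\<lambda>v. (1 / sqrt \<gamma>) *\<^sub>R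
            (0, 0, 0, - d_entry_c x y \<theta> (y_of v) (\<theta>_of v), d_entry_a x y \<theta> (x_of v) (y_of v) (\<theta>_of v),
             p_of v * entry_a x y \<theta> + p * d_entry_a x y \<theta> (x_of v) (y_of v) (\<theta>_of v)
                + (q_of v * entry_c x y \<theta> + q * d_entry_c x y \<theta> (y_of v) (\<theta>_of v)))))
          (at (x, y, \<theta>, p, q, \<kappa>))"
    and "(vfield \<alpha> \<beta> \<gamma> \<delta> 6 has_derivative (\<lambda>_. 0)) (at (x, y, \<theta>, p, q, \<kappa>))"
proof -
  note intros = derivative_eq_intros has_derivative_entry
  have fn: "vfield \<alpha> \<beta> \<gamma> \<delta> 1 = (\<lambda>u. (1 / sqrt \<alpha>) *\<^sub>R (y_of u * cos (2 * \<theta>_of u), y_of u * sin (2 * \<theta>_of u),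
        - (1 / 2) * cos (2 * \<theta>_of u), 0, 0, 0))"
    "vfield \<alpha> \<beta> \<gamma> \<delta> 2 = (\<lambda>u. (1 / sqrt \<alpha>) *\<^sub>R (- y_of u * sin (2 * \<theta>_of u), y_of u * cos (2 * \<theta>_of u),
        1 / 2 * sin (2 * \<theta>_of u), 0, 0, 0))"
    "vfield \<alpha> \<beta> \<gamma> \<delta> 3 = (\<lambda>u. (1 / (2 * sqrt \<beta>)) *\<^sub>R (0, 0, 1, 0, 0, 0))"
    "vfield \<alpha> \<beta> \<gamma> \<delta> 4 = (\<lambda>u. (1 / sqrt \<gamma>) *\<^sub>R (0, 0, 0, entry_d (x_of u) (y_of u) (\<theta>_of u),
        - entry_b (x_of u) (y_of u) (\<theta>_of u),
        - (p_of u * entry_b (x_of u) (y_of u) (\<theta>_of u) + q_of u * entry_d (x_of u) (y_of u) (\<theta>_of u))))"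
    "vfield \<alpha> \<beta> \<gamma> \<delta> 5 = (\<lambda>u. (1 / sqrt \<gamma>) *\<^sub>R (0, 0, 0, - entry_c (x_of u) (y_of u) (\<theta>_of u),
        entry_a (x_of u) (y_of u) (\<theta>_of u),
        p_of u * entry_a (x_of u) (y_of u) (\<theta>_of u) + q_of u * entry_c (x_of u) (y_of u) (\<theta>_of u)))"
    "vfield \<alpha> \<beta> \<gamma> \<delta> 6 = (\<lambda>u. (1 / sqrt \<delta>) *\<^sub>R (0, 0, 0, 0, 0, 1))"
    by (auto simp: vfield_def Let_def)
  show "(vfield \<alpha> \<beta> \<gamma> \<delta> 3 has_derivative (\<lambda>_. 0)) (at (x, y, \<theta>, p, q, \<kappa>))"
    "(vfield \<alpha> \<beta> \<gamma> \<delta> 6 has_derivative (\<lambda>_. 0)) (at (x, y, \<theta>, p, q, \<kappa>))"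
    unfolding fn by (rule has_derivative_const)+
  show "(vfield \<alpha> \<beta> \<gamma> \<delta> 1 has_derivative (\<lambda>v. (1 / sqrt \<alpha>) *\<^sub>R
            (y_of v * cos (2 * \<theta>) - y * (2 * \<theta>_of v * sin (2 * \<theta>)),
             y_of v * sin (2 * \<theta>) + y * (2 * \<theta>_of v * cos (2 * \<theta>)), \<theta>_of v * sin (2 * \<theta>), 0, 0, 0)))
          (at (x, y, \<theta>, p, q, \<kappa>))"
    unfolding fn by (rule has_derivative_scaleR_right) (auto intro!: intros ext simp: zero_prod_def)
  show "(vfield \<alpha> \<beta> \<gamma> \<delta> 2 has_derivative (\<lambda>v. (1 / sqrt \<alpha>) *\<^sub>R
            (- y_of v * sin (2 * \<theta>) - y * (2 * \<theta>_of v * cos (2 * \<theta>)),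
             y_of v * cos (2 * \<theta>) - y * (2 * \<theta>_of v * sin (2 * \<theta>)), \<theta>_of v * cos (2 * \<theta>), 0, 0, 0)))
          (at (x, y, \<theta>, p, q, \<kappa>))"
    unfolding fn by (rule has_derivative_scaleR_right) (auto intro!: intros ext simp: zero_prod_def)
  show "(vfield \<alpha> \<beta> \<gamma> \<delta> 4 has_derivative (\<lambda>v. (1 / sqrt \<gamma>) *\<^sub>R
            (0, 0, 0, d_entry_d x y \<theta> (y_of v) (\<theta>_of v), - d_entry_b x y \<theta> (x_of v) (y_of v) (\<theta>_of v),
             - (p_of v * entry_b x y \<theta> + p * d_entry_b x y \<theta> (x_of v) (y_of v) (\<theta>_of v)
                + (q_of v * entry_d x y \<theta> + q * d_entry_d x y \<theta> (y_of v) (\<theta>_of v))))))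
          (at (x, y, \<theta>, p, q, \<kappa>))"
    unfolding fn using assms
    by (intro has_derivative_scaleR_right) (auto intro!: intros ext simp: zero_prod_def)
  show "(vfield \<alpha> \<beta> \<gamma> \<delta> 5 has_derivative (\<lambda>v. (1 / sqrt \<gamma>) *\<^sub>R
            (0, 0, 0, - d_entry_c x y \<theta> (y_of v) (\<theta>_of v), d_entry_a x y \<theta> (x_of v) (y_of v) (\<theta>_of v),
             p_of v * entry_a x y \<theta> + p * d_entry_a x y \<theta> (x_of v) (y_of v) (\<theta>_of v)
                + (q_of v * entry_c x y \<theta> + q * d_entry_c x y \<theta> (y_of v) (\<theta>_of v)))))
          (at (x, y, \<theta>, p, q, \<kappa>))"
    unfolding fn using assms
    by (intro has_derivative_scaleR_right) (auto intro!: intros ext simp: zero_prod_def)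
qed

text \<open>Up to constant factors, the field \<open>L\<^sup>1\<close> is the left-invariant field of the symmetric
  matrix with zero diagonal and off-diagonal entries \<open>1 / 2\<close>: along it \<open>dM\<close> is \<open>M\<close> times this
  matrix. For \<open>L\<^sup>2\<close> the matrix is diagonal with entries \<open>1 / 2\<close> and \<open>- 1 / 2\<close>, for \<open>L\<^sup>3\<close> it
  is an infinitesimal rotation.\<close>
lemma d_entry_along_L1:
  fixes x y \<theta> t :: real
  assumes y: "y > 0"
  defines "dx \<equiv> t * (y * cos (2 * \<theta>))" and "dy \<equiv> t * (y * sin (2 * \<theta>))"
    and "d\<theta> \<equiv> t * (- (1 / 2) * cos (2 * \<theta>))"
  shows "d_entry_a x y \<theta> dx dy d\<theta> = t / 2 * entry_b x y \<theta>"
    and "d_entry_b x y \<theta> dx dy d\<theta> = t / 2 * entry_a x y \<theta>"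
    and "d_entry_c x y \<theta> dy d\<theta> = t / 2 * entry_d x y \<theta>"
    and "d_entry_d x y \<theta> dy d\<theta> = t / 2 * entry_c x y \<theta>"
proof -
  define w where "w = x / y"
  have w: "x = w * y" using y by (simp add: w_def)
  let ?c = "entry_c x y \<theta>" and ?d = "entry_d x y \<theta>"
  note n = entry_norm[OF y, of x \<theta>] and ab = entry_ab[OF y, of x \<theta>]
  note cs = double_angle_entries[OF y, of \<theta> x]
  have r: "e / (2 * y) * (t * (y * s)) = e / 2 * (t * s)" for e s
    using y by simp
  have a: "d_entry_a x y \<theta> dx dy d\<theta> = ?c * dx + (?d - w * ?c) / 2 * dy - entry_b x y \<theta> * d\<theta>"
    and b: "d_entry_b x y \<theta> dx dy d\<theta> = ?d * dx - (?c + w * ?d) / 2 * dy + entry_a x y \<theta> * d\<theta>"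
    by (simp_all add: d_entry_a_def d_entry_b_def w_def)
  have c: "d_entry_c x y \<theta> dy d\<theta> = - (?c / 2 * (t * sin (2 * \<theta>))) - ?d * d\<theta>"
    and d: "d_entry_d x y \<theta> dy d\<theta> = - (?d / 2 * (t * sin (2 * \<theta>))) + ?c * d\<theta>"
    unfolding d_entry_c_def d_entry_d_def dy_def mult_minus_left r by simp_all
  show "d_entry_a x y \<theta> dx dy d\<theta> = t / 2 * entry_b x y \<theta>"
    unfolding a ab unfolding dx_def dy_def d\<theta>_def cs using n w by algebra
  show "d_entry_b x y \<theta> dx dy d\<theta> = t / 2 * entry_a x y \<theta>"
    unfolding b ab unfolding dx_def dy_def d\<theta>_def cs using n w by algebra
  show "d_entry_c x y \<theta> dy d\<theta> = t / 2 * entry_d x y \<theta>"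
    unfolding c unfolding d\<theta>_def cs using n by algebra
  show "d_entry_d x y \<theta> dy d\<theta> = t / 2 * entry_c x y \<theta>"
    unfolding d unfolding d\<theta>_def cs using n by algebra
qed

lemma d_entry_along_L2:
  fixes x y \<theta> t :: real
  assumes y: "y > 0"
  defines "dx \<equiv> t * (- y * sin (2 * \<theta>))" and "dy \<equiv> t * (y * cos (2 * \<theta>))"
    and "d\<theta> \<equiv> t * (1 / 2 * sin (2 * \<theta>))"
  shows "d_entry_a x y \<theta> dx dy d\<theta> = t / 2 * entry_a x y \<theta>"
    and "d_entry_b x y \<theta> dx dy d\<theta> = - (t / 2) * entry_b x y \<theta>"
    and "d_entry_c x y \<theta> dy d\<theta> = t / 2 * entry_c x y \<theta>"
    and "d_entry_d x y \<theta> dy d\<theta> = - (t / 2) * entry_d x y \<theta>"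
proof -
  define w where "w = x / y"
  have w: "x = w * y" using y by (simp add: w_def)
  let ?c = "entry_c x y \<theta>" and ?d = "entry_d x y \<theta>"
  note n = entry_norm[OF y, of x \<theta>] and ab = entry_ab[OF y, of x \<theta>]
  note cs = double_angle_entries[OF y, of \<theta> x]
  have r: "e / (2 * y) * (t * (y * s)) = e / 2 * (t * s)" for e s
    using y by simp
  have a: "d_entry_a x y \<theta> dx dy d\<theta> = ?c * dx + (?d - w * ?c) / 2 * dy - entry_b x y \<theta> * d\<theta>"
    and b: "d_entry_b x y \<theta> dx dy d\<theta> = ?d * dx - (?c + w * ?d) / 2 * dy + entry_a x y \<theta> * d\<theta>"
    by (simp_all add: d_entry_a_def d_entry_b_def w_def)
  have c: "d_entry_c x y \<theta> dy d\<theta> = - (?c / 2 * (t * cos (2 * \<theta>))) - ?d * d\<theta>"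
    and d: "d_entry_d x y \<theta> dy d\<theta> = - (?d / 2 * (t * cos (2 * \<theta>))) + ?c * d\<theta>"
    unfolding d_entry_c_def d_entry_d_def dy_def mult_minus_left r by simp_all
  show "d_entry_a x y \<theta> dx dy d\<theta> = t / 2 * entry_a x y \<theta>"
    unfolding a ab unfolding dx_def dy_def d\<theta>_def cs using n w by algebra
  show "d_entry_b x y \<theta> dx dy d\<theta> = - (t / 2) * entry_b x y \<theta>"
    unfolding b ab unfolding dx_def dy_def d\<theta>_def cs using n w by algebra
  show "d_entry_c x y \<theta> dy d\<theta> = t / 2 * entry_c x y \<theta>"
    unfolding c unfolding d\<theta>_def cs using n by algebra
  show "d_entry_d x y \<theta> dy d\<theta> = - (t / 2) * entry_d x y \<theta>"
    unfolding d unfolding d\<theta>_def cs using n by algebra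
qed

lemma d_entry_along_L3:
  "d_entry_a x y \<theta> 0 0 t = - t * entry_b x y \<theta>" "d_entry_b x y \<theta> 0 0 t = t * entry_a x y \<theta>"
  "d_entry_c x y \<theta> 0 t = - t * entry_d x y \<theta>" "d_entry_d x y \<theta> 0 t = t * entry_c x y \<theta>"
  by (simp_all add: d_entry_a_def d_entry_b_def d_entry_c_def d_entry_d_def)

lemma d_entry_zero [simp]:
  "d_entry_a x y \<theta> 0 0 0 = 0" "d_entry_b x y \<theta> 0 0 0 = 0" "d_entry_c x y \<theta> 0 0 = 0" "d_entry_d x y \<theta> 0 0 = 0"
  by (simp_all add: d_entry_a_def d_entry_b_def d_entry_c_def d_entry_d_def)

lemma commutators:
  fixes \<alpha> \<beta> \<gamma> \<delta> :: real
  assumes u: "u \<in> S_domain" and pos: "\<alpha> > 0" "\<beta> > 0" "\<gamma> > 0" "\<delta> > 0"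
  defines "L \<equiv> vfield \<alpha> \<beta> \<gamma> \<delta>"
  shows "lie_bracket (L 1) (L 2) u = - (sqrt \<beta> / \<alpha>) *\<^sub>R L 3 u"
    and "lie_bracket (L 2) (L 3) u = (1 / sqrt \<beta>) *\<^sub>R L 1 u"
    and "lie_bracket (L 3) (L 1) u = (1 / sqrt \<beta>) *\<^sub>R L 2 u"
    and "lie_bracket (L 1) (L 4) u = - (1 / (2 * sqrt \<alpha>)) *\<^sub>R L 5 u"
    and "lie_bracket (L 1) (L 5) u = - (1 / (2 * sqrt \<alpha>)) *\<^sub>R L 4 u"
    and "lie_bracket (L 2) (L 4) u = - (1 / (2 * sqrt \<alpha>)) *\<^sub>R L 4 u"
    and "lie_bracket (L 2) (L 5) u = (1 / (2 * sqrt \<alpha>)) *\<^sub>R L 5 u"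
    and "lie_bracket (L 3) (L 4) u = - (1 / (2 * sqrt \<beta>)) *\<^sub>R L 5 u"
    and "lie_bracket (L 3) (L 5) u = (1 / (2 * sqrt \<beta>)) *\<^sub>R L 4 u"
    and "lie_bracket (L 4) (L 5) u = (2 * sqrt \<delta> / \<gamma>) *\<^sub>R L 6 u"
    and "i \<in> {1..5} \<Longrightarrow> lie_bracket (L i) (L 6) u = 0"
proof -
  obtain x y \<theta> p q \<kappa> where u_eq: "u = (x, y, \<theta>, p, q, \<kappa>)"
    by (metis prod_cases6)
  have y: "y > 0" using u by (simp add: u_eq)
  note hd = has_derivative_vfield[OF y, where \<alpha> = \<alpha> and \<beta> = \<beta> and \<gamma> = \<gamma> and \<delta> = \<delta>
    and x = x and \<theta> = \<theta> and p = p and q = q and \<kappa> = \<kappa>, folded L_def u_eq]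
  note L = vfield_simps[where \<alpha> = \<alpha> and \<beta> = \<beta> and \<gamma> = \<gamma> and \<delta> = \<delta>
    and x = x and y = y and \<theta> = \<theta> and p = p and q = q and \<kappa> = \<kappa>, folded L_def u_eq, unfolded scaleR_Pair real_scaleR_def]
  note tuple = scaleR_Pair real_scaleR_def diff_Pair fst_conv snd_conv prod.inject prod.case
  obtain C S where CS: "cos (2 * \<theta>) = C" "sin (2 * \<theta>) = S" and CS1: "C * C + S * S = 1"
    using sin_cos_squared_add3 by blast
  obtain A where A: "sqrt \<alpha> = A" "\<alpha> = A * A" "A > 0"
    using pos that[of "sqrt \<alpha>"] by simp
  obtain B where B: "sqrt \<beta> = B" "\<beta> = B * B" "B > 0"
    using pos that[of "sqrt \<beta>"] by simp
  obtain G where G: "sqrt \<gamma> = G" "\<gamma> = G * G" "G > 0"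
    using pos that[of "sqrt \<gamma>"] by simp
  obtain D where D: "sqrt \<delta> = D" "\<delta> = D * D" "D > 0"
    using pos that[of "sqrt \<delta>"] by simp
  have sc: "C * (C * k) + S * (S * k) = k" "C * (k * C) + S * (k * S) = k" for k
    using CS1 by algebra+
  have det: "entry_a x y \<theta> * entry_d x y \<theta> - entry_b x y \<theta> * entry_c x y \<theta> = 1"
    using entry_det[OF y] .
  note d1 = d_entry_along_L1[OF y, of x \<theta>] and d2 = d_entry_along_L2[OF y, of x \<theta>]
  show "lie_bracket (L 1) (L 2) u = - (sqrt \<beta> / \<alpha>) *\<^sub>R L 3 u"
    unfolding lie_bracket_eq[OF hd(1,2)] L tuple CS A(1) B(1) unfolding A(2) B(2) using A(3) B(3)
    by (simp add: field_simps sc) (use CS1 in algebra)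
  show "lie_bracket (L 2) (L 3) u = (1 / sqrt \<beta>) *\<^sub>R L 1 u"
    unfolding lie_bracket_eq[OF hd(2,3)] L tuple CS A(1) B(1) unfolding A(2) B(2) using A(3) B(3)
    by (simp add: zero_prod_def field_simps)
  show "lie_bracket (L 3) (L 1) u = (1 / sqrt \<beta>) *\<^sub>R L 2 u"
    unfolding lie_bracket_eq[OF hd(3,1)] L tuple CS A(1) B(1) unfolding A(2) B(2) using A(3) B(3)
    by (simp add: zero_prod_def field_simps)
  show "lie_bracket (L 1) (L 4) u = - (1 / (2 * sqrt \<alpha>)) *\<^sub>R L 5 u"
    unfolding lie_bracket_eq[OF hd(1,4)] L tuple d1 using pos
    by (simp add: field_simps)
  show "lie_bracket (L 1) (L 5) u = - (1 / (2 * sqrt \<alpha>)) *\<^sub>R L 4 u"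
    unfolding lie_bracket_eq[OF hd(1,5)] L tuple d1 using pos
    by (simp add: field_simps)
  show "lie_bracket (L 2) (L 4) u = - (1 / (2 * sqrt \<alpha>)) *\<^sub>R L 4 u"
    unfolding lie_bracket_eq[OF hd(2,4)] L tuple d2 using pos
    by (simp add: field_simps)
  show "lie_bracket (L 2) (L 5) u = (1 / (2 * sqrt \<alpha>)) *\<^sub>R L 5 u"
    unfolding lie_bracket_eq[OF hd(2,5)] L tuple d2 using pos
    by (simp add: field_simps)
  show "lie_bracket (L 3) (L 4) u = - (1 / (2 * sqrt \<beta>)) *\<^sub>R L 5 u"
    unfolding lie_bracket_eq[OF hd(3,4)] L tuple using pos
    by (simp add: d_entry_along_L3 field_simps)
  show "lie_bracket (L 3) (L 5) u = (1 / (2 * sqrt \<beta>)) *\<^sub>R L 4 u"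
    unfolding lie_bracket_eq[OF hd(3,5)] L tuple using pos
    by (simp add: d_entry_along_L3 field_simps)
  show "lie_bracket (L 4) (L 5) u = (2 * sqrt \<delta> / \<gamma>) *\<^sub>R L 6 u"
    unfolding lie_bracket_eq[OF hd(4,5)] L tuple G(1) D(1) unfolding G(2) using G(3) D(3)
    by (simp add: field_simps) (use det in algebra)
  show "lie_bracket (L i) (L 6) u = 0" if "i \<in> {1..5}"
  proof -
    have "i \<in> {1, 2, 3, 4, 5}" using that by auto
    then show ?thesis
      using hd by (elim insertE emptyE) (simp_all add: lie_bracket_eq[OF _ hd(6)] L zero_prod_def)
  qed
qed

section \<open>Smoothness and positivity\<close>

lemma differentiable_at_open:
  assumes "open D" "f differentiable_on D" "u \<in> D"
  shows "(f has_derivative frechet_derivative f (at u)) (at u)"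
  using assms differentiable_on_eq_differentiable_at frechet_derivative_works by blast

text \<open>The class \<open>Ck_on\<close> speaks of the chosen derivative of a function. On an open set this depends only on
  the values of the function there, so that formulas valid on the set may be substituted.\<close>
lemma Ck_on_cong:
  assumes D: "open D" and "Ck_on k D f" and "\<And>u. u \<in> D \<Longrightarrow> f u = g u"
  shows "Ck_on k D g"
  using assms(2,3)
proof (induction k arbitrary: f g)
  case 0
  then show ?case by (simp cong: continuous_on_cong)
next
  case (Suc k)
  have hd: "(g has_derivative frechet_derivative f (at u)) (at u)" if "u \<in> D" for u
    using has_derivative_transform_within_open[OF differentiable_at_open[OF D _ that] D that] Suc.prems
    by auto
  then have "g differentiable_on D"
    using D differentiable_on_eq_differentiable_at differentiable_def by blast
  moreover have "Ck_on k D (\<lambda>u. frechet_derivative g (at u) b)" if "b \<in> Basis" for b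
  proof (rule Suc.IH)
    show "Ck_on k D (\<lambda>u. frechet_derivative f (at u) b)"
      using Suc.prems(1) that by simp
    show "frechet_derivative f (at u) b = frechet_derivative g (at u) b" if "u \<in> D" for u
      using frechet_derivative_at[OF hd[OF that]] by simp
  qed
  ultimately show ?case by simp
qed

lemma Ck_on_SucI:
  assumes D: "open D" and hd: "\<And>u. u \<in> D \<Longrightarrow> (f has_derivative f' u) (at u)"
    and "\<And>b. b \<in> Basis \<Longrightarrow> Ck_on k D (\<lambda>u. f' u b)"
  shows "Ck_on (Suc k) D f"
proof -
  have "f differentiable_on D"
    using D hd differentiable_on_eq_differentiable_at differentiable_def by blast
  moreover have "Ck_on k D (\<lambda>u. frechet_derivative f (at u) b)" if "b \<in> Basis" for b
    by (rule Ck_on_cong[OF D assms(3)[OF that]]) (simp flip: frechet_derivative_at[OF hd])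
  ultimately show ?thesis by simp
qed

lemma Ck_on_SucD: "Ck_on (Suc k) D f \<Longrightarrow> Ck_on k D f"
proof (induction k arbitrary: f)
  case 0
  then show ?case by (simp add: differentiable_imp_continuous_on)
next
  case (Suc k)
  then show ?case using Ck_on.simps(2) by blast
qed

lemma Ck_on_const: "Ck_on k D (\<lambda>u. c)"
  by (induction k arbitrary: c) simp_all

lemma Ck_on_linear:
  fixes l :: "'c::euclidean_space \<Rightarrow> real"
  assumes "open D" "linear l"
  shows "Ck_on k D l"
proof (cases k)
  case 0
  then show ?thesis using assms by (simp add: linear_continuous_on linear_linear)
next
  case (Suc n)
  have "(l has_derivative l) (at u)" for u
    using assms by (simp add: bounded_linear_imp_has_derivative linear_linear)
  then show ?thesis
    unfolding Suc by (rule Ck_on_SucI[OF assms(1)]) (rule Ck_on_const)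
qed

lemma Ck_on_derivative:
  assumes "Ck_on (Suc k) D f" "b \<in> Basis"
  shows "Ck_on k D (\<lambda>u. frechet_derivative f (at u) b)"
  using assms by simp

lemma Ck_on_add:
  fixes D :: "'c::euclidean_space set"
  assumes D: "open D" and "Ck_on k D f" "Ck_on k D g"
  shows "Ck_on k D (\<lambda>u. f u + g u)"
  using assms(2,3)
proof (induction k arbitrary: f g)
  case 0
  then show ?case by (simp add: continuous_on_add)
next
  case (Suc k)
  show ?case
  proof (rule Ck_on_SucI[OF D])
    fix u assume u: "u \<in> D"
    show "((\<lambda>u. f u + g u) has_derivative
        (\<lambda>b. frechet_derivative f (at u) b + frechet_derivative g (at u) b)) (at u)"
      using Suc.prems u by (intro has_derivative_add differentiable_at_open[OF D]) simp_all
  next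
    fix b :: 'c assume "b \<in> Basis"
    then show "Ck_on k D (\<lambda>u. frechet_derivative f (at u) b + frechet_derivative g (at u) b)"
      by (intro Suc.IH Ck_on_derivative Suc.prems)
  qed
qed

lemma Ck_on_mult:
  fixes D :: "'c::euclidean_space set"
  assumes D: "open D" and "Ck_on k D f" "Ck_on k D g"
  shows "Ck_on k D (\<lambda>u. f u * g u)"
  using assms(2,3)
proof (induction k arbitrary: f g)
  case 0
  then show ?case by (simp add: continuous_on_mult)
next
  case (Suc k)
  show ?case
  proof (rule Ck_on_SucI[OF D])
    fix u assume u: "u \<in> D"
    show "((\<lambda>u. f u * g u) has_derivative
        (\<lambda>b. f u * frechet_derivative g (at u) b + frechet_derivative f (at u) b * g u)) (at u)"
      using Suc.prems u by (intro has_derivative_mult differentiable_at_open[OF D]) simp_all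
  next
    fix b :: 'c assume "b \<in> Basis"
    then show "Ck_on k D (\<lambda>u. f u * frechet_derivative g (at u) b + frechet_derivative f (at u) b * g u)"
      by (intro Ck_on_add[OF D] Suc.IH Ck_on_derivative Suc.prems Suc.prems[THEN Ck_on_SucD])
  qed
qed

lemma Ck_on_diff:
  assumes "open D" "Ck_on k D f" "Ck_on k D g"
  shows "Ck_on k D (\<lambda>u. f u - g u)"
  using Ck_on_add[OF assms(1,2) Ck_on_mult[OF assms(1) Ck_on_const[of k D "- 1"] assms(3)]]
  by simp

lemma Ck_on_inverse:
  fixes D :: "'c::euclidean_space set"
  assumes D: "open D" and "Ck_on k D f" and nz: "\<And>u. u \<in> D \<Longrightarrow> f u \<noteq> 0"
  shows "Ck_on k D (\<lambda>u. 1 / f u)"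
  using assms(2)
proof (induction k)
  case 0
  then show ?case using nz by (auto intro!: continuous_on_divide)
next
  case (Suc k)
  show ?case
  proof (rule Ck_on_SucI[OF D])
    fix u assume u: "u \<in> D"
    have f: "(f has_derivative frechet_derivative f (at u)) (at u)"
      using Suc.prems u by (intro differentiable_at_open[OF D]) simp_all
    show "((\<lambda>u. 1 / f u) has_derivative
        (\<lambda>b. - 1 * ((1 / f u) * (1 / f u)) * frechet_derivative f (at u) b)) (at u)"
      by (rule has_derivative_eq_rhs[OF has_derivative_divide[OF has_derivative_const f nz[OF u]]])
         (simp add: divide_inverse ac_simps)
  next
    fix b :: 'c assume "b \<in> Basis"
    then show "Ck_on k D (\<lambda>u. - 1 * ((1 / f u) * (1 / f u)) * frechet_derivative f (at u) b)"
      by (intro Ck_on_mult[OF D] Ck_on_const Suc.IH Ck_on_derivative Suc.prems Suc.prems[THEN Ck_on_SucD])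
  qed
qed

lemma Ck_on_metric_tensor:
  assumes D: "open D" and s: "Ck_on k D X" "Ck_on k D Y" "Ck_on k D P" "Ck_on k D Q"
    and Y: "\<And>u. u \<in> D \<Longrightarrow> Y u > 0"
  shows "Ck_on k D (\<lambda>u. metric_tensor \<alpha> \<beta> \<gamma> \<delta> (X u, Y u, T u, P u, Q u, K u) v w)"
proof -
  obtain dx dy d\<theta> dp dq d\<kappa> dx' dy' d\<theta>' dp' dq' d\<kappa>' where
    vw: "v = (dx, dy, d\<theta>, dp, dq, d\<kappa>)" "w = (dx', dy', d\<theta>', dp', dq', d\<kappa>')"
    by (metis prod_cases6)
  have r: "Ck_on k D (\<lambda>u. 1 / Y u)"
    using D s(2) by (rule Ck_on_inverse) (use Y in force)
  show ?thesis
    unfolding vw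
    apply (rule Ck_on_cong[OF D _ metric_tensor_tuple[OF Y, symmetric]])
    unfolding power2_eq_square
    by (intro Ck_on_add[OF D] Ck_on_diff[OF D] Ck_on_mult[OF D] s r Ck_on_const)
qed

lemma linear_one_form:
  assumes "i \<in> {1..6}" shows "linear (one_form \<alpha> \<beta> \<gamma> \<delta> i u)"
proof (rule linearI)
  show "one_form \<alpha> \<beta> \<gamma> \<delta> i u (v + w) = one_form \<alpha> \<beta> \<gamma> \<delta> i u v + one_form \<alpha> \<beta> \<gamma> \<delta> i u w" for v w
    using assms by (rule one_form_add)
  show "one_form \<alpha> \<beta> \<gamma> \<delta> i u (r *\<^sub>R v) = r *\<^sub>R one_form \<alpha> \<beta> \<gamma> \<delta> i u v" for r v
    using assms unfolding index_set_6
    apply (cases u; cases v)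
    apply (elim insertE emptyE; hypsubst)
    apply (simp_all only: one_form_simps scaleR_Pair real_scaleR_def)
    by (simp_all add: algebra_simps)
qed

lemma metric_tensor_self:
  assumes "u \<in> S_domain" "\<alpha> \<ge> 0" "\<beta> \<ge> 0" "\<gamma> \<ge> 0" "\<delta> \<ge> 0"
  shows "metric_tensor \<alpha> \<beta> \<gamma> \<delta> u v v = ds2 \<alpha> \<beta> \<gamma> \<delta> u v"
  unfolding metric_tensor_eq_sum[OF assms] by (simp add: power2_eq_square flip: sum_squares_one_form[OF assms])

text \<open>Each of the four summands is a nonnegative square, so the form vanishes only where all of
  them do. Keeping the parameters separate serves all degenerate metrics at once.\<close>
lemma ds2_definite:
  fixes x y \<theta> p q \<kappa> dx dy d\<theta> dp dq d\<kappa> :: real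
  assumes y: "y > 0" and nonneg: "\<alpha> \<ge> 0" "\<beta> \<ge> 0" "\<gamma> \<ge> 0" "\<delta> \<ge> 0"
  defines "n \<equiv> ds2 \<alpha> \<beta> \<gamma> \<delta> (x, y, \<theta>, p, q, \<kappa>) (dx, dy, d\<theta>, dp, dq, d\<kappa>)"
  shows "n \<ge> 0"
    and "n = 0 \<Longrightarrow> \<alpha> > 0 \<Longrightarrow> dx = 0 \<and> dy = 0"
    and "n = 0 \<Longrightarrow> \<beta> > 0 \<Longrightarrow> dx / y + 2 * d\<theta> = 0"
    and "n = 0 \<Longrightarrow> \<gamma> > 0 \<Longrightarrow> dp = 0 \<and> dq = 0"
    and "n = 0 \<Longrightarrow> \<delta> > 0 \<Longrightarrow> d\<kappa> - p * dq + q * dp = 0"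
proof -
  let ?A = "\<alpha> * ((dx\<^sup>2 + dy\<^sup>2) / y\<^sup>2)" and ?B = "\<beta> * (dx / y + 2 * d\<theta>)\<^sup>2"
    and ?C = "\<gamma> / y * ((dq + x * dp)\<^sup>2 + (y * dp)\<^sup>2)" and ?D = "\<delta> * (d\<kappa> - p * dq + q * dp)\<^sup>2"
  have n: "n = ?A + ?B + ?C + ?D"
    by (simp add: n_def ds2_def power2_eq_square algebra_simps)
  have pos: "?A \<ge> 0" "?B \<ge> 0" "?C \<ge> 0" "?D \<ge> 0"
    using y nonneg by simp_all
  show "n \<ge> 0" using pos n by linarith
  assume "n = 0"
  then have z: "?A = 0" "?B = 0" "?C = 0" "?D = 0"
    using pos n by linarith+
  show "\<alpha> > 0 \<Longrightarrow> dx = 0 \<and> dy = 0" "\<beta> > 0 \<Longrightarrow> dx / y + 2 * d\<theta> = 0"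
    "\<delta> > 0 \<Longrightarrow> d\<kappa> - p * dq + q * dp = 0"
    using z y by (auto simp: sum_power2_eq_zero_iff)
  show "\<gamma> > 0 \<Longrightarrow> dp = 0 \<and> dq = 0"
    using z(3) y by (auto simp: sum_power2_eq_zero_iff)
qed

text \<open>\<open>\<sigma>\<close> is a linear section of the projection to the variables that occur; it inserts zeros for the
  others. Composing with it turns the tensor of the group into one in these variables.\<close>

lemma riemannian_metric_section:
  fixes \<sigma> :: "'c::euclidean_space \<Rightarrow> scoord"
  assumes D: "open D" "\<And>u. u \<in> D \<Longrightarrow> \<sigma> u \<in> S_domain" and \<sigma>: "linear \<sigma>"
    and nonneg: "\<alpha> \<ge> 0" "\<beta> \<ge> 0" "\<gamma> \<ge> 0" "\<delta> \<ge> 0"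
    and pos: "\<And>u v. u \<in> D \<Longrightarrow> v \<noteq> 0 \<Longrightarrow> ds2 \<alpha> \<beta> \<gamma> \<delta> (\<sigma> u) (\<sigma> v) > 0"
  shows "riemannian_metric_on D (\<lambda>u v w. metric_tensor \<alpha> \<beta> \<gamma> \<delta> (\<sigma> u) (\<sigma> v) (\<sigma> w))"
  unfolding riemannian_metric_on_def
proof (intro conjI ballI allI impI)
  fix u v w assume u: "u \<in> D"
  note sum = metric_tensor_eq_sum[OF D(2)[OF u] nonneg]
  have lin: "linear (\<lambda>v. one_form \<alpha> \<beta> \<gamma> \<delta> i (\<sigma> u) (\<sigma> v))" if "i \<in> {1..6}" for i
    using linear_compose[OF \<sigma> linear_one_form[OF that]] by (simp add: o_def)
  show "bilinear (\<lambda>v w. metric_tensor \<alpha> \<beta> \<gamma> \<delta> (\<sigma> u) (\<sigma> v) (\<sigma> w))"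
    unfolding bilinear_def sum
    by (auto intro!: linearI simp: linear_add[OF lin] linear_scale[OF lin] sum.distrib sum_distrib_left algebra_simps)
  show "metric_tensor \<alpha> \<beta> \<gamma> \<delta> (\<sigma> u) (\<sigma> v) (\<sigma> w) = metric_tensor \<alpha> \<beta> \<gamma> \<delta> (\<sigma> u) (\<sigma> w) (\<sigma> v)"
    unfolding sum by (simp add: mult.commute)
  show "metric_tensor \<alpha> \<beta> \<gamma> \<delta> (\<sigma> u) (\<sigma> v) (\<sigma> v) > 0" if "v \<noteq> 0"
    unfolding metric_tensor_self[OF D(2)[OF u] nonneg] using pos u that .
next
  fix v w k
  have "Ck_on k D (\<lambda>u. metric_tensor \<alpha> \<beta> \<gamma> \<delta> (x_of (\<sigma> u), y_of (\<sigma> u), \<theta>_of (\<sigma> u), p_of (\<sigma> u), q_of (\<sigma> u), \<kappa>_of (\<sigma> u))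
      (\<sigma> v) (\<sigma> w))"
    using D(2) \<sigma>
    by (intro Ck_on_metric_tensor D(1) Ck_on_linear linearI)
       (auto simp: in_S_domain linear_add[OF \<sigma>] linear_scale[OF \<sigma>])
  then show "Ck_on k D (\<lambda>u. metric_tensor \<alpha> \<beta> \<gamma> \<delta> (\<sigma> u) (\<sigma> v) (\<sigma> w))"
    by simp
qed

section \<open>Left translations\<close>

lemma derivative_eq_on_open:
  assumes "open S" "u \<in> S" "\<And>z. z \<in> S \<Longrightarrow> F z = G z"
    and "(F has_derivative F') (at u)" "(G has_derivative G') (at u)"
  shows "F' = G'"
  using has_derivative_unique has_derivative_transform_within_open assms by metis

text \<open>The hypotheses are what the group law says about a translated point and a translated tangent vector,
  \<open>(n11, n12, n21, n22)\<close> and \<open>(l, m)\<close> being the components of the translating element. In the last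
  form the change of \<open>d\<kappa>\<close> cancels against the translation of \<open>(p, q)\<close>.\<close>
lemma one_form_left_invariant:
  fixes x y \<theta> x1 y1 \<theta>1 :: real
  assumes y: "y > 0" and y1: "y1 > 0" and det: "n11 * n22 - n12 * n21 = 1"
    and M: "entry_a x1 y1 \<theta>1 = n11 * entry_a x y \<theta> + n12 * entry_c x y \<theta>"
      "entry_b x1 y1 \<theta>1 = n11 * entry_b x y \<theta> + n12 * entry_d x y \<theta>"
      "entry_c x1 y1 \<theta>1 = n21 * entry_a x y \<theta> + n22 * entry_c x y \<theta>"
      "entry_d x1 y1 \<theta>1 = n21 * entry_b x y \<theta> + n22 * entry_d x y \<theta>"
    and dM: "d_entry_a x1 y1 \<theta>1 dx1 dy1 d\<theta>1 = n11 * d_entry_a x y \<theta> dx dy d\<theta> + n12 * d_entry_c x y \<theta> dy d\<theta>"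
      "d_entry_b x1 y1 \<theta>1 dx1 dy1 d\<theta>1 = n11 * d_entry_b x y \<theta> dx dy d\<theta> + n12 * d_entry_d x y \<theta> dy d\<theta>"
      "d_entry_c x1 y1 \<theta>1 dy1 d\<theta>1 = n21 * d_entry_a x y \<theta> dx dy d\<theta> + n22 * d_entry_c x y \<theta> dy d\<theta>"
      "d_entry_d x1 y1 \<theta>1 dy1 d\<theta>1 = n21 * d_entry_b x y \<theta> dx dy d\<theta> + n22 * d_entry_d x y \<theta> dy d\<theta>"
    and X: "p1 = n22 * (l + p) - n21 * (m + q)" "q1 = n11 * (m + q) - n12 * (l + p)"
      "dp1 = n22 * dp - n21 * dq" "dq1 = n11 * dq - n12 * dp"
    and K: "d\<kappa>1 = d\<kappa> + l * dq - m * dp"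
    and i: "i \<in> {1..6}"
  shows "one_form \<alpha> \<beta> \<gamma> \<delta> i (x1, y1, \<theta>1, p1, q1, \<kappa>1) (dx1, dy1, d\<theta>1, dp1, dq1, d\<kappa>1) =
         one_form \<alpha> \<beta> \<gamma> \<delta> i (x, y, \<theta>, p, q, \<kappa>) (dx, dy, d\<theta>, dp, dq, d\<kappa>)"
proof -
  \<comment> \<open>a row of \<open>M\<^sup>-\<^sup>1\<close> times a column of \<open>dM\<close>, before and after multiplication by \<open>N\<close>\<close>
  have 1: "d1 * e1 - b1 * f1 = d * e - b * f"
    if "d1 = n21 * b + n22 * d" "b1 = n11 * b + n12 * d" "e1 = n11 * e + n12 * f" "f1 = n21 * e + n22 * f"
    for b d b1 d1 e f e1 f1 :: real
    unfolding that using det by algebra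
  have E': "entry_a x1 y1 \<theta>1 * f1 - entry_c x1 y1 \<theta>1 * e1 = entry_a x y \<theta> * f - entry_c x y \<theta> * e"
    if "e1 = n11 * e + n12 * f" "f1 = n21 * e + n22 * f" for e f e1 f1
    using 1[OF M(3,1) that] by simp
  note E = 1[OF M(4,2) dM(2,4)] 1[OF M(4,2) dM(1,3)] E'[OF dM(1,3)] E'[OF dM(2,4)]
  have 45: "entry_a x1 y1 \<theta>1 * dp1 + entry_c x1 y1 \<theta>1 * dq1 = entry_a x y \<theta> * dp + entry_c x y \<theta> * dq"
    "entry_b x1 y1 \<theta>1 * dp1 + entry_d x1 y1 \<theta>1 * dq1 = entry_b x y \<theta> * dp + entry_d x y \<theta> * dq"
    unfolding M X using det by algebra+
  have 6: "d\<kappa>1 - p1 * dq1 + q1 * dp1 = d\<kappa> - p * dq + q * dp"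
    unfolding X K using det by algebra
  show ?thesis
    using i unfolding index_set_6
    by (elim insertE emptyE; hypsubst)
       (simp_all only: one_form_cartan[OF y] one_form_cartan[OF y1] E one_form_simps(4-6) 45 6)
qed

text \<open>Differentiating \<open>M(f u) = N M(u)\<close> gives the differentials of the matrix entries at \<open>f u\<close>, and
  the first three one-forms see the derivative of \<open>f\<close> through these alone; \<open>p\<close>, \<open>q\<close>, \<open>\<kappa>\<close>
  transform by affine maps. So the derivative of the angle component never has to be computed.\<close>

lemma left_translation_metric:
  assumes nonneg: "\<alpha> \<ge> 0" "\<beta> \<ge> 0" "\<gamma> \<ge> 0" "\<delta> \<ge> 0"
    and g: "g \<in> carrier jacobi" and f: "local_expression has_S_coords (jac_mult g) U f" and u: "u \<in> U"
  shows "metric_tensor \<alpha> \<beta> \<gamma> \<delta> (f u) (frechet_derivative f (at u) v) (frechet_derivative f (at u) w) =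
         metric_tensor \<alpha> \<beta> \<gamma> \<delta> u v w"
proof -
  obtain n11 n12 n21 n22 l m k
    where g_eq: "g = (mat2 n11 n12 n21 n22, vector [l, m], k)" and det: "n11 * n22 - n12 * n21 = 1"
    using g by (rule in_jacobiE)
  have U: "open U" "U \<subseteq> S_domain" and f_diff: "f differentiable_on U"
    and fU: "\<And>z. z \<in> U \<Longrightarrow> f z \<in> S_domain \<and> s_point (f z) = jac_mult g (s_point z)"
    using f by (auto simp: local_expression_def has_S_coords_iff coord_domain_def)
  let ?X = "\<lambda>z. x_of (f z)" and ?Y = "\<lambda>z. y_of (f z)" and ?T = "\<lambda>z. \<theta>_of (f z)"
  let ?P = "\<lambda>z. p_of (f z)" and ?Q = "\<lambda>z. q_of (f z)" and ?K = "\<lambda>z. \<kappa>_of (f z)"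
  have ypos: "?Y z > 0" "y_of z > 0" if "z \<in> U" for z
    using fU[OF that] U that by (auto simp: in_S_domain)
  have M: "entry_a (?X z) (?Y z) (?T z) = n11 * entry_a (x_of z) (y_of z) (\<theta>_of z) + n12 * entry_c (x_of z) (y_of z) (\<theta>_of z)"
    "entry_b (?X z) (?Y z) (?T z) = n11 * entry_b (x_of z) (y_of z) (\<theta>_of z) + n12 * entry_d (x_of z) (y_of z) (\<theta>_of z)"
    "entry_c (?X z) (?Y z) (?T z) = n21 * entry_a (x_of z) (y_of z) (\<theta>_of z) + n22 * entry_c (x_of z) (y_of z) (\<theta>_of z)"
    "entry_d (?X z) (?Y z) (?T z) = n21 * entry_b (x_of z) (y_of z) (\<theta>_of z) + n22 * entry_d (x_of z) (y_of z) (\<theta>_of z)"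
    and P: "?P z = n22 * (l + p_of z) - n21 * (m + q_of z)"
    and Q: "?Q z = n11 * (m + q_of z) - n12 * (l + p_of z)"
    and K: "?K z = k + \<kappa>_of z + l * q_of z - m * p_of z"
    if z: "z \<in> U" for z
  proof -
    obtain x y \<theta> p q \<kappa> where z_eq: "z = (x, y, \<theta>, p, q, \<kappa>)" by (metis prod_cases6)
    obtain x1 y1 \<theta>1 p1 q1 \<kappa>1 where fz: "f z = (x1, y1, \<theta>1, p1, q1, \<kappa>1)" by (metis prod_cases6)
    define a b c d where "a = entry_a x y \<theta>" and "b = entry_b x y \<theta>"
      and "c = entry_c x y \<theta>" and "d = entry_d x y \<theta>"
    have abcd: "a * d - b * c = 1"
      using entry_det[of y x \<theta>] ypos(2)[OF z] by (simp add: z_eq a_def b_def c_def d_def)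
    have "s_point (x1, y1, \<theta>1, p1, q1, \<kappa>1) = jac_mult g (s_point (x, y, \<theta>, p, q, \<kappa>))"
      using fU[OF z] unfolding fz unfolding z_eq by simp
    then have E: "entry_a x1 y1 \<theta>1 = n11 * a + n12 * c" "entry_b x1 y1 \<theta>1 = n11 * b + n12 * d"
        "entry_c x1 y1 \<theta>1 = n21 * a + n22 * c" "entry_d x1 y1 \<theta>1 = n21 * b + n22 * d"
      and F: "p1 * entry_a x1 y1 \<theta>1 + q1 * entry_c x1 y1 \<theta>1 = l * a + m * c + (p * a + q * c)"
        "p1 * entry_b x1 y1 \<theta>1 + q1 * entry_d x1 y1 \<theta>1 = l * b + m * d + (p * b + q * d)"
        "\<kappa>1 = k + \<kappa> + ((l * a + m * c) * (p * b + q * d) - (l * b + m * d) * (p * a + q * c))"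
      unfolding s_point_def g_eq prod.case jac_mult_entries mat2_mult prod.inject mat2_eq_iff vec2_eq_iff
        a_def b_def c_def d_def by blast+
    have pq: "p1 * n11 + q1 * n21 = l + p" "p1 * n12 + q1 * n22 = m + q"
      using F(1,2) abcd unfolding E by algebra+
    show "entry_a (?X z) (?Y z) (?T z) = n11 * entry_a (x_of z) (y_of z) (\<theta>_of z) + n12 * entry_c (x_of z) (y_of z) (\<theta>_of z)"
      "entry_b (?X z) (?Y z) (?T z) = n11 * entry_b (x_of z) (y_of z) (\<theta>_of z) + n12 * entry_d (x_of z) (y_of z) (\<theta>_of z)"
      "entry_c (?X z) (?Y z) (?T z) = n21 * entry_a (x_of z) (y_of z) (\<theta>_of z) + n22 * entry_c (x_of z) (y_of z) (\<theta>_of z)"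
      "entry_d (?X z) (?Y z) (?T z) = n21 * entry_b (x_of z) (y_of z) (\<theta>_of z) + n22 * entry_d (x_of z) (y_of z) (\<theta>_of z)"
      using E unfolding fz unfolding z_eq by (simp_all add: a_def b_def c_def d_def)
    show "?P z = n22 * (l + p_of z) - n21 * (m + q_of z)" "?Q z = n11 * (m + q_of z) - n12 * (l + p_of z)"
      unfolding fz unfolding z_eq fst_conv snd_conv using pq det by algebra+
    show "?K z = k + \<kappa>_of z + l * q_of z - m * p_of z"
      unfolding fz unfolding z_eq fst_conv snd_conv F(3) using abcd by algebra
  qed
  define f' where "f' = frechet_derivative f (at u)"
  have fd: "(f has_derivative f') (at u)"
    unfolding f'_def by (rule differentiable_at_open[OF U(1) f_diff u])
  note comp = fd[THEN has_derivative_fst]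
    fd[THEN has_derivative_snd, THEN has_derivative_fst]
    fd[THEN has_derivative_snd, THEN has_derivative_snd, THEN has_derivative_fst]
    fd[THEN has_derivative_snd, THEN has_derivative_snd, THEN has_derivative_snd, THEN has_derivative_fst]
    fd[THEN has_derivative_snd, THEN has_derivative_snd, THEN has_derivative_snd, THEN has_derivative_snd, THEN has_derivative_fst]
    fd[THEN has_derivative_snd, THEN has_derivative_snd, THEN has_derivative_snd, THEN has_derivative_snd, THEN has_derivative_snd]
  note idd = has_derivative_ident[of "at u :: scoord filter"]
  note base = idd[THEN has_derivative_fst]
    idd[THEN has_derivative_snd, THEN has_derivative_fst]
    idd[THEN has_derivative_snd, THEN has_derivative_snd, THEN has_derivative_fst]
  note dM1 = has_derivative_entry[OF comp(1-3) ypos(1)[OF u]]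
  note dM0 = has_derivative_entry[OF base ypos(2)[OF u]]
  note lin = has_derivative_add[OF has_derivative_mult_right has_derivative_mult_right]
  note on_U = derivative_eq_on_open[OF U(1) u, THEN fun_cong]
  have dM: "d_entry_a (?X u) (?Y u) (?T u) (x_of (f' v)) (y_of (f' v)) (\<theta>_of (f' v)) =
      n11 * d_entry_a (x_of u) (y_of u) (\<theta>_of u) (x_of v) (y_of v) (\<theta>_of v)
      + n12 * d_entry_c (x_of u) (y_of u) (\<theta>_of u) (y_of v) (\<theta>_of v)"
    "d_entry_b (?X u) (?Y u) (?T u) (x_of (f' v)) (y_of (f' v)) (\<theta>_of (f' v)) =
      n11 * d_entry_b (x_of u) (y_of u) (\<theta>_of u) (x_of v) (y_of v) (\<theta>_of v)
      + n12 * d_entry_d (x_of u) (y_of u) (\<theta>_of u) (y_of v) (\<theta>_of v)"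
    "d_entry_c (?X u) (?Y u) (?T u) (y_of (f' v)) (\<theta>_of (f' v)) =
      n21 * d_entry_a (x_of u) (y_of u) (\<theta>_of u) (x_of v) (y_of v) (\<theta>_of v)
      + n22 * d_entry_c (x_of u) (y_of u) (\<theta>_of u) (y_of v) (\<theta>_of v)"
    "d_entry_d (?X u) (?Y u) (?T u) (y_of (f' v)) (\<theta>_of (f' v)) =
      n21 * d_entry_b (x_of u) (y_of u) (\<theta>_of u) (x_of v) (y_of v) (\<theta>_of v)
      + n22 * d_entry_d (x_of u) (y_of u) (\<theta>_of u) (y_of v) (\<theta>_of v)" for v
    using on_U[OF M(1) dM1(1) lin[OF dM0(1,3)]] on_U[OF M(2) dM1(2) lin[OF dM0(2,4)]]
      on_U[OF M(3) dM1(3) lin[OF dM0(1,3)]] on_U[OF M(4) dM1(4) lin[OF dM0(2,4)]] by auto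
  have dP: "p_of (f' v) = n22 * p_of v - n21 * q_of v" for v
    by (rule on_U[OF P comp(4)]) (auto intro!: derivative_eq_intros)
  have dQ: "q_of (f' v) = n11 * q_of v - n12 * p_of v" for v
    by (rule on_U[OF Q comp(5)]) (auto intro!: derivative_eq_intros)
  have dK: "\<kappa>_of (f' v) = \<kappa>_of v + l * q_of v - m * p_of v" for v
    by (rule on_U[OF K comp(6)]) (auto intro!: derivative_eq_intros)
  have inv: "one_form \<alpha> \<beta> \<gamma> \<delta> i (f u) (f' v) = one_form \<alpha> \<beta> \<gamma> \<delta> i u v" if "i \<in> {1..6}" for i v
    using one_form_left_invariant[OF ypos(2,1)[OF u] det M[OF u] dM[of v] P[OF u] Q[OF u] dP[of v] dQ[of v] dK[of v] that,
        of \<alpha> \<beta> \<gamma> \<delta> "\<kappa>_of (f u)" "\<kappa>_of u"]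
    by simp
  show ?thesis
    using fU[OF u] U(2) u inv
    by (auto simp: metric_tensor_eq_sum[OF _ nonneg] f'_def[symmetric] intro!: sum.cong)
qed

text \<open>The angle changes by minus an argument of \<open>c \<tau> + d\<close>, which has a smooth branch on the whole
  upper half-plane, since \<open>c \<tau> + d\<close> stays in an open half-plane or is constant.\<close>

lemma angle_shift:
  fixes c d :: real
  assumes "c \<noteq> 0 \<or> d \<noteq> 0"
  obtains \<psi> where
    "\<And>x y. y > 0 \<Longrightarrow> cos (\<psi> x y) = (c * x + d) / sqrt ((c * x + d)\<^sup>2 + (c * y)\<^sup>2)"
    "\<And>x y. y > 0 \<Longrightarrow> sin (\<psi> x y) = - (c * y) / sqrt ((c * x + d)\<^sup>2 + (c * y)\<^sup>2)"
    "(\<lambda>u. \<psi> (x_of u) (y_of u)) differentiable_on S_domain"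
proof (cases "c = 0")
  case True
  then have d: "d \<noteq> 0" using assms by simp
  show ?thesis
    by (rule that[of "\<lambda>x y. if d > 0 then 0 else pi"]) (use d True in auto)
next
  case False
  define s where "s = sgn c"
  have s: "s = 1 \<or> s = - 1" "s * \<bar>c\<bar> = c" "\<bar>c\<bar> = s * c" using False by (auto simp: s_def sgn_if)
  \<comment> \<open>For \<open>c > 0\<close> the argument of \<open>c \<tau> + d\<close> is \<open>\<pi> / 2 - arctan ((c x + d) / (c y))\<close>; for \<open>c < 0\<close> the
    lower half-plane changes the sign of the constant.\<close>
  define \<psi> where "\<psi> = (\<lambda>x y. arctan ((c * x + d) / (c * y)) - s * (pi / 2))"
  have trig: "cos (t - s * (pi / 2)) = s * sin t" "sin (t - s * (pi / 2)) = - s * cos t" for t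
    using s(1) by (auto simp: cos_diff sin_diff cos_add sin_add)
  have sum_sq: "1 + (t / r)\<^sup>2 = (t\<^sup>2 + r\<^sup>2) / r\<^sup>2" if "r \<noteq> 0" for t r :: real
    using that by (simp add: power2_eq_square field_simps)
  have root: "sqrt (1 + ((c * x + d) / (c * y))\<^sup>2) = sqrt ((c * x + d)\<^sup>2 + (c * y)\<^sup>2) / (s * c * y)"
    if "y > 0" for x y
  proof -
    have "1 + ((c * x + d) / (c * y))\<^sup>2 = ((c * x + d)\<^sup>2 + (c * y)\<^sup>2) / (c * y)\<^sup>2"
      using sum_sq[of "c * y" "c * x + d"] that False by simp
    then show ?thesis
      using that by (simp add: real_sqrt_divide abs_mult s(3))
  qed
  show ?thesis
  proof (rule that[of \<psi>])
    fix x y :: real assume y: "y > 0"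
    have L: "sqrt ((c * x + d)\<^sup>2 + (c * y)\<^sup>2) > 0"
      using y False by (simp add: add_nonneg_pos)
    show "cos (\<psi> x y) = (c * x + d) / sqrt ((c * x + d)\<^sup>2 + (c * y)\<^sup>2)"
      unfolding \<psi>_def trig sin_arctan root[OF y] using s(1) y False L by auto
    show "sin (\<psi> x y) = - (c * y) / sqrt ((c * x + d)\<^sup>2 + (c * y)\<^sup>2)"
      unfolding \<psi>_def trig cos_arctan root[OF y] using s(1) y False L by auto
  next
    have "(\<lambda>u. \<psi> (x_of u) (y_of u)) differentiable (at u within S_domain)" if "u \<in> S_domain" for u
      unfolding \<psi>_def differentiable_def using that False
      by (intro exI) (auto intro!: derivative_eq_intros simp: in_S_domain)
    then show "(\<lambda>u. \<psi> (x_of u) (y_of u)) differentiable_on S_domain"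
      by (simp add: differentiable_on_def)
  qed
qed

lemma open_S_domain: "open S_domain"
proof -
  have "S_domain = {u. 0 < y_of u}" by (auto simp: in_S_domain)
  also have "open \<dots>" by (intro open_Collect_less continuous_intros)
  finally show ?thesis .
qed

text \<open>The composition law gives every component except the angle by a formula; adding \<open>angle_shift\<close> to
  the angle gives an expression on the whole coordinate domain. It can be made to hit the prescribed
  value \<open>w\<close> by a multiple of \<open>2 \<pi>\<close>.\<close>
lemma left_translation_lift:
  assumes g: "g \<in> carrier jacobi" and h: "has_S_coords h u" and gh: "has_S_coords (jac_mult g h) w"
  obtains F where "local_expression has_S_coords (jac_mult g) S_domain F" "F u = w"
proof -
  obtain u0 where u0: "u0 \<in> S_domain" "g = s_point u0" using g by (rule s_point_surj)
  obtain x0 y0 \<theta>0 p0 q0 \<kappa>0 where u0_eq: "u0 = (x0, y0, \<theta>0, p0, q0, \<kappa>0)" by (metis prod_cases6)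
  have y0: "y0 > 0" using u0 by (simp add: u0_eq)
  define a b c d where "a = entry_a x0 y0 \<theta>0" and "b = entry_b x0 y0 \<theta>0"
    and "c = entry_c x0 y0 \<theta>0" and "d = entry_d x0 y0 \<theta>0"
  have det: "a * d - b * c = 1"
    using entry_det[OF y0] by (simp add: a_def b_def c_def d_def)
  then have cd: "c \<noteq> 0 \<or> d \<noteq> 0" by auto
  obtain \<psi> where \<psi>: "\<And>x y. y > 0 \<Longrightarrow> cos (\<psi> x y) = (c * x + d) / sqrt ((c * x + d)\<^sup>2 + (c * y)\<^sup>2)"
    "\<And>x y. y > 0 \<Longrightarrow> sin (\<psi> x y) = - (c * y) / sqrt ((c * x + d)\<^sup>2 + (c * y)\<^sup>2)"
    "(\<lambda>u. \<psi> (x_of u) (y_of u)) differentiable_on S_domain"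
    using angle_shift[OF cd] by blast
  define \<Lambda> where "\<Lambda> = (\<lambda>u. (c * x_of u + d)\<^sup>2 + (c * y_of u)\<^sup>2)"
  define F where "F = (\<lambda>n u. (((a * x_of u + b) * (c * x_of u + d) + a * c * (y_of u)\<^sup>2) / \<Lambda> u, y_of u / \<Lambda> u,
      \<theta>_of u + \<psi> (x_of u) (y_of u) + 2 * pi * of_int n,
      p0 + d * p_of u - c * q_of u, q0 - b * p_of u + a * q_of u,
      \<kappa>0 + \<kappa>_of u + (p0 * a + q0 * c) * q_of u - (p0 * b + q0 * d) * p_of u))"
  have coords: "has_S_coords (jac_mult g (s_point z)) w' \<longleftrightarrow>
      x_of w' = x_of (F n z) \<and> y_of w' = y_of (F n z) \<and> sin (\<theta>_of w') = sin (\<theta>_of (F n z))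
      \<and> cos (\<theta>_of w') = cos (\<theta>_of (F n z)) \<and> p_of w' = p_of (F n z) \<and> q_of w' = q_of (F n z)
      \<and> \<kappa>_of w' = \<kappa>_of (F n z)" if z: "z \<in> S_domain" for z w' and n :: int
  proof -
    obtain x y \<theta> p q \<kappa> where z_eq: "z = (x, y, \<theta>, p, q, \<kappa>)" by (metis prod_cases6)
    obtain x1 y1 \<theta>1 p1 q1 \<kappa>1 where w_eq: "w' = (x1, y1, \<theta>1, p1, q1, \<kappa>1)" by (metis prod_cases6)
    have y: "y > 0" using z by (simp add: z_eq)
    have per: "sin (t + 2 * pi * of_int n) = sin t" "cos (t + 2 * pi * of_int n) = cos t" for t
      using sin_cos_eq_iff[of "t + 2 * pi * of_int n" t] by auto
    have sc: "sin (\<theta>_of (F n z)) = ((c * x + d) * sin \<theta> - c * y * cos \<theta>) / sqrt (\<Lambda> z)"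
      "cos (\<theta>_of (F n z)) = (c * y * sin \<theta> + (c * x + d) * cos \<theta>) / sqrt (\<Lambda> z)"
      by (simp_all add: F_def per z_eq sin_add cos_add \<psi>(1,2)[OF y] \<Lambda>_def)
         (simp_all add: add_divide_distrib diff_divide_distrib algebra_simps)
    show ?thesis
      unfolding sc unfolding u0(2) u0_eq z_eq w_eq
      unfolding composition_law[OF y0 y, unfolded jacobi_simps]
      by (simp add: F_def \<Lambda>_def a_def b_def c_def d_def)
  qed
  have \<Lambda>: "\<Lambda> z > 0" if "z \<in> S_domain" for z
  proof -
    have "y_of z > 0" using that by (simp add: in_S_domain)
    then show ?thesis
      using cd by (cases "c = 0") (auto simp: \<Lambda>_def add_nonneg_pos)
  qed
  have local: "local_expression has_S_coords (jac_mult g) S_domain (F n)" for n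
    unfolding local_expression_def
  proof (intro conjI ballI allI impI)
    show "open S_domain" by (rule open_S_domain)
    show "S_domain \<subseteq> coord_domain has_S_coords"
      by (auto simp: coord_domain_def has_S_coords_iff)
    have "F n differentiable (at z within S_domain)" if z: "z \<in> S_domain" for z
    proof -
      obtain \<psi>' where [derivative_intros]:
        "((\<lambda>u. \<psi> (x_of u) (y_of u)) has_derivative \<psi>') (at z within S_domain)"
        using \<psi>(3) z by (auto simp: differentiable_on_def differentiable_def)
      show ?thesis
        unfolding F_def differentiable_def
        using \<Lambda>[OF z] unfolding \<Lambda>_def
        by (intro exI) (auto intro!: derivative_eq_intros)
    qed
    then show "F n differentiable_on S_domain"
      by (simp add: differentiable_on_def)
  next
    fix z m assume "z \<in> S_domain" "has_S_coords m z"
    then show "has_S_coords (jac_mult g m) (F n z)"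
      by (simp add: has_S_coords_iff[of m] coords[of z _ n])
  qed
  have u: "u \<in> S_domain" "h = s_point u" using h by (simp_all add: has_S_coords_iff)
  note eqs = coords[OF u(1), of w 0, folded u(2), THEN iffD1, OF gh]
  obtain n :: int where "\<theta>_of w = \<theta>_of (F 0 u) + 2 * pi * n"
    using eqs sin_cos_eq_iff by blast
  then have "F n u = w"
    using eqs by (intro prod_eqI) (simp_all add: F_def)
  then show ?thesis
    using that local by blast
qed

section \<open>Invariant metrics on homogeneous spaces\<close>

(* From here on the carrier and the product of the group stay folded, as the group axioms expect. *)
declare jacobi_simps [simp del]

lemma s_coords_unique:
  assumes "has_S_coords g u" "has_S_coords g u'"
  shows "x_of u = x_of u'" "y_of u = y_of u'" "p_of u = p_of u'" "q_of u = q_of u'" "\<kappa>_of u = \<kappa>_of u'"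
    and "\<exists>n::int. \<theta>_of u = \<theta>_of u' + 2 * pi * n"
proof -
  obtain x y \<theta> p q \<kappa> where u: "u = (x, y, \<theta>, p, q, \<kappa>)" by (metis prod_cases6)
  obtain x' y' \<theta>' p' q' \<kappa>' where u': "u' = (x', y', \<theta>', p', q', \<kappa>')" by (metis prod_cases6)
  have "y > 0" "y' > 0" "s_point (x, y, \<theta>, p, q, \<kappa>) = s_point (x', y', \<theta>', p', q', \<kappa>')"
    using assms by (simp_all add: has_S_coords_iff u u')
  note eq = s_point_eq_iff[OF this(1,2), THEN iffD1, OF this(3)]
  show "x_of u = x_of u'" "y_of u = y_of u'" "p_of u = p_of u'" "q_of u = q_of u'" "\<kappa>_of u = \<kappa>_of u'"
    using eq by (simp_all add: u u')
  show "\<exists>n::int. \<theta>_of u = \<theta>_of u' + 2 * pi * n"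
    using eq sin_cos_eq_iff[of \<theta> \<theta>'] unfolding u u' fst_conv snd_conv by blast
qed

lemma local_expressionD: "local_expression R T U f \<Longrightarrow> u \<in> U \<Longrightarrow> R m u \<Longrightarrow> R (T m) (f u)"
  unfolding local_expression_def by blast

lemma tensor_in_variablesD:
  "tensor_in_variables \<pi> G h \<Longrightarrow> u \<in> S_domain \<Longrightarrow> G u v w = h (\<pi> u) (\<pi> v) (\<pi> w)"
  unfolding tensor_in_variables_def by blast

lemma riemannian_metric_on_cong:
  assumes D: "open D" and h: "riemannian_metric_on D h" and eq: "\<And>u. u \<in> D \<Longrightarrow> h u = h' u"
  shows "riemannian_metric_on D h'"
  unfolding riemannian_metric_on_def
proof (intro conjI allI)
  show "\<forall>u\<in>D. bilinear (h' u) \<and> (\<forall>v w. h' u v w = h' u w v) \<and> (\<forall>v. v \<noteq> 0 \<longrightarrow> 0 < h' u v v)"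
    using h eq unfolding riemannian_metric_on_def by simp
  show "Ck_on k D (\<lambda>u. h' u v w)" for v w k
  proof (rule Ck_on_cong[OF D])
    show "Ck_on k D (\<lambda>u. h u v w)" using h unfolding riemannian_metric_on_def by blast
  qed (simp add: eq)
qed

text \<open>A space \<open>M\<close> with an action of the Jacobi group whose points are the images of group elements under
  an equivariant map \<open>point\<close>, coordinatized by dropping S-coordinates: \<open>\<pi>\<close> is the projection, \<open>\<sigma>\<close>
  is a linear section of it. The group itself is the case where nothing is dropped. The
  assumption \<open>locally_unique\<close> is stated for coordinates upstairs; it has content only if the angle
  is retained.\<close>
locale homogeneous_space =
  fixes M :: "'m set" and R :: "'m \<Rightarrow> 'c::euclidean_space \<Rightarrow> bool"
    and act :: "jac \<Rightarrow> 'm \<Rightarrow> 'm" and point :: "jac \<Rightarrow> 'm"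
    and \<pi> :: "scoord \<Rightarrow> 'c" and \<sigma> :: "'c \<Rightarrow> scoord"
  assumes linear_\<pi>: "linear \<pi>" and linear_\<sigma>: "linear \<sigma>" and \<pi>_\<sigma>: "\<pi> (\<sigma> w) = w"
    and y_\<sigma>_\<pi>: "y_of (\<sigma> (\<pi> u)) = y_of u"
    and point_image: "point ` carrier jacobi = M"
    and R_in_M: "R m w \<Longrightarrow> m \<in> M"
    and R_point: "g \<in> carrier jacobi \<Longrightarrow> R (point g) w \<longleftrightarrow> (\<exists>u. has_S_coords g u \<and> \<pi> u = w)"
    and point_eq: "has_S_coords g u \<Longrightarrow> has_S_coords h u' \<Longrightarrow> \<pi> u = \<pi> u' \<Longrightarrow> point g = point h"
    and locally_unique: "\<exists>W. open W \<and> w \<in> W \<and>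
      (\<forall>g u u'. has_S_coords g u \<longrightarrow> has_S_coords g u' \<longrightarrow> \<pi> u \<in> W \<longrightarrow> \<pi> u' \<in> W \<longrightarrow> \<pi> u = \<pi> u')"
    and act_point: "g \<in> carrier jacobi \<Longrightarrow> h \<in> carrier jacobi \<Longrightarrow> act g (point h) = point (g \<otimes>\<^bsub>jacobi\<^esub> h)"
begin

lemma R_elim:
  assumes "R m w"
  obtains g u where "g \<in> carrier jacobi" "has_S_coords g u" "m = point g" "w = \<pi> u"
proof -
  have "m \<in> point ` carrier jacobi" using R_in_M[OF assms] point_image by simp
  then obtain g where g: "g \<in> carrier jacobi" "m = point g" by blast
  have "R (point g) w" using assms g(2) by simp
  then obtain u where "has_S_coords g u" "\<pi> u = w"
    unfolding R_point[OF g(1)] by (elim exE conjE)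
  then show ?thesis using that[OF g(1)] g(2) by blast
qed

lemma R_intro:
  assumes "has_S_coords g u" shows "R (point g) (\<pi> u)"
proof -
  have g: "g \<in> carrier jacobi"
    using assms s_point_in_carrier unfolding has_S_coords_iff by simp
  show ?thesis
    unfolding R_point[OF g] using assms by (intro exI[of _ u] conjI refl)
qed

lemma coord_domain_R: "coord_domain R = {w. \<sigma> w \<in> S_domain}"
proof (intro Set.set_eqI iffI)
  fix w assume "w \<in> coord_domain R"
  then obtain m where "R m w" by (auto simp: coord_domain_def)
  then obtain g u where "has_S_coords g u" "w = \<pi> u" by (rule R_elim)
  then show "w \<in> {w. \<sigma> w \<in> S_domain}"
    by (simp add: in_S_domain y_\<sigma>_\<pi> has_S_coords_iff)
next
  fix w assume "w \<in> {w. \<sigma> w \<in> S_domain}"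
  then have "R (point (s_point (\<sigma> w))) (\<pi> (\<sigma> w))"
    by (intro R_intro) (simp add: has_S_coords_iff)
  then show "w \<in> coord_domain R"
    by (auto simp: coord_domain_def \<pi>_\<sigma>)
qed

lemma open_coord_domain: "open (coord_domain R)"
proof -
  have "coord_domain R = \<sigma> -` S_domain" by (auto simp: coord_domain_R)
  then show ?thesis
    using open_S_domain linear_\<sigma> by (simp add: continuous_open_vimage linear_continuous_at linear_linear)
qed

lemma R_functional:
  assumes "R m w" "R m' w"
  shows "m = m'"
proof -
  obtain g u where "has_S_coords g u" "m = point g" "w = \<pi> u"
    using assms(1) by (rule R_elim)
  moreover obtain h u' where "has_S_coords h u'" "m' = point h" "w = \<pi> u'"
    using assms(2) by (rule R_elim)
  ultimately show ?thesis using point_eq[of g u h u'] by simp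
qed

lemma R_locally_injective:
  "\<exists>W. open W \<and> w \<in> W \<and> (\<forall>m. \<forall>v\<in>W. \<forall>v'\<in>W. R m v \<longrightarrow> R m v' \<longrightarrow> v = v')"
proof -
  obtain W where W: "open W" "w \<in> W"
      "\<forall>g u u'. has_S_coords g u \<longrightarrow> has_S_coords g u' \<longrightarrow> \<pi> u \<in> W \<longrightarrow> \<pi> u' \<in> W \<longrightarrow> \<pi> u = \<pi> u'"
    using locally_unique[of w] by (elim exE conjE)
  have "\<forall>m. \<forall>v\<in>W. \<forall>v'\<in>W. R m v \<longrightarrow> R m v' \<longrightarrow> v = v'"
  proof (intro allI ballI impI)
    fix m v v' assume vW: "v \<in> W" "v' \<in> W" and R: "R m v" "R m v'"
    obtain g u where g: "g \<in> carrier jacobi" "has_S_coords g u" "m = point g" "v = \<pi> u"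
      using R(1) by (rule R_elim)
    have "R (point g) v'" using R(2) g(3) by simp
    then obtain u' where "has_S_coords g u'" "\<pi> u' = v'"
      unfolding R_point[OF g(1)] by (elim exE conjE)
    with W(3)[rule_format, of g u u'] vW g(2,4) show "v = v'" by simp
  qed
  then show ?thesis using W(1,2) by (intro exI[of _ W] conjI)
qed

lemma coordinates: "coordinates_on M R"
  unfolding coordinates_on_def
proof (intro conjI allI impI ballI)
  show "{m. \<exists>u. R m u} = M"
  proof (intro Set.set_eqI iffI)
    fix m assume "m \<in> M"
    then obtain g where "g \<in> carrier jacobi" "m = point g" using point_image by blast
    moreover then obtain u where "has_S_coords g u"
      using s_point_surj has_S_coords_iff by metis
    ultimately show "m \<in> {m. \<exists>u. R m u}" using R_intro by blast
  qed (use R_in_M in blast)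
  show "open (coord_domain R)" by (rule open_coord_domain)
  show "m = m'" if "R m u" "R m' u" for m m' u using R_functional that .
  show "\<exists>U. open U \<and> u \<in> U \<and> (\<forall>m. \<forall>v\<in>U. \<forall>w\<in>U. R m v \<longrightarrow> R m w \<longrightarrow> v = w)" for u
    by (rule R_locally_injective)
qed

lemma act_bij:
  assumes g: "g \<in> carrier jacobi" shows "bij_betw (act g) M M"
proof -
  interpret group jacobi by (rule group_jacobi)
  have closed: "act g ` M \<subseteq> M" if "g \<in> carrier jacobi" for g
  proof
    fix m assume "m \<in> act g ` M"
    then obtain h where h: "h \<in> carrier jacobi" "m = act g (point h)"
      unfolding point_image[symmetric] by (elim imageE) simp
    have "m = point (g \<otimes>\<^bsub>jacobi\<^esub> h)" unfolding h(2) by (rule act_point[OF that h(1)])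
    then show "m \<in> M"
      unfolding point_image[symmetric] using m_closed[OF that h(1)] by (rule image_eqI)
  qed
  note g' = inv_closed[OF g]
  have inverse: "act (m_inv jacobi g) (act g m) = m \<and> act g (act (m_inv jacobi g) m) = m" if "m \<in> M" for m
  proof -
    obtain h where h: "h \<in> carrier jacobi" "m = point h"
      using \<open>m \<in> M\<close> unfolding point_image[symmetric] by (elim imageE)
    have "m_inv jacobi g \<otimes>\<^bsub>jacobi\<^esub> (g \<otimes>\<^bsub>jacobi\<^esub> h) = h"
      unfolding m_assoc[OF g' g h(1), symmetric] l_inv[OF g] by (rule l_one[OF h(1)])
    moreover have "g \<otimes>\<^bsub>jacobi\<^esub> (m_inv jacobi g \<otimes>\<^bsub>jacobi\<^esub> h) = h"
      unfolding m_assoc[OF g g' h(1), symmetric] r_inv[OF g] by (rule l_one[OF h(1)])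
    ultimately show ?thesis
      unfolding h(2) act_point[OF g h(1)] act_point[OF g' h(1)]
        act_point[OF g' m_closed[OF g h(1)]] act_point[OF g m_closed[OF g' h(1)]] by simp
  qed
  show ?thesis
  proof (rule bij_betw_byWitness)
    show "\<forall>m\<in>M. act (m_inv jacobi g) (act g m) = m" "\<forall>m\<in>M. act g (act (m_inv jacobi g) m) = m"
      using inverse by blast+
  qed (rule closed[OF g], rule closed[OF g'])
qed

lemma lift:
  assumes g: "g \<in> carrier jacobi" and h: "h \<in> carrier jacobi" and u: "has_S_coords h u" and w: "R (act g (point h)) w"
  obtains F where "local_expression has_S_coords (jac_mult g) S_domain F" "\<pi> (F u) = w"
proof -
  note mult = jacobi_simps(2)
  interpret group jacobi by (rule group_jacobi)
  have "R (point (g \<otimes>\<^bsub>jacobi\<^esub> h)) w" using w act_point[OF g h] by metis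
  then obtain w' where "has_S_coords (g \<otimes>\<^bsub>jacobi\<^esub> h) w'" "\<pi> w' = w"
    using R_point[OF m_closed[OF g h]] by blast
  then show ?thesis
    using left_translation_lift[OF g u, of w'] that unfolding mult by metis
qed

text \<open>A coordinate expression downstairs is obtained by going up along a section of \<open>\<pi>\<close> through a chosen
  lift \<open>u0\<close>, translating there, and projecting.\<close>
lemma act_local_expression:
  assumes g: "g \<in> carrier jacobi" and m: "R m u" and w: "R (act g m) w"
  shows "\<exists>U f. local_expression R (act g) U f \<and> u \<in> U \<and> f u = w"
proof -
  obtain h u0 where h: "h \<in> carrier jacobi" "has_S_coords h u0" "m = point h" "u = \<pi> u0"
    using m by (rule R_elim)
  obtain F where F: "local_expression has_S_coords (jac_mult g) S_domain F" "\<pi> (F u0) = w"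
    using lift[OF g h(1,2)] w h(3) by blast
  \<comment> \<open>a section of \<open>\<pi>\<close> through \<open>u0\<close>\<close>
  define s where "s = (\<lambda>v. \<sigma> v + (u0 - \<sigma> (\<pi> u0)))"
  have \<pi>s: "\<pi> (s v) = v" for v
    using linear_\<pi> by (simp add: s_def linear_add linear_diff \<pi>_\<sigma>)
  have su: "s u = u0" by (simp add: s_def h(4))
  have s_dom: "s v \<in> S_domain \<longleftrightarrow> v \<in> coord_domain R" for v
  proof -
    have "y_of (s v) = y_of (\<sigma> v)" by (simp add: s_def y_\<sigma>_\<pi>)
    then show ?thesis by (simp add: coord_domain_R in_S_domain)
  qed
  have s_diff: "s differentiable at v" for v
    unfolding s_def using linear_\<sigma>
    by (intro differentiable_add differentiable_const linear_imp_differentiable)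
  have \<pi>_diff: "\<pi> differentiable at v" for v
    using linear_\<pi> by (rule linear_imp_differentiable)
  have F_diff: "F differentiable at v" if "v \<in> S_domain" for v
    using F(1) that open_S_domain differentiable_on_eq_differentiable_at
    by (auto simp: local_expression_def)
  have "local_expression R (act g) (coord_domain R) (\<lambda>v. \<pi> (F (s v)))"
    unfolding local_expression_def
  proof (intro conjI ballI allI impI open_coord_domain order_refl)
    have "(\<pi> \<circ> (F \<circ> s)) differentiable at v" if "v \<in> coord_domain R" for v
      using that by (intro differentiable_chain_at s_diff F_diff \<pi>_diff) (simp_all add: s_dom)
    then show "(\<lambda>v. \<pi> (F (s v))) differentiable_on coord_domain R"
      by (simp add: differentiable_on_def differentiable_at_withinI o_def)
  next
    fix v m assume v: "v \<in> coord_domain R" and m: "R m v"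
    have sv: "s v \<in> S_domain" using v s_dom by simp
    then have c: "has_S_coords (s_point (s v)) (s v)" by (simp add: has_S_coords_iff)
    have "has_S_coords (jac_mult g (s_point (s v))) (F (s v))"
      using F(1) sv c by (rule local_expressionD)
    then have "R (point (jac_mult g (s_point (s v)))) (\<pi> (F (s v)))"
      by (rule R_intro)
    then have "R (act g (point (s_point (s v)))) (\<pi> (F (s v)))"
      using act_point[OF g s_point_in_carrier[OF sv]] by (simp add: jacobi_simps(2))
    moreover have "m = point (s_point (s v))"
      using R_functional[OF m] R_intro[OF c] \<pi>s by simp
    ultimately show "R (act g m) (\<pi> (F (s v)))" by simp
  qed
  moreover have "u \<in> coord_domain R" using m by (auto simp: coord_domain_def)
  ultimately show ?thesis using F(2) su by metis
qed

text \<open>Near a lift \<open>u0\<close> of \<open>u\<close>, the given expression \<open>f\<close> is covered by an expression \<open>F\<close> upstairs: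
  \<open>f (\<pi> z)\<close> and \<open>\<pi> (F z)\<close> are coordinates of the same point and agree at \<open>u0\<close>, so they agree
  near \<open>u0\<close> by continuity and local uniqueness of coordinates. Differentiating and using the isometry
  upstairs gives the claim.\<close>
lemma act_preserves_metric:
  assumes nonneg: "\<alpha> \<ge> 0" "\<beta> \<ge> 0" "\<gamma> \<ge> 0" "\<delta> \<ge> 0"
    and h: "tensor_in_variables \<pi> (metric_tensor \<alpha> \<beta> \<gamma> \<delta>) h"
    and g: "g \<in> carrier jacobi" and f: "local_expression R (act g) U f" and u: "u \<in> U"
  shows "h (f u) (frechet_derivative f (at u) v) (frechet_derivative f (at u) w) = h u v w"
proof -
  have U: "open U" "U \<subseteq> coord_domain R" "f differentiable_on U"
    using f unfolding local_expression_def by blast+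
  note fR = local_expressionD[OF f]
  define u0 where "u0 = \<sigma> u"
  have u0: "u0 \<in> S_domain" "\<pi> u0 = u"
    using u U(2) by (auto simp: u0_def coord_domain_R \<pi>_\<sigma>)
  have c: "has_S_coords (s_point z) z" if "z \<in> S_domain" for z
    using that by (simp add: has_S_coords_iff)
  have Rc: "R (act g (point (s_point z))) (f (\<pi> z))" if "z \<in> S_domain" "\<pi> z \<in> U" for z
    using fR[OF that(2)] R_intro[OF c[OF that(1)]] .
  obtain F where F: "local_expression has_S_coords (jac_mult g) S_domain F" "\<pi> (F u0) = f u"
    using lift[OF g s_point_in_carrier[OF u0(1)] c[OF u0(1)] Rc[OF u0(1)]] u0(2) u by auto
  have F_diff: "F differentiable_on S_domain"
    using F(1) unfolding local_expression_def by blast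
  have FR: "has_S_coords (jac_mult g (s_point z)) (F z)" if "z \<in> S_domain" for z
    using F(1) that c[OF that] by (rule local_expressionD)
  have RF: "R (act g (point (s_point z))) (\<pi> (F z))" if "z \<in> S_domain" for z
    using R_intro[OF FR[OF that]] act_point[OF g s_point_in_carrier[OF that]] by (simp add: jacobi_simps(2))
  obtain W where W: "open W" "f u \<in> W" "\<forall>m. \<forall>v\<in>W. \<forall>v'\<in>W. R m v \<longrightarrow> R m v' \<longrightarrow> v = v'"
    using R_locally_injective[of "f u"] by (elim exE conjE)
  define f' where "f' = frechet_derivative f (at u)"
  define F' where "F' = frechet_derivative F (at u0)"
  have fd: "(f has_derivative f') (at (\<pi> u0))"
    unfolding f'_def u0(2) by (rule differentiable_at_open[OF U(1,3) u])
  have Fd: "(F has_derivative F') (at u0)"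
    unfolding F'_def by (rule differentiable_at_open[OF open_S_domain F_diff u0(1)])
  have \<pi>d: "(\<pi> has_derivative \<pi>) (at z)" for z
    using linear_\<pi> by (simp add: bounded_linear_imp_has_derivative linear_linear)
  have d1: "((\<lambda>z. f (\<pi> z)) has_derivative (\<lambda>v. f' (\<pi> v))) (at u0)"
    using diff_chain_at[OF \<pi>d fd] by (simp add: o_def)
  have d2: "((\<lambda>z. \<pi> (F z)) has_derivative (\<lambda>v. \<pi> (F' v))) (at u0)"
    using diff_chain_at[OF Fd \<pi>d] by (simp add: o_def)
  have near: "\<forall>\<^sub>F z in nhds u0. k z \<in> V" if "(k has_derivative k') (at u0)" "open V" "k u0 \<in> V"
    for k :: "scoord \<Rightarrow> 'c" and k' V
    using has_derivative_continuous[OF that(1)] that(2,3)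
    unfolding isCont_def tendsto_at_iff_tendsto_nhds by (rule topological_tendstoD)
  have "\<forall>\<^sub>F z in nhds u0. z \<in> S_domain"
    using open_S_domain u0(1) by (rule eventually_nhds_in_open)
  moreover have "\<forall>\<^sub>F z in nhds u0. \<pi> z \<in> U"
    using near[OF \<pi>d U(1)] u u0(2) by simp
  moreover have "\<forall>\<^sub>F z in nhds u0. f (\<pi> z) \<in> W"
    using near[OF d1 W(1)] W(2) u0(2) by simp
  moreover have "\<forall>\<^sub>F z in nhds u0. \<pi> (F z) \<in> W"
    using near[OF d2 W(1)] W(2) F(2) by simp
  ultimately have "\<forall>\<^sub>F z in nhds u0. f (\<pi> z) = \<pi> (F z)"
    by eventually_elim (use W(3) Rc RF in blast)
  then obtain S where "open S" "u0 \<in> S" "\<forall>z\<in>S. f (\<pi> z) = \<pi> (F z)"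
    unfolding eventually_nhds by blast
  then have "(\<lambda>v. f' (\<pi> v)) = (\<lambda>v. \<pi> (F' v))"
    using derivative_eq_on_open[OF _ _ _ d1 d2] by blast
  then have eq: "f' (\<pi> z) = \<pi> (F' z)" for z
    by (rule fun_cong)
  have hG: "h (\<pi> z) (\<pi> v) (\<pi> w) = metric_tensor \<alpha> \<beta> \<gamma> \<delta> z v w" if "z \<in> S_domain" for z v w
    using tensor_in_variablesD[OF h that] by simp
  have "h (f u) (f' v) (f' w) = h (\<pi> (F u0)) (\<pi> (F' (\<sigma> v))) (\<pi> (F' (\<sigma> w)))"
    using eq[of "\<sigma> v"] eq[of "\<sigma> w"] by (simp add: F(2) \<pi>_\<sigma>)
  also have "\<dots> = metric_tensor \<alpha> \<beta> \<gamma> \<delta> (F u0) (F' (\<sigma> v)) (F' (\<sigma> w))"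
    using FR[OF u0(1)] by (simp add: hG has_S_coords_iff)
  also have "\<dots> = metric_tensor \<alpha> \<beta> \<gamma> \<delta> u0 (\<sigma> v) (\<sigma> w)"
    unfolding F'_def by (rule left_translation_metric[OF nonneg g F(1) u0(1)])
  also have "\<dots> = h u v w"
    using hG[OF u0(1), of "\<sigma> v" "\<sigma> w"] by (simp add: u0(2) \<pi>_\<sigma>)
  finally show ?thesis by (simp add: f'_def)
qed

theorem invariant_metric_descends:
  assumes nonneg: "\<alpha> \<ge> 0" "\<beta> \<ge> 0" "\<gamma> \<ge> 0" "\<delta> \<ge> 0"
    and h: "tensor_in_variables \<pi> (metric_tensor \<alpha> \<beta> \<gamma> \<delta>) h"
    and pos: "\<And>u v. \<sigma> u \<in> S_domain \<Longrightarrow> v \<noteq> 0 \<Longrightarrow> ds2 \<alpha> \<beta> \<gamma> \<delta> (\<sigma> u) (\<sigma> v) > 0"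
  shows "invariant_metric (carrier jacobi) act M R h"
  unfolding invariant_metric_def
proof (intro conjI ballI)
  show "coordinates_on M R" by (rule coordinates)
  have h_eq: "h u v w = metric_tensor \<alpha> \<beta> \<gamma> \<delta> (\<sigma> u) (\<sigma> v) (\<sigma> w)" if "u \<in> coord_domain R" for u v w
    using tensor_in_variablesD[OF h, of "\<sigma> u"] that by (simp add: coord_domain_R \<pi>_\<sigma>)
  have "riemannian_metric_on (coord_domain R) (\<lambda>u v w. metric_tensor \<alpha> \<beta> \<gamma> \<delta> (\<sigma> u) (\<sigma> v) (\<sigma> w))"
    by (rule riemannian_metric_section[OF open_coord_domain _ linear_\<sigma> nonneg])
       (auto simp: coord_domain_R intro: pos)
  then show "riemannian_metric_on (coord_domain R) h"
    by (rule riemannian_metric_on_cong[OF open_coord_domain]) (intro ext, rule h_eq[symmetric])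
  show "isometry_on M R h (act g)" if g: "g \<in> carrier jacobi" for g
    unfolding isometry_on_def
    using act_bij[OF g] act_local_expression[OF g] act_preserves_metric[OF nonneg h g] by blast
qed

end

section \<open>The five homogeneous spaces\<close>

text \<open>Angles that differ by a multiple of \<open>2 \<pi>\<close> and lie in a common open interval of length \<open>2 \<pi>\<close>
  coincide. This makes coordinates that include the angle locally unique.\<close>
lemma angle_unique_near:
  assumes "\<bar>s - r\<bar> < pi" "\<bar>t - r\<bar> < pi" and "\<exists>n::int. s = t + 2 * pi * n"
  shows "s = t"
proof -
  obtain n :: int where n: "s = t + 2 * pi * n" using assms(3) by blast
  have "\<bar>s - t\<bar> < 2 * pi" using assms(1,2) by linarith
  then have "2 * pi * \<bar>real_of_int n\<bar> < 2 * pi * 1"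
    using n by (simp add: abs_mult)
  then have "\<bar>real_of_int n\<bar> < 1"
    by (rule mult_left_less_imp_less) simp
  then have "n = 0" by linarith
  then show ?thesis using n by simp
qed

lemma homogeneous_space_jacobi:
  "homogeneous_space (carrier jacobi) has_S_coords (mult jacobi) (\<lambda>g. g) (\<lambda>u. u) (\<lambda>u. u)"
proof (rule homogeneous_space.intro)
  show "g \<in> carrier jacobi" if "has_S_coords g u" for g u
    using that s_point_in_carrier unfolding has_S_coords_iff by simp
  show "g = h" if "has_S_coords g u" "has_S_coords h u'" "u = u'" for g h u u'
    using that unfolding has_S_coords_iff by simp
  show "\<exists>W. open W \<and> w \<in> W \<and>
      (\<forall>g u u'. has_S_coords g u \<longrightarrow> has_S_coords g u' \<longrightarrow> u \<in> W \<longrightarrow> u' \<in> W \<longrightarrow> u = u')" for w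
  proof (intro exI conjI allI impI)
    show "open {v. \<bar>\<theta>_of v - \<theta>_of w\<bar> < pi}"
      by (intro open_Collect_less continuous_intros)
    fix g u u'
    assume c: "has_S_coords g u" "has_S_coords g u'"
      and W: "u \<in> {v. \<bar>\<theta>_of v - \<theta>_of w\<bar> < pi}" "u' \<in> {v. \<bar>\<theta>_of v - \<theta>_of w\<bar> < pi}"
    have "\<theta>_of u = \<theta>_of u'"
      using W s_coords_unique(6)[OF c] by (intro angle_unique_near) simp_all
    then show "u = u'"
      using s_coords_unique(1-5)[OF c] by (simp add: prod_eq_iff)
  qed simp
qed (auto intro: linear_id[unfolded id_def])

lemma homogeneous_space_SL2:
  "homogeneous_space SL2 coords_SL2 (\<lambda>g N. fst g ** N) fst
     (\<lambda>(x, y, \<theta>, p, q, \<kappa>). (x, y, \<theta>)) (\<lambda>(x, y, \<theta>). (x, y, \<theta>, 0, 0, 0))"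
proof (rule homogeneous_space.intro)
  let ?\<pi> = "(\<lambda>(x, y, \<theta>, p, q, \<kappa>). (x, y, \<theta>)) :: scoord \<Rightarrow> real \<times> real \<times> real"
  let ?\<sigma> = "(\<lambda>(x, y, \<theta>). (x, y, \<theta>, 0, 0, 0)) :: real \<times> real \<times> real \<Rightarrow> scoord"
  show "linear ?\<pi>" "linear ?\<sigma>"
    by (auto intro!: linearI)
  show "?\<pi> (?\<sigma> w) = w" for w
    by (cases w) simp
  show "y_of (?\<sigma> (?\<pi> u)) = y_of u" for u
    by (cases u) simp
  show "fst ` carrier jacobi = SL2"
    by (simp add: jacobi_simps)
  show "N \<in> SL2" if "coords_SL2 N w" for N w
    using that by (cases w) (auto simp: coords_SL2_def iwasawa_entries entry_det)
  show "coords_SL2 (fst g) w \<longleftrightarrow> (\<exists>u. has_S_coords g u \<and> ?\<pi> u = w)" for g w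
  proof
    obtain M X k where g: "g = (M, X, k)" by (metis prod_cases3)
    obtain x y \<theta> where w: "w = (x, y, \<theta>)" by (metis prod_cases3)
    assume "coords_SL2 (fst g) w"
    then have "has_S_coords g (x, y, \<theta>, (X v* matrix_inv M) $ 1, (X v* matrix_inv M) $ 2, k)"
      by (simp add: coords_SL2_def has_S_coords_def g w vec2_eta)
    then show "\<exists>u. has_S_coords g u \<and> ?\<pi> u = w"
      unfolding w by (intro exI conjI) (assumption, simp)
  next
    assume "\<exists>u. has_S_coords g u \<and> ?\<pi> u = w"
    then show "coords_SL2 (fst g) w"
      by (auto simp: coords_SL2_def has_S_coords_def)
  qed
  show "fst g = fst h" if "has_S_coords g u" "has_S_coords h u'" "?\<pi> u = ?\<pi> u'" for g h u u'
    using that by (cases u; cases u') (auto simp: has_S_coords_def)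
  show "\<exists>W. open W \<and> w \<in> W \<and> (\<forall>g u u'. has_S_coords g u \<longrightarrow> has_S_coords g u' \<longrightarrow>
      ?\<pi> u \<in> W \<longrightarrow> ?\<pi> u' \<in> W \<longrightarrow> ?\<pi> u = ?\<pi> u')" for w
  proof (intro exI conjI allI impI)
    show "open {v. \<bar>snd (snd v) - snd (snd w)\<bar> < pi}"
      by (intro open_Collect_less continuous_intros)
    fix g u u'
    assume c: "has_S_coords g u" "has_S_coords g u'"
      and W: "?\<pi> u \<in> {v. \<bar>snd (snd v) - snd (snd w)\<bar> < pi}" "?\<pi> u' \<in> {v. \<bar>snd (snd v) - snd (snd w)\<bar> < pi}"
    have "\<theta>_of u = \<theta>_of u'"
      using W s_coords_unique(6)[OF c]
      by (intro angle_unique_near[of _ "snd (snd w)"]) (simp_all add: case_prod_beta)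
    then show "?\<pi> u = ?\<pi> u'"
      using s_coords_unique(1-5)[OF c] by (simp add: case_prod_beta)
  qed simp
  show "fst g ** fst h = fst (g \<otimes>\<^bsub>jacobi\<^esub> h)" for g h
    by (simp add: jacobi_simps jac_mult_def case_prod_beta)
qed

text \<open>The image of \<open>\<i>\<close> under a group element is its point \<open>x + \<i> y\<close>, so the upper half-plane is the
  orbit of \<open>\<i>\<close> and carries the first two S-coordinates.\<close>
lemma moebius_act_ii:
  assumes "u \<in> S_domain"
  shows "moebius_act (fst (s_point u)) \<i> = Complex (x_of u) (y_of u)"
proof -
  obtain x y \<theta> p q \<kappa> where u: "u = (x, y, \<theta>, p, q, \<kappa>)" by (metis prod_cases6)
  have y: "y > 0" using assms by (simp add: u)
  let ?c = "entry_c x y \<theta>" and ?d = "entry_d x y \<theta>"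
  have "(of_real ?c * \<i> + of_real ?d :: complex) \<noteq> 0"
    using entry_norm[OF y, of x \<theta>] by (auto simp: complex_eq_iff)
  moreover have "of_real (entry_a x y \<theta>) * \<i> + of_real (entry_b x y \<theta>) =
      Complex x y * (of_real ?c * \<i> + of_real ?d)"
    by (simp add: complex_eq_iff entry_ab[OF y])
  ultimately show ?thesis
    by (simp add: u s_point_def moebius_act_def)
qed

lemma moebius_act_mult:
  assumes "M $ 2 $ 1 \<noteq> 0 \<or> M $ 2 $ 2 \<noteq> 0"
  shows "moebius_act N (moebius_act M \<i>) = moebius_act (N ** M) \<i>"
proof -
  have D: "of_real (M $ 2 $ 1) * \<i> + of_real (M $ 2 $ 2) \<noteq> (0 :: complex)"
    using assms by (auto simp: complex_eq_iff)
  have *: "(n1 * (X / D) + n2) / (n3 * (X / D) + n4) = (n1 * X + n2 * D) / (n3 * X + n4 * D)"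
    if "D \<noteq> 0" for X D n1 n2 n3 n4 :: complex
  proof -
    have "n1 * (X / D) + n2 = (n1 * X + n2 * D) / D" "n3 * (X / D) + n4 = (n3 * X + n4 * D) / D"
      using that by (simp_all add: field_simps)
    then show ?thesis using that by simp
  qed
  show ?thesis
    unfolding moebius_act_def *[OF D]
    by (simp add: matrix_matrix_mult_def sum_2 algebra_simps)
qed

lemma homogeneous_space_upper_half_plane:
  "homogeneous_space upper_half_plane coords_uhp (\<lambda>g. moebius_act (fst g)) (\<lambda>g. moebius_act (fst g) \<i>)
     (\<lambda>(x, y, \<theta>, p, q, \<kappa>). (x, y)) (\<lambda>(x, y). (x, y, 0, 0, 0, 0))"
proof (rule homogeneous_space.intro)
  let ?\<pi> = "(\<lambda>(x, y, \<theta>, p, q, \<kappa>). (x, y)) :: scoord \<Rightarrow> real \<times> real"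
  let ?\<sigma> = "(\<lambda>(x, y). (x, y, 0, 0, 0, 0)) :: real \<times> real \<Rightarrow> scoord"
  let ?q = "\<lambda>g :: jac. moebius_act (fst g) \<i>"
  have q: "?q g = Complex (x_of u) (y_of u)" if "has_S_coords g u" for g u
    using that moebius_act_ii unfolding has_S_coords_iff by simp
  show "linear ?\<pi>" "linear ?\<sigma>"
    by (auto intro!: linearI)
  show "?\<pi> (?\<sigma> w) = w" for w
    by (cases w) simp
  show "y_of (?\<sigma> (?\<pi> u)) = y_of u" for u
    by (cases u) simp
  show "?q ` carrier jacobi = upper_half_plane"
  proof (intro Set.set_eqI iffI)
    fix \<tau> assume "\<tau> \<in> ?q ` carrier jacobi"
    then obtain g where g: "g \<in> carrier jacobi" "\<tau> = ?q g" by (elim imageE)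
    from s_point_surj[OF g(1)] obtain u where u: "u \<in> S_domain" "g = s_point u" .
    then show "\<tau> \<in> upper_half_plane"
      unfolding g(2) u(2) moebius_act_ii[OF u(1)] by (simp add: upper_half_plane_def in_S_domain)
  next
    fix \<tau> assume "\<tau> \<in> upper_half_plane"
    then have u: "(Re \<tau>, Im \<tau>, 0, 0, 0, 0) \<in> S_domain" by (simp add: upper_half_plane_def)
    show "\<tau> \<in> ?q ` carrier jacobi"
      by (rule image_eqI[OF _ s_point_in_carrier[OF u]]) (simp add: moebius_act_ii[OF u])
  qed
  show "\<tau> \<in> upper_half_plane" if "coords_uhp \<tau> w" for \<tau> w
    using that by (cases w) (simp add: coords_uhp_def upper_half_plane_def)
  show "coords_uhp (?q g) w \<longleftrightarrow> (\<exists>u. has_S_coords g u \<and> ?\<pi> u = w)" if g: "g \<in> carrier jacobi" for g w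
  proof
    from s_point_surj[OF g] obtain u where u: "u \<in> S_domain" "g = s_point u" .
    then have c: "has_S_coords g u" unfolding has_S_coords_iff by simp
    assume "coords_uhp (?q g) w"
    then have "?\<pi> u = w"
      by (cases w) (simp add: coords_uhp_def q[OF c] case_prod_beta)
    with c show "\<exists>u. has_S_coords g u \<and> ?\<pi> u = w" by (intro exI conjI)
  next
    assume "\<exists>u. has_S_coords g u \<and> ?\<pi> u = w"
    then obtain u where c: "has_S_coords g u" "?\<pi> u = w" by (elim exE conjE)
    have "y_of u > 0" using c(1) by (simp add: has_S_coords_iff in_S_domain)
    then show "coords_uhp (?q g) w"
      unfolding q[OF c(1)] c(2)[symmetric] by (simp add: coords_uhp_def case_prod_beta)
  qed
  show "?q g = ?q h" if "has_S_coords g u" "has_S_coords h u'" "?\<pi> u = ?\<pi> u'" for g h u u'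
    using that(3) unfolding q[OF that(1)] q[OF that(2)] by (simp add: case_prod_beta)
  show "\<exists>W. open W \<and> w \<in> W \<and> (\<forall>g u u'. has_S_coords g u \<longrightarrow> has_S_coords g u' \<longrightarrow>
      ?\<pi> u \<in> W \<longrightarrow> ?\<pi> u' \<in> W \<longrightarrow> ?\<pi> u = ?\<pi> u')" for w
  proof (intro exI[of _ UNIV] conjI allI impI)
    show "?\<pi> u = ?\<pi> u'" if "has_S_coords g u" "has_S_coords g u'" for g u u'
      using s_coords_unique(1-5)[OF that] by (simp add: case_prod_beta)
  qed simp_all
  show "moebius_act (fst g) (?q h) = ?q (g \<otimes>\<^bsub>jacobi\<^esub> h)" if h: "h \<in> carrier jacobi" for g h
  proof -
    have "det (fst h) = 1" using h by (auto simp: jacobi_simps SL2_def)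
    then have "fst h $ 2 $ 1 \<noteq> 0 \<or> fst h $ 2 $ 2 \<noteq> 0" by (auto simp: det_2)
    then show ?thesis
      by (simp add: moebius_act_mult jacobi_simps jac_mult_def case_prod_beta)
  qed
qed

text \<open>The elements of both stabilizers in S-coordinates; right multiplication by them shifts \<open>\<theta>\<close> and
  \<open>\<kappa>\<close> only, which is why the other coordinates live on the cosets.\<close>
definition rotation :: "real \<Rightarrow> real \<Rightarrow> jac" where
  "rotation \<phi> t = s_point (0, 1, \<phi>, 0, 0, t)"

lemma rotation_eq: "rotation \<phi> t = (mat2 (cos \<phi>) (sin \<phi>) (- sin \<phi>) (cos \<phi>), 0, t)"
  by (simp add: rotation_def s_point_def entry_a_def entry_b_def entry_c_def entry_d_def vec2_zero)

lemma orthogonal_SL2_iff: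
  "orthogonal_matrix M \<and> det M = 1 \<longleftrightarrow> (\<exists>\<phi>. M = mat2 (cos \<phi>) (sin \<phi>) (- sin \<phi>) (cos \<phi>))"
proof
  assume M: "orthogonal_matrix M \<and> det M = 1"
  obtain a b c d where M_eq: "M = mat2 a b c d" by (metis mat2_eta)
  have "transpose (mat2 a b c d) = mat2 a c b d"
    by (simp add: transpose_def vec_eq_iff forall_2)
  then have o: "a * a + b * b = 1" "a * c + b * d = 0" "c * c + d * d = 1" "a * d - b * c = 1"
    using M by (simp_all add: M_eq orthogonal_matrix_def mat_1_mat2)
  then have "d = a" "c = - b" by algebra+
  moreover obtain \<phi> where "a = cos \<phi>" "b = sin \<phi>"
    using o(1) sincos_total_2pi[of a b] by (auto simp: power2_eq_square)
  ultimately show "\<exists>\<phi>. M = mat2 (cos \<phi>) (sin \<phi>) (- sin \<phi>) (cos \<phi>)"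
    by (auto simp: M_eq)
next
  assume "\<exists>\<phi>. M = mat2 (cos \<phi>) (sin \<phi>) (- sin \<phi>) (cos \<phi>)"
  then obtain \<phi> where M_eq: "M = mat2 (cos \<phi>) (sin \<phi>) (- sin \<phi>) (cos \<phi>)" ..
  have "transpose M = mat2 (cos \<phi>) (- sin \<phi>) (sin \<phi>) (cos \<phi>)"
    by (simp add: M_eq transpose_def vec_eq_iff forall_2)
  then show "orthogonal_matrix M \<and> det M = 1"
    by (simp add: M_eq orthogonal_matrix_def mat_1_mat2 mult.commute flip: power2_eq_square)
qed

lemma SO2_eq: "SO2 = {rotation \<phi> t | \<phi> t. t \<in> {0}}"
  unfolding SO2_def rotation_eq orthogonal_SL2_iff by auto

lemma SO2_R_eq: "SO2_R = {rotation \<phi> t | \<phi> t. t \<in> UNIV}"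
  unfolding SO2_R_def rotation_eq orthogonal_SL2_iff by auto

lemma s_point_mult_rotation:
  "s_point (x, y, \<theta>, p, q, \<kappa>) \<otimes>\<^bsub>jacobi\<^esub> rotation \<phi> t = s_point (x, y, \<theta> + \<phi>, p, q, \<kappa> + t)"
  by (simp add: rotation_eq s_point_def jacobi_simps vec2_zero entry_a_def entry_b_def entry_c_def
      entry_d_def sin_add cos_add algebra_simps diff_divide_distrib add_divide_distrib)

lemma rotation_mult: "rotation \<phi> t \<otimes>\<^bsub>jacobi\<^esub> rotation \<phi>' t' = rotation (\<phi> + \<phi>') (t + t')"
  using s_point_mult_rotation by (simp add: rotation_def)

lemma rotation_0: "rotation 0 0 = \<one>\<^bsub>jacobi\<^esub>"
  by (simp add: rotation_eq jacobi_simps vec2_zero)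

lemma rotation_in_carrier: "rotation \<phi> t \<in> carrier jacobi"
  unfolding rotation_def by (rule s_point_in_carrier) simp

lemma subgroup_rotations:
  assumes T: "0 \<in> T" "\<And>s t. s \<in> T \<Longrightarrow> t \<in> T \<Longrightarrow> s + t \<in> T" "\<And>t. t \<in> T \<Longrightarrow> - t \<in> T"
  shows "subgroup {rotation \<phi> t | \<phi> t. t \<in> T} jacobi"
proof -
  interpret group jacobi by (rule group_jacobi)
  have inverse: "m_inv jacobi (rotation \<phi> t) = rotation (- \<phi>) (- t)" for \<phi> t
    by (rule inv_equality) (simp_all add: rotation_mult rotation_0 rotation_in_carrier)
  show ?thesis
  proof (rule subgroupI)
    show "{rotation \<phi> t | \<phi> t. t \<in> T} \<subseteq> carrier jacobi"
      using rotation_in_carrier by blast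
    show "{rotation \<phi> t | \<phi> t. t \<in> T} \<noteq> {}"
      using T(1) by blast
    fix g assume "g \<in> {rotation \<phi> t | \<phi> t. t \<in> T}"
    then obtain \<phi> t where g: "g = rotation \<phi> t" "t \<in> T" by blast
    then show "m_inv jacobi g \<in> {rotation \<phi> t | \<phi> t. t \<in> T}"
      using T(3) inverse by blast
    fix h assume "h \<in> {rotation \<phi> t | \<phi> t. t \<in> T}"
    then obtain \<phi>' t' where "h = rotation \<phi>' t'" "t' \<in> T" by blast
    then show "g \<otimes>\<^bsub>jacobi\<^esub> h \<in> {rotation \<phi> t | \<phi> t. t \<in> T}"
      unfolding g rotation_mult[symmetric] using g T(2) rotation_mult by blast
  qed
qed

text \<open>Both coset spaces at once: \<open>T\<close> is the group of shifts of \<open>\<kappa>\<close> in the stabilizer, \<open>{0}\<close> or all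
  of \<open>\<real>\<close>, and the hypothesis on \<open>\<pi>\<close> says that two tuples project to the same coordinates exactly
  if they differ by a shift that the stabilizer produces.\<close>
lemma homogeneous_space_cosets:
  fixes T :: "real set" and \<pi> :: "scoord \<Rightarrow> 'c::euclidean_space"
  defines "H \<equiv> {rotation \<phi> t | \<phi> t. t \<in> T}"
  assumes T: "0 \<in> T" "\<And>s t. s \<in> T \<Longrightarrow> t \<in> T \<Longrightarrow> s + t \<in> T" "\<And>t. t \<in> T \<Longrightarrow> - t \<in> T"
    and lin: "linear \<pi>" "linear \<sigma>" and \<sigma>: "\<And>w. \<pi> (\<sigma> w) = w" "\<And>u. y_of (\<sigma> (\<pi> u)) = y_of u"
    and \<pi>: "\<And>x y \<theta> p q \<kappa> x' y' \<theta>' p' q' \<kappa>'. \<pi> (x, y, \<theta>, p, q, \<kappa>) = \<pi> (x', y', \<theta>', p', q', \<kappa>') \<longleftrightarrow>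
      x = x' \<and> y = y' \<and> p = p' \<and> q = q' \<and> \<kappa>' - \<kappa> \<in> T"
    and R: "\<And>C w. R C w \<longleftrightarrow> C \<in> lcosets\<^bsub>jacobi\<^esub> H \<and> (\<exists>g\<in>C. \<exists>u. has_S_coords g u \<and> \<pi> u = w)"
  shows "homogeneous_space (lcosets\<^bsub>jacobi\<^esub> H) R (l_coset jacobi) (\<lambda>g. g <#\<^bsub>jacobi\<^esub> H) \<pi> \<sigma>"
proof -
  interpret group jacobi by (rule group_jacobi)
  have H: "subgroup H jacobi" unfolding H_def using T by (rule subgroup_rotations)
  have coset_eq: "(g \<otimes>\<^bsub>jacobi\<^esub> k) <#\<^bsub>jacobi\<^esub> H = g <#\<^bsub>jacobi\<^esub> H" if "g \<in> carrier jacobi" "k \<in> H" for g k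
  proof -
    have k: "k \<in> carrier jacobi" using H that(2) by (rule subgroup.mem_carrier)
    have "(g \<otimes>\<^bsub>jacobi\<^esub> k) <#\<^bsub>jacobi\<^esub> H = g <#\<^bsub>jacobi\<^esub> (k <#\<^bsub>jacobi\<^esub> H)"
      by (rule lcos_m_assoc[OF subgroup.subset[OF H] that(1) k, symmetric])
    also have "k <#\<^bsub>jacobi\<^esub> H = H" by (rule coset_join3[OF k H that(2)])
    finally show ?thesis .
  qed
  have shift: "\<exists>u. has_S_coords g u \<and> \<pi> u = \<pi> v" if "has_S_coords (g \<otimes>\<^bsub>jacobi\<^esub> k) v" "k \<in> H" "g \<in> carrier jacobi" for g k v
  proof -
    obtain x y \<theta> p q \<kappa> where v: "v = (x, y, \<theta>, p, q, \<kappa>)" by (metis prod_cases6)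
    have k': "m_inv jacobi k \<in> H" using that(2) by (rule subgroup.m_inv_closed[OF H])
    then obtain \<phi> t where rot: "m_inv jacobi k = rotation \<phi> t" "t \<in> T" unfolding H_def by blast
    have k: "k \<in> carrier jacobi" using H that(2) by (rule subgroup.mem_carrier)
    have "g = (g \<otimes>\<^bsub>jacobi\<^esub> k) \<otimes>\<^bsub>jacobi\<^esub> m_inv jacobi k"
      unfolding m_assoc[OF that(3) k inv_closed[OF k]] r_inv[OF k] by (rule r_one[OF that(3), symmetric])
    also have "g \<otimes>\<^bsub>jacobi\<^esub> k = s_point v"
      using that(1) unfolding has_S_coords_iff by simp
    finally have "g = s_point (x, y, \<theta> + \<phi>, p, q, \<kappa> + t)"
      unfolding v rot s_point_mult_rotation .
    moreover have "y > 0" using that(1) by (simp add: has_S_coords_iff v)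
    ultimately have "has_S_coords g (x, y, \<theta> + \<phi>, p, q, \<kappa> + t)"
      by (simp add: has_S_coords_iff)
    moreover have "\<pi> (x, y, \<theta> + \<phi>, p, q, \<kappa> + t) = \<pi> v"
      unfolding v \<pi> using T(3)[OF rot(2)] by simp
    ultimately show ?thesis by (intro exI conjI)
  qed
  show ?thesis
  proof (rule homogeneous_space.intro)
    show "linear \<pi>" "linear \<sigma>"
      by (fact lin)+
    show "\<pi> (\<sigma> w) = w" for w
      by (rule \<sigma>)
    show "y_of (\<sigma> (\<pi> u)) = y_of u" for u
      by (rule \<sigma>)
    show "(\<lambda>g. g <#\<^bsub>jacobi\<^esub> H) ` carrier jacobi = lcosets\<^bsub>jacobi\<^esub> H"
      by (auto simp: LCOSETS_def)
    show "C \<in> lcosets\<^bsub>jacobi\<^esub> H" if "R C w" for C w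
      using that unfolding R by (rule conjunct1)
    show "R (g <#\<^bsub>jacobi\<^esub> H) w \<longleftrightarrow> (\<exists>u. has_S_coords g u \<and> \<pi> u = w)" if g: "g \<in> carrier jacobi" for g w
    proof
      assume "R (g <#\<^bsub>jacobi\<^esub> H) w"
      then obtain k v where k: "k \<in> H" and v: "has_S_coords (g \<otimes>\<^bsub>jacobi\<^esub> k) v" "\<pi> v = w"
        unfolding R l_coset_def by blast
      from shift[OF v(1) k g] v(2) show "\<exists>u. has_S_coords g u \<and> \<pi> u = w" by simp
    next
      assume "\<exists>u. has_S_coords g u \<and> \<pi> u = w"
      moreover have "g \<in> g <#\<^bsub>jacobi\<^esub> H" using g H by (rule lcos_self)
      moreover have "g <#\<^bsub>jacobi\<^esub> H \<in> lcosets\<^bsub>jacobi\<^esub> H" using g by (auto simp: LCOSETS_def)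
      ultimately show "R (g <#\<^bsub>jacobi\<^esub> H) w" unfolding R by blast
    qed
    show "g <#\<^bsub>jacobi\<^esub> H = h <#\<^bsub>jacobi\<^esub> H"
      if c: "has_S_coords g u" "has_S_coords h u'" and eq: "\<pi> u = \<pi> u'" for g h u u'
    proof -
      obtain x y \<theta> p q \<kappa> where u: "u = (x, y, \<theta>, p, q, \<kappa>)" by (metis prod_cases6)
      obtain x' y' \<theta>' p' q' \<kappa>' where u': "u' = (x', y', \<theta>', p', q', \<kappa>')" by (metis prod_cases6)
      have e: "x = x'" "y = y'" "p = p'" "q = q'" "\<kappa>' - \<kappa> \<in> T"
        using eq unfolding u u' \<pi> by simp_all
      have g: "g = s_point u" "g \<in> carrier jacobi" and h: "h = s_point u'"
        using c s_point_in_carrier by (simp_all add: has_S_coords_iff)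
      have "h = g \<otimes>\<^bsub>jacobi\<^esub> rotation (\<theta>' - \<theta>) (\<kappa>' - \<kappa>)"
        unfolding g(1) h u u' s_point_mult_rotation using e by simp
      moreover have "rotation (\<theta>' - \<theta>) (\<kappa>' - \<kappa>) \<in> H"
        unfolding H_def using e(5) by blast
      ultimately show ?thesis using coset_eq[OF g(2)] by simp
    qed
    show "\<exists>W. open W \<and> w \<in> W \<and> (\<forall>g u u'. has_S_coords g u \<longrightarrow> has_S_coords g u' \<longrightarrow>
        \<pi> u \<in> W \<longrightarrow> \<pi> u' \<in> W \<longrightarrow> \<pi> u = \<pi> u')" for w
    proof (intro exI[of _ UNIV] conjI allI impI)
      show "\<pi> u = \<pi> u'" if "has_S_coords g u" "has_S_coords g u'" for g u u'
      proof (cases u; cases u')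
        fix x y \<theta> p q \<kappa> x' y' \<theta>' p' q' \<kappa>'
        assume "u = (x, y, \<theta>, p, q, \<kappa>)" "u' = (x', y', \<theta>', p', q', \<kappa>')"
        then show ?thesis
          using s_coords_unique(1-5)[OF that] T(1) by (simp add: \<pi>)
      qed
    qed simp_all
    show "g <#\<^bsub>jacobi\<^esub> (h <#\<^bsub>jacobi\<^esub> H) = (g \<otimes>\<^bsub>jacobi\<^esub> h) <#\<^bsub>jacobi\<^esub> H"
      if "g \<in> carrier jacobi" "h \<in> carrier jacobi" for g h
      by (rule lcos_m_assoc[OF subgroup.subset[OF H] that])
  qed
qed

lemma homogeneous_space_ext_siegel_jacobi:
  "homogeneous_space ext_siegel_jacobi coords_ext_siegel_jacobi (l_coset jacobi) (\<lambda>g. g <#\<^bsub>jacobi\<^esub> SO2)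
     (\<lambda>(x, y, \<theta>, p, q, \<kappa>). (x, y, p, q, \<kappa>)) (\<lambda>(x, y, p, q, \<kappa>). (x, y, 0, p, q, \<kappa>))"
  unfolding ext_siegel_jacobi_def SO2_eq
proof (rule homogeneous_space_cosets)
  show "linear ((\<lambda>(x, y, \<theta>, p, q, \<kappa>). (x, y, p, q, \<kappa>)) :: scoord \<Rightarrow> real \<times> real \<times> real \<times> real \<times> real)"
    "linear ((\<lambda>(x, y, p, q, \<kappa>). (x, y, 0, p, q, \<kappa>)) :: _ \<Rightarrow> scoord)"
    by (auto intro!: linearI)
  show "coords_ext_siegel_jacobi C w \<longleftrightarrow> C \<in> lcosets\<^bsub>jacobi\<^esub> {rotation \<phi> t |\<phi> t. t \<in> {0}} \<and>
      (\<exists>g\<in>C. \<exists>u. has_S_coords g u \<and> (\<lambda>(x, y, \<theta>, p, q, \<kappa>). (x, y, p, q, \<kappa>)) u = w)" for C w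
    by (cases w) (auto simp: coords_ext_siegel_jacobi_def ext_siegel_jacobi_def SO2_eq)
qed auto

lemma homogeneous_space_siegel_jacobi:
  "homogeneous_space siegel_jacobi coords_siegel_jacobi (l_coset jacobi) (\<lambda>g. g <#\<^bsub>jacobi\<^esub> SO2_R)
     (\<lambda>(x, y, \<theta>, p, q, \<kappa>). (x, y, p, q)) (\<lambda>(x, y, p, q). (x, y, 0, p, q, 0))"
  unfolding siegel_jacobi_def SO2_R_eq
proof (rule homogeneous_space_cosets)
  show "linear ((\<lambda>(x, y, \<theta>, p, q, \<kappa>). (x, y, p, q)) :: scoord \<Rightarrow> real \<times> real \<times> real \<times> real)"
    "linear ((\<lambda>(x, y, p, q). (x, y, 0, p, q, 0)) :: _ \<Rightarrow> scoord)"
    by (auto intro!: linearI)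
  show "coords_siegel_jacobi C w \<longleftrightarrow> C \<in> lcosets\<^bsub>jacobi\<^esub> {rotation \<phi> t |\<phi> t. t \<in> UNIV} \<and>
      (\<exists>g\<in>C. \<exists>u. has_S_coords g u \<and> (\<lambda>(x, y, \<theta>, p, q, \<kappa>). (x, y, p, q)) u = w)" for C w
    by (cases w) (auto simp: coords_siegel_jacobi_def siegel_jacobi_def SO2_R_eq)
qed auto

section \<open>The metrics on the five spaces\<close>

text \<open>Positive definiteness in the variables that occur: a parameter that vanishes excuses the variables
  that only its summand controls.\<close>
lemma ds2_pos:
  assumes "y_of u > 0" "\<alpha> > 0" "\<beta> \<ge> 0" "\<gamma> \<ge> 0" "\<delta> \<ge> 0"
    and "\<not> (x_of v = 0 \<and> y_of v = 0 \<and> (\<beta> > 0 \<longrightarrow> \<theta>_of v = 0) \<and> (\<gamma> > 0 \<longrightarrow> p_of v = 0 \<and> q_of v = 0)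
      \<and> (\<delta> > 0 \<longrightarrow> \<kappa>_of v = p_of u * q_of v - q_of u * p_of v))"
  shows "ds2 \<alpha> \<beta> \<gamma> \<delta> u v > 0"
proof -
  obtain x y \<theta> p q \<kappa> where u: "u = (x, y, \<theta>, p, q, \<kappa>)" by (metis prod_cases6)
  obtain dx dy d\<theta> dp dq d\<kappa> where v: "v = (dx, dy, d\<theta>, dp, dq, d\<kappa>)" by (metis prod_cases6)
  have y: "y > 0" using assms(1) by (simp add: u)
  note def = ds2_definite[OF y less_imp_le[OF assms(2)] assms(3-5), of x \<theta> p q \<kappa> dx dy d\<theta> dp dq d\<kappa>,
      folded u v]
  have "ds2 \<alpha> \<beta> \<gamma> \<delta> u v \<noteq> 0"
  proof
    assume 0: "ds2 \<alpha> \<beta> \<gamma> \<delta> u v = 0"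
    show False
      using assms(6) def(2)[OF 0 assms(2)] def(3)[OF 0] def(4)[OF 0] def(5)[OF 0] by (auto simp: u v)
  qed
  with def(1) show ?thesis by simp
qed

lemma invariant_metric_jacobi:
  assumes "\<alpha> > 0" "\<beta> > 0" "\<gamma> > 0" "\<delta> > 0"
  shows "invariant_metric (carrier jacobi) (mult jacobi) (carrier jacobi) has_S_coords
    (metric_tensor \<alpha> \<beta> \<gamma> \<delta>)"
proof (rule homogeneous_space.invariant_metric_descends[OF homogeneous_space_jacobi])
  show "tensor_in_variables (\<lambda>u. u) (metric_tensor \<alpha> \<beta> \<gamma> \<delta>) (metric_tensor \<alpha> \<beta> \<gamma> \<delta>)"
    by (simp add: tensor_in_variables_def)
  show "ds2 \<alpha> \<beta> \<gamma> \<delta> u v > 0" if "u \<in> S_domain" "v \<noteq> 0" for u v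
    using that assms by (intro ds2_pos) (auto simp: in_S_domain prod_eq_iff)
qed (use assms in auto)

lemma tensor_in_variables_section:
  assumes "\<And>u v w. u \<in> S_domain \<Longrightarrow> G u v w = G (\<sigma> (\<pi> u)) (\<sigma> (\<pi> v)) (\<sigma> (\<pi> w))"
  shows "tensor_in_variables \<pi> G (\<lambda>u v w. G (\<sigma> u) (\<sigma> v) (\<sigma> w))"
  using assms unfolding tensor_in_variables_def by blast

text \<open>\<open>SL2\<close> acts through the elements \<open>(N, 0, 0)\<close> of the Jacobi group.\<close>
lemma invariant_metric_SL2_of_jacobi:
  assumes "invariant_metric (carrier jacobi) (\<lambda>g. act (fst g)) M R h"
  shows "invariant_metric SL2 act M R h"
proof -
  have "isometry_on M R h (act N)" if "N \<in> SL2" for N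
  proof -
    have "(N, 0, 0) \<in> carrier jacobi" using that by (simp add: jacobi_simps)
    then show ?thesis using assms unfolding invariant_metric_def by fastforce
  qed
  with assms show ?thesis unfolding invariant_metric_def by blast
qed

lemma invariant_metric_upper_half_plane:
  assumes \<alpha>: "\<alpha> > 0"
  shows "\<exists>h. tensor_in_variables (\<lambda>(x, y, \<theta>, p, q, \<kappa>). (x, y)) (metric_tensor \<alpha> 0 0 0) h \<and>
    invariant_metric SL2 moebius_act upper_half_plane coords_uhp h"
proof -
  let ?\<sigma> = "(\<lambda>(x, y). (x, y, 0, 0, 0, 0)) :: real \<times> real \<Rightarrow> scoord"
  let ?h = "\<lambda>u v w. metric_tensor \<alpha> 0 0 0 (?\<sigma> u) (?\<sigma> v) (?\<sigma> w)"
  have t: "tensor_in_variables (\<lambda>(x, y, \<theta>, p, q, \<kappa>). (x, y)) (metric_tensor \<alpha> 0 0 0) ?h"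
    by (rule tensor_in_variables_section) (auto simp: metric_tensor_tuple)
  have "invariant_metric SL2 moebius_act upper_half_plane coords_uhp ?h"
  proof (rule invariant_metric_SL2_of_jacobi,
      rule homogeneous_space.invariant_metric_descends[OF homogeneous_space_upper_half_plane _ _ _ _ t])
    show "ds2 \<alpha> 0 0 0 (?\<sigma> u) (?\<sigma> v) > 0" if "?\<sigma> u \<in> S_domain" "v \<noteq> 0" for u v
      using that \<alpha> by (intro ds2_pos) (auto simp: in_S_domain case_prod_beta prod_eq_iff)
  qed (use \<alpha> in auto)
  with t show ?thesis by blast
qed

lemma invariant_metric_SL2:
  assumes pos: "\<alpha> > 0" "\<beta> > 0"
  shows "\<exists>h. tensor_in_variables (\<lambda>(x, y, \<theta>, p, q, \<kappa>). (x, y, \<theta>)) (metric_tensor \<alpha> \<beta> 0 0) h \<and>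
    invariant_metric SL2 (**) SL2 coords_SL2 h"
proof -
  let ?\<sigma> = "(\<lambda>(x, y, \<theta>). (x, y, \<theta>, 0, 0, 0)) :: real \<times> real \<times> real \<Rightarrow> scoord"
  let ?h = "\<lambda>u v w. metric_tensor \<alpha> \<beta> 0 0 (?\<sigma> u) (?\<sigma> v) (?\<sigma> w)"
  have t: "tensor_in_variables (\<lambda>(x, y, \<theta>, p, q, \<kappa>). (x, y, \<theta>)) (metric_tensor \<alpha> \<beta> 0 0) ?h"
    by (rule tensor_in_variables_section) (auto simp: metric_tensor_tuple)
  have "invariant_metric SL2 (**) SL2 coords_SL2 ?h"
  proof (rule invariant_metric_SL2_of_jacobi,
      rule homogeneous_space.invariant_metric_descends[OF homogeneous_space_SL2 _ _ _ _ t])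
    show "ds2 \<alpha> \<beta> 0 0 (?\<sigma> u) (?\<sigma> v) > 0" if "?\<sigma> u \<in> S_domain" "v \<noteq> 0" for u v
      using that pos by (intro ds2_pos) (auto simp: in_S_domain case_prod_beta prod_eq_iff)
  qed (use pos in auto)
  with t show ?thesis by blast
qed

lemma invariant_metric_siegel_jacobi:
  assumes pos: "\<alpha> > 0" "\<gamma> > 0"
  shows "\<exists>h. tensor_in_variables (\<lambda>(x, y, \<theta>, p, q, \<kappa>). (x, y, p, q)) (metric_tensor \<alpha> 0 \<gamma> 0) h \<and>
    invariant_metric (carrier jacobi) (l_coset jacobi) siegel_jacobi coords_siegel_jacobi h"
proof -
  let ?\<sigma> = "(\<lambda>(x, y, p, q). (x, y, 0, p, q, 0)) :: real \<times> real \<times> real \<times> real \<Rightarrow> scoord"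
  let ?h = "\<lambda>u v w. metric_tensor \<alpha> 0 \<gamma> 0 (?\<sigma> u) (?\<sigma> v) (?\<sigma> w)"
  have t: "tensor_in_variables (\<lambda>(x, y, \<theta>, p, q, \<kappa>). (x, y, p, q)) (metric_tensor \<alpha> 0 \<gamma> 0) ?h"
    by (rule tensor_in_variables_section) (auto simp: metric_tensor_tuple)
  have "invariant_metric (carrier jacobi) (l_coset jacobi) siegel_jacobi coords_siegel_jacobi ?h"
  proof (rule homogeneous_space.invariant_metric_descends[OF homogeneous_space_siegel_jacobi _ _ _ _ t])
    show "ds2 \<alpha> 0 \<gamma> 0 (?\<sigma> u) (?\<sigma> v) > 0" if "?\<sigma> u \<in> S_domain" "v \<noteq> 0" for u v
      using that pos by (intro ds2_pos) (auto simp: in_S_domain case_prod_beta prod_eq_iff)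
  qed (use pos in auto)
  with t show ?thesis by blast
qed

lemma invariant_metric_ext_siegel_jacobi:
  assumes pos: "\<alpha> > 0" "\<gamma> > 0" "\<delta> > 0"
  shows "\<exists>h. tensor_in_variables (\<lambda>(x, y, \<theta>, p, q, \<kappa>). (x, y, p, q, \<kappa>)) (metric_tensor \<alpha> 0 \<gamma> \<delta>) h \<and>
    invariant_metric (carrier jacobi) (l_coset jacobi) ext_siegel_jacobi coords_ext_siegel_jacobi h"
proof -
  let ?\<sigma> = "(\<lambda>(x, y, p, q, \<kappa>). (x, y, 0, p, q, \<kappa>)) :: real \<times> real \<times> real \<times> real \<times> real \<Rightarrow> scoord"
  let ?h = "\<lambda>u v w. metric_tensor \<alpha> 0 \<gamma> \<delta> (?\<sigma> u) (?\<sigma> v) (?\<sigma> w)"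
  have t: "tensor_in_variables (\<lambda>(x, y, \<theta>, p, q, \<kappa>). (x, y, p, q, \<kappa>)) (metric_tensor \<alpha> 0 \<gamma> \<delta>) ?h"
    by (rule tensor_in_variables_section) (auto simp: metric_tensor_tuple)
  have "invariant_metric (carrier jacobi) (l_coset jacobi) ext_siegel_jacobi coords_ext_siegel_jacobi ?h"
  proof (rule homogeneous_space.invariant_metric_descends[OF homogeneous_space_ext_siegel_jacobi _ _ _ _ t])
    show "ds2 \<alpha> 0 \<gamma> \<delta> (?\<sigma> u) (?\<sigma> v) > 0" if "?\<sigma> u \<in> S_domain" "v \<noteq> 0" for u v
      using that pos by (intro ds2_pos) (auto simp: in_S_domain case_prod_beta prod_eq_iff)
  qed (use pos in auto)
  with t show ?thesis by blast
qed

section \<open>Composition law, metric, frame and quotients together\<close>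

lemma complex_quotient_eq_iff:
  "complex_of_real x1 + \<i> * complex_of_real y1 =
     (complex_of_real n + \<i> * complex_of_real y) / complex_of_real r \<longleftrightarrow> x1 = n / r \<and> y1 = y / r"
  by (simp add: complex_eq_iff)

theorem theorem5p7:
  fixes \<alpha> \<beta> \<gamma> \<delta> :: real
  assumes pos: "\<alpha> > 0" "\<beta> > 0" "\<gamma> > 0" "\<delta> > 0"
  shows
    \<comment> \<open>(a)\<close>
    "(\<forall>g g' x y \<theta> p q \<kappa> x' y' \<theta>' p' q' \<kappa>'.
        has_S_coords g (x, y, \<theta>, p, q, \<kappa>) \<longrightarrow> has_S_coords g' (x', y', \<theta>', p', q', \<kappa>') \<longrightarrow>
        (let a = sqrt y * cos \<theta> - x / sqrt y * sin \<theta>;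
             b = sqrt y * sin \<theta> + x / sqrt y * cos \<theta>;
             c = - (1 / sqrt y) * sin \<theta>;
             d = 1 / sqrt y * cos \<theta>;
             l = p * a + q * c;
             m = p * b + q * d;
             \<Lambda> = (c * x' + d)\<^sup>2 + (c * y')\<^sup>2
         in fst g = mat2 a b c d \<and> fst (snd g) = vector [l, m] \<and>
            (\<forall>x\<^sub>1 y\<^sub>1 \<theta>\<^sub>1 p\<^sub>1 q\<^sub>1 \<kappa>\<^sub>1.
               has_S_coords (g \<otimes>\<^bsub>jacobi\<^esub> g') (x\<^sub>1, y\<^sub>1, \<theta>\<^sub>1, p\<^sub>1, q\<^sub>1, \<kappa>\<^sub>1) \<longleftrightarrow>
               complex_of_real x\<^sub>1 + \<i> * complex_of_real y\<^sub>1 =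
                 (complex_of_real ((a * x' + b) * (c * x' + d) + a * c * y'\<^sup>2)
                  + \<i> * complex_of_real y') / complex_of_real \<Lambda> \<and>
               sin \<theta>\<^sub>1 = ((c * x' + d) * sin \<theta>' - c * y' * cos \<theta>') / sqrt \<Lambda> \<and>
               cos \<theta>\<^sub>1 = (c * y' * sin \<theta>' + (c * x' + d) * cos \<theta>') / sqrt \<Lambda> \<and>
               p\<^sub>1 = p + d * p' - c * q' \<and>
               q\<^sub>1 = q - b * p' + a * q' \<and>
               \<kappa>\<^sub>1 = \<kappa> + \<kappa>' + l * q' - m * p')))
     \<and>
     \<comment> \<open>(b)\<close>
     (\<forall>u\<in>S_domain. \<forall>v. (\<Sum>i = 1..6. (one_form \<alpha> \<beta> \<gamma> \<delta> i u v)\<^sup>2) = ds2 \<alpha> \<beta> \<gamma> \<delta> u v) \<and>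
     invariant_metric (carrier jacobi) (mult jacobi) (carrier jacobi) has_S_coords
       (metric_tensor \<alpha> \<beta> \<gamma> \<delta>) \<and>
     (\<forall>u\<in>S_domain. \<forall>i\<in>{1..6}. \<forall>j\<in>{1..6}.
        metric_matrix \<alpha> \<beta> \<gamma> \<delta> u i j = metric_matrix \<alpha> \<beta> \<gamma> \<delta> u j i \<and>
        (i \<le> 3 \<and> j > 3 \<longrightarrow> metric_matrix \<alpha> \<beta> \<gamma> \<delta> u i j = 0)) \<and>
     (\<forall>x y \<theta> p q \<kappa>. y > 0 \<longrightarrow>
        (\<forall>i\<in>{1..6}. \<forall>j\<in>{1..6}. metric_matrix \<alpha> \<beta> \<gamma> \<delta> (x, y, \<theta>, p, q, \<kappa>) i j =
          [[(\<alpha> + \<beta>) / y\<^sup>2, 0,        2 * \<beta> / y, 0,                               0,                    0],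
           [0,             \<alpha> / y\<^sup>2, 0,         0,                               0,                    0],
           [2 * \<beta> / y,     0,        4 * \<beta>,     0,                               0,                    0],
           [0, 0, 0,       \<gamma> * ((x\<^sup>2 + y\<^sup>2) / y) + \<delta> * q\<^sup>2, \<gamma> * (x / y) - \<delta> * p * q, \<delta> * q],
           [0, 0, 0,       \<gamma> * (x / y) - \<delta> * p * q,         \<gamma> / y + \<delta> * p\<^sup>2,       - \<delta> * p],
           [0, 0, 0,       \<delta> * q,                           - \<delta> * p,             \<delta>]]
          ! (i - 1) ! (j - 1)))
     \<and>
     \<comment> \<open>(c)\<close>
     (let lam = one_form \<alpha> \<beta> \<gamma> \<delta>;
          L = vfield \<alpha> \<beta> \<gamma> \<delta>;
          G = metric_tensor \<alpha> \<beta> \<gamma> \<delta>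
      in
     (\<forall>u\<in>S_domain. \<forall>i\<in>{1..6}. \<forall>j\<in>{1..6}.
        lam i u (L j u) = (if i = j then 1 else 0) \<and>
        G u (L i u) (L j u) = (if i = j then 1 else 0)) \<and>
     (\<forall>u\<in>S_domain.
        lie_bracket (L 1) (L 2) u = - (sqrt \<beta> / \<alpha>) *\<^sub>R L 3 u \<and>
        lie_bracket (L 2) (L 3) u = (1 / sqrt \<beta>) *\<^sub>R L 1 u \<and>
        lie_bracket (L 3) (L 1) u = (1 / sqrt \<beta>) *\<^sub>R L 2 u \<and>
        lie_bracket (L 1) (L 4) u = - (1 / (2 * sqrt \<alpha>)) *\<^sub>R L 5 u \<and>
        lie_bracket (L 1) (L 5) u = - (1 / (2 * sqrt \<alpha>)) *\<^sub>R L 4 u \<and>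
        lie_bracket (L 2) (L 4) u = - (1 / (2 * sqrt \<alpha>)) *\<^sub>R L 4 u \<and>
        lie_bracket (L 2) (L 5) u = (1 / (2 * sqrt \<alpha>)) *\<^sub>R L 5 u \<and>
        lie_bracket (L 3) (L 4) u = - (1 / (2 * sqrt \<beta>)) *\<^sub>R L 5 u \<and>
        lie_bracket (L 3) (L 5) u = (1 / (2 * sqrt \<beta>)) *\<^sub>R L 4 u \<and>
        lie_bracket (L 4) (L 5) u = (2 * sqrt \<delta> / \<gamma>) *\<^sub>R L 6 u \<and>
        (\<forall>i\<in>{1..5}. lie_bracket (L i) (L 6) u = 0)))
     \<and>
     \<comment> \<open>(d)\<close>
     (\<exists>h. tensor_in_variables (\<lambda>(x, y, \<theta>, p, q, \<kappa>). (x, y)) (metric_tensor \<alpha> 0 0 0) h \<and>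
          invariant_metric SL2 moebius_act upper_half_plane coords_uhp h) \<and>
     (\<exists>h. tensor_in_variables (\<lambda>(x, y, \<theta>, p, q, \<kappa>). (x, y, \<theta>)) (metric_tensor \<alpha> \<beta> 0 0) h \<and>
          invariant_metric SL2 (**) SL2 coords_SL2 h) \<and>
     (\<exists>h. tensor_in_variables (\<lambda>(x, y, \<theta>, p, q, \<kappa>). (x, y, p, q)) (metric_tensor \<alpha> 0 \<gamma> 0) h \<and>
          invariant_metric (carrier jacobi) (l_coset jacobi) siegel_jacobi coords_siegel_jacobi h) \<and>
     (\<exists>h. tensor_in_variables (\<lambda>(x, y, \<theta>, p, q, \<kappa>). (x, y, p, q, \<kappa>)) (metric_tensor \<alpha> 0 \<gamma> \<delta>) h \<and>
          invariant_metric (carrier jacobi) (l_coset jacobi) ext_siegel_jacobi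
            coords_ext_siegel_jacobi h) \<and>
     invariant_metric (carrier jacobi) (mult jacobi) (carrier jacobi) has_S_coords
       (metric_tensor \<alpha> \<beta> \<gamma> \<delta>)"
proof -
  have a: "let a = sqrt y * cos \<theta> - x / sqrt y * sin \<theta>;
             b = sqrt y * sin \<theta> + x / sqrt y * cos \<theta>;
             c = - (1 / sqrt y) * sin \<theta>;
             d = 1 / sqrt y * cos \<theta>;
             l = p * a + q * c;
             m = p * b + q * d;
             \<Lambda> = (c * x' + d)\<^sup>2 + (c * y')\<^sup>2
         in fst g = mat2 a b c d \<and> fst (snd g) = vector [l, m] \<and>
            (\<forall>x\<^sub>1 y\<^sub>1 \<theta>\<^sub>1 p\<^sub>1 q\<^sub>1 \<kappa>\<^sub>1.
               has_S_coords (g \<otimes>\<^bsub>jacobi\<^esub> g') (x\<^sub>1, y\<^sub>1, \<theta>\<^sub>1, p\<^sub>1, q\<^sub>1, \<kappa>\<^sub>1) \<longleftrightarrow>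
               complex_of_real x\<^sub>1 + \<i> * complex_of_real y\<^sub>1 =
                 (complex_of_real ((a * x' + b) * (c * x' + d) + a * c * y'\<^sup>2)
                  + \<i> * complex_of_real y') / complex_of_real \<Lambda> \<and>
               sin \<theta>\<^sub>1 = ((c * x' + d) * sin \<theta>' - c * y' * cos \<theta>') / sqrt \<Lambda> \<and>
               cos \<theta>\<^sub>1 = (c * y' * sin \<theta>' + (c * x' + d) * cos \<theta>') / sqrt \<Lambda> \<and>
               p\<^sub>1 = p + d * p' - c * q' \<and>
               q\<^sub>1 = q - b * p' + a * q' \<and>
               \<kappa>\<^sub>1 = \<kappa> + \<kappa>' + l * q' - m * p')"
    if "has_S_coords g (x, y, \<theta>, p, q, \<kappa>)" "has_S_coords g' (x', y', \<theta>', p', q', \<kappa>')"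
    for g g' x y \<theta> p q \<kappa> x' y' \<theta>' p' q' \<kappa>'
  proof -
    have y: "y > 0" "y' > 0"
      and g: "g = s_point (x, y, \<theta>, p, q, \<kappa>)" "g' = s_point (x', y', \<theta>', p', q', \<kappa>')"
      using that by (simp_all add: has_S_coords_iff)
    have "fst g = mat2 (entry_a x y \<theta>) (entry_b x y \<theta>) (entry_c x y \<theta>) (entry_d x y \<theta>)"
      "fst (snd g) = vector [p * entry_a x y \<theta> + q * entry_c x y \<theta>, p * entry_b x y \<theta> + q * entry_d x y \<theta>]"
      by (simp_all add: g s_point_def)
    then show ?thesis
      unfolding Let_def complex_quotient_eq_iff g
        entry_a_def[of x y \<theta>, symmetric] entry_b_def[of x y \<theta>, symmetric]
        entry_c_def[of x y \<theta>, symmetric] entry_d_def[of x y \<theta>, symmetric]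
        composition_law[OF y] by (intro conjI allI) simp_all
  qed
  have b: "\<forall>u\<in>S_domain. \<forall>v. (\<Sum>i = 1..6. (one_form \<alpha> \<beta> \<gamma> \<delta> i u v)\<^sup>2) = ds2 \<alpha> \<beta> \<gamma> \<delta> u v"
    using sum_squares_one_form pos by (meson less_imp_le)
  have sym: "metric_matrix \<alpha> \<beta> \<gamma> \<delta> u i j = metric_matrix \<alpha> \<beta> \<gamma> \<delta> u j i" for u i j
    by (simp add: metric_matrix_def metric_tensor_def add.commute)
  have block: "metric_matrix \<alpha> \<beta> \<gamma> \<delta> u i j = 0"
    if u: "u \<in> S_domain" and ij: "i \<in> {1..6}" "j \<in> {1..6}" "i \<le> 3" "j > 3" for u i j
  proof (cases u)
    case (fields x y \<theta> p q \<kappa>)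
    have "i \<in> {1, 2, 3}" "j \<in> {4, 5, 6}" using ij by auto
    then show ?thesis
      using metric_matrix_entries[of y i j] ij u by (auto simp: fields)
  qed
  have c: "let lam = one_form \<alpha> \<beta> \<gamma> \<delta>;
          L = vfield \<alpha> \<beta> \<gamma> \<delta>;
          G = metric_tensor \<alpha> \<beta> \<gamma> \<delta>
      in (\<forall>u\<in>S_domain. \<forall>i\<in>{1..6}. \<forall>j\<in>{1..6}.
        lam i u (L j u) = (if i = j then 1 else 0) \<and>
        G u (L i u) (L j u) = (if i = j then 1 else 0)) \<and>
     (\<forall>u\<in>S_domain.
        lie_bracket (L 1) (L 2) u = - (sqrt \<beta> / \<alpha>) *\<^sub>R L 3 u \<and>
        lie_bracket (L 2) (L 3) u = (1 / sqrt \<beta>) *\<^sub>R L 1 u \<and>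
        lie_bracket (L 3) (L 1) u = (1 / sqrt \<beta>) *\<^sub>R L 2 u \<and>
        lie_bracket (L 1) (L 4) u = - (1 / (2 * sqrt \<alpha>)) *\<^sub>R L 5 u \<and>
        lie_bracket (L 1) (L 5) u = - (1 / (2 * sqrt \<alpha>)) *\<^sub>R L 4 u \<and>
        lie_bracket (L 2) (L 4) u = - (1 / (2 * sqrt \<alpha>)) *\<^sub>R L 4 u \<and>
        lie_bracket (L 2) (L 5) u = (1 / (2 * sqrt \<alpha>)) *\<^sub>R L 5 u \<and>
        lie_bracket (L 3) (L 4) u = - (1 / (2 * sqrt \<beta>)) *\<^sub>R L 5 u \<and>
        lie_bracket (L 3) (L 5) u = (1 / (2 * sqrt \<beta>)) *\<^sub>R L 4 u \<and>
        lie_bracket (L 4) (L 5) u = (2 * sqrt \<delta> / \<gamma>) *\<^sub>R L 6 u \<and>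
        (\<forall>i\<in>{1..5}. lie_bracket (L i) (L 6) u = 0))"
    unfolding Let_def
    by (intro conjI ballI one_form_vfield_dual vfield_orthonormal commutators pos; assumption)
  show ?thesis
    by (intro conjI allI impI ballI a b[rule_format] sym block c metric_matrix_entries
        invariant_metric_jacobi invariant_metric_upper_half_plane invariant_metric_SL2
        invariant_metric_siegel_jacobi invariant_metric_ext_siegel_jacobi pos; (elim conjE)?; assumption?)
qed

end
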